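(* Let $F:[0,1]\to[0,1]$ be an admissible parabolic map (as defined in the context), with parameter $s>0$ at the indifferent fixed point and invariant measure $\mu$. Then there exists a constant $c_s>0$, depending only on the system and not on the hole, such that for the Markov holes $H:=[0,a_N]$, $N\ge2$, as $N\to\infty$ (equivalently, as $m(H)\to0^+$), $$\gamma_\mu(H)\sim\begin{cases}c_s\cdot m(H),&\text{if } s\in(0,1);\\[0.1cm] c_s\cdot\dfrac{m(H)}{-\log m(H)},&\text{if } s=1;\\[0.2cm] c_s\cdot m(H)^s,&\text{if } s>1.\end{cases}$$
   Context: **Parabolic maps.** $m$ is Lebesgue measure on $[0,1]$. Consider maps $F:[0,1]\to[0,1]$ such that: (H1) for some $a\in(0,1)$, with $J_0:=[0,a]$, $J_1:=(a,1]$, $F$ is monotone on each of $J_0,J_1$ and has full branches: $F(J_0)=\overline{F(J_1)}=[0,1]$. (H2) for some $r\in\mathbb N\cup\{\infty\}$, $r\ge1$, $F_0:=F|_{J_0}$ is $C^r$ on $(0,a)$ and extends to a $C^r$ function on $(0,a]$, and $F_1:=F|_{J_1}$ is $C^r$ on $(a,1)$ and extends to a $C^r$ function on $[a,1]$. Let $\phi_i:=F_i^{-1}$ be the local inverses (extended by continuity to $[0,1]$). (H3) $F(0)=0$ and $F'(x)-1\sim c\,x^s$ as $x\to0^+$ for some $c>0$, $s>0$. (H4) there are $\varepsilon>0$, $\beta>1$ such that $F'$ is increasing on $(0,\varepsilon)$ and $|F'(x)|\ge\beta$ for all $x\ge\varepsilon$. (H5) $F$ admits a unique ergodic conservative invariant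 measure $\mu$ (finite or $\sigma$-finite infinite) equivalent to $m$, in the sense that $\mu$ is absolutely continuous with density bounded away from $0$. Put $a_0:=1$, $a_1:=a$, $a_n:=\phi_0(a_{n-1})$ for $n\ge2$ (a sequence decreasing to $0$). A Markov hole is an interval $[0,a_N]$ with $N\ge2$. **Symbolic representation.** $\Omega=\{0,1\}^{\mathbb N_0}$ with left shift $T$. The coding $\pi:\Omega\to[0,1]$ is $\pi(\omega)=x$ iff $F^i(x)\in J_{\omega_i}$ for all $i\ge0$, extended by continuity to the countably many strings not arising in this way. Let $\tau_0(\omega)=1+\inf\{i\ge0:\omega_i=1\}$, $\tau_k(\omega)=1+\inf\{i\ge\tau_{k-1}(\omega):\omega_i=1\}$ for $k\ge1$, let $0^\infty$ be the constant string of zeros, $\Omega_0:=\Omega\setminus\bigcup_{i\ge0}T^{-i}(0^\infty)$, $\sigma_0=\tau_0$, $\sigma_k=\tau_k-\tau_{k-1}$. Let $\Sigma=\mathbb N^{\mathbb N_0}$ ($\mathbb N=\{1,2,\dots\}$), $[n]:=\{\sigma\in\Sigma:\sigma_0=n\}$, and let $\iota:\Omega_0\to\Sigma$ be the homeomorphism $\iota(\omega)=(\sigma_0(\omega)\sigma_1(\omega)\dots)$. **Potentials.** $V(\omega)=\log|\phi_{\omega_0}'(\pi(\omega_1\omega_2\dots))|$ on $\Omega$; $W(\omega)=\sum_{i=0}^{\tau_0(\omega)-1}V(T^i\omega)$, regarded as a function on $\Sigma$ via $\iota^{-1}$. It is assumed that, for a fixed $\theta\in(0,1)$: (W1) there is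 $C_2\in(0,\infty)$ such that for all $n\ge1$, $\sup\{|W(\sigma)-W(\sigma')|:\inf\{j\ge0:\sigma_j\ne\sigma'_j\}=n\}\le C_2\theta^n$. (W2) there is $C_3\in(0,\infty)$ such that $\sum_{n\ge1}\exp(\sup_{\sigma\in[n]}W(\sigma))<C_3$. An *admissible parabolic map* is a map satisfying (H1)-(H5) and (W1)-(W2). **Escape rate.** For a hole $H\subset[0,1]$, $\gamma_\mu(H)=\limsup_{n\to\infty}-\frac1n\log\mu\{x\in[0,1]:F^j(x)\notin H,\ 0\le j\le n-1\}$. Here $f\sim g$ means that the ratio $f/g$ tends to $1$ in the indicated limit. *)

theory Defs
  imports "HOL-Analysis.Analysis" "HOL-Library.Landau_Symbols" "HOL-Library.Extended_Nat"
begin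

section \<open>Branches of the map\<close>

text \<open>
  The symbols 0 and 1 are encoded as \<^const>\<open>False\<close> and \<^const>\<open>True\<close>, so that \<open>{0,1}\<^sup>\<nat>\<close> is
  the whole type \<^typ>\<open>nat \<Rightarrow> bool\<close>, which carries the product topology of the library.
\<close>

definition branch_dom :: "real \<Rightarrow> bool \<Rightarrow> real set" where
  "branch_dom a i = (if i then {a<..1} else {0..a})"

text \<open>Derivative of the branch of \<open>F\<close> containing \<open>x\<close>; it is one-sided at \<open>0\<close>, \<open>a\<close> and \<open>1\<close>.\<close>

definition branch_deriv :: "(real \<Rightarrow> real) \<Rightarrow> real \<Rightarrow> real \<Rightarrow> real" where
  "branch_deriv F a x = vector_derivative F (at x within branch_dom a (a < x))"

text \<open>
  Local inverses. The image of the second branch is in general only dense in \<open>[0,1]\<close>;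
  the missing endpoint gets the limit value.
\<close>

definition local_inv :: "(real \<Rightarrow> real) \<Rightarrow> real \<Rightarrow> bool \<Rightarrow> real \<Rightarrow> real" where
  "local_inv F a i y =
     (let J = branch_dom a i in
      if y \<in> F ` J then the_inv_into J F y
      else Lim (at y within F ` J) (the_inv_into J F))"

text \<open>
  \<open>C\<^sup>r\<close> functions on an interval \<open>S\<close>, with one-sided derivatives at endpoints belonging to \<open>S\<close>;
  \<open>D i\<close> is the \<open>i\<close>-th derivative.
\<close>

definition Cr_on :: "enat \<Rightarrow> (real \<Rightarrow> real) \<Rightarrow> real set \<Rightarrow> bool" where
  "Cr_on r f S \<longleftrightarrow>
     (\<exists>D :: nat \<Rightarrow> real \<Rightarrow> real.
        (\<forall>x\<in>S. D 0 x = f x) \<and>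
        (\<forall>i. enat i < r \<longrightarrow> (\<forall>x\<in>S. (D i has_real_derivative D (Suc i) x) (at x within S))) \<and>
        (\<forall>i. enat i \<le> r \<longrightarrow> continuous_on S (D i)))"

definition Cr_extends :: "enat \<Rightarrow> (real \<Rightarrow> real) \<Rightarrow> real set \<Rightarrow> real set \<Rightarrow> bool" where
  "Cr_extends r f S S' \<longleftrightarrow> (\<exists>g. Cr_on r g S' \<and> (\<forall>x\<in>S. g x = f x))"


section \<open>Conditions on the map\<close>

definition H1 :: "(real \<Rightarrow> real) \<Rightarrow> real \<Rightarrow> bool" where
  "H1 F a \<longleftrightarrow>
     0 < a \<and> a < 1 \<and>
     F \<in> {0..1} \<rightarrow> {0..1} \<and>
     (\<forall>i. mono_on (branch_dom a i) F \<or> antimono_on (branch_dom a i) F) \<and>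
     F ` branch_dom a False = {0..1} \<and>
     closure (F ` branch_dom a True) = {0..1}"

definition H2 :: "(real \<Rightarrow> real) \<Rightarrow> real \<Rightarrow> enat \<Rightarrow> bool" where
  "H2 F a r \<longleftrightarrow>
     1 \<le> r \<and>
     Cr_on r F {0<..<a} \<and> Cr_extends r F {0<..<a} {0<..a} \<and>
     Cr_on r F {a<..<1} \<and> Cr_extends r F {a<..<1} {a..1}"

definition H3 :: "(real \<Rightarrow> real) \<Rightarrow> real \<Rightarrow> real \<Rightarrow> real \<Rightarrow> bool" where
  "H3 F a c s \<longleftrightarrow>
     F 0 = 0 \<and> 0 < c \<and> 0 < s \<and>
     (\<lambda>x. branch_deriv F a x - 1) \<sim>[at_right 0] (\<lambda>x. c * x powr s)"

definition H4 :: "(real \<Rightarrow> real) \<Rightarrow> real \<Rightarrow> bool" where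
  "H4 F a \<longleftrightarrow>
     (\<exists>\<epsilon> \<beta>. 0 < \<epsilon> \<and> 1 < \<beta> \<and>
        mono_on ({0<..<\<epsilon>} \<inter> {0..1}) (branch_deriv F a) \<and>
        (\<forall>x\<in>{\<epsilon>..1}. \<beta> \<le> \<bar>branch_deriv F a x\<bar>))"

definition unit_lebesgue :: "real measure" where
  "unit_lebesgue = restrict_space lborel {0..1}"

definition invariant_measure :: "'a measure \<Rightarrow> ('a \<Rightarrow> 'a) \<Rightarrow> bool" where
  "invariant_measure M f \<longleftrightarrow> f \<in> measurable M M \<and> distr M M f = M"

definition ergodic :: "'a measure \<Rightarrow> ('a \<Rightarrow> 'a) \<Rightarrow> bool" where
  "ergodic M f \<longleftrightarrow>
     (\<forall>A\<in>sets M. f -` A \<inter> space M = A \<longrightarrow> emeasure M A = 0 \<or> emeasure M (space M - A) = 0)"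

text \<open>Conservativity: every wandering set is null.\<close>

definition conservative :: "'a measure \<Rightarrow> ('a \<Rightarrow> 'a) \<Rightarrow> bool" where
  "conservative M f \<longleftrightarrow>
     (\<forall>A\<in>sets M. disjoint_family (\<lambda>n. (f ^^ n) -` A \<inter> space M) \<longrightarrow> emeasure M A = 0)"

definition equivalent_to_lebesgue :: "real measure \<Rightarrow> bool" where
  "equivalent_to_lebesgue \<mu> \<longleftrightarrow>
     (\<exists>h \<in> borel_measurable unit_lebesgue.
        \<mu> = density unit_lebesgue h \<and>
        (\<exists>\<delta>>0. AE x in unit_lebesgue. ennreal \<delta> \<le> h x))"

definition ergodic_conservative_acim :: "(real \<Rightarrow> real) \<Rightarrow> real measure \<Rightarrow> bool" where
  "ergodic_conservative_acim F \<mu> \<longleftrightarrow>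
     sigma_finite_measure \<mu> \<and> equivalent_to_lebesgue \<mu> \<and>
     invariant_measure \<mu> F \<and> ergodic \<mu> F \<and> conservative \<mu> F"

text \<open>
  Since \<open>\<mu>\<close> may be infinite there is no normalisation, and uniqueness can only hold up to a
  positive constant factor.
\<close>

definition H5 :: "(real \<Rightarrow> real) \<Rightarrow> real measure \<Rightarrow> bool" where
  "H5 F \<mu> \<longleftrightarrow>
     ergodic_conservative_acim F \<mu> \<and>
     (\<forall>\<nu>. ergodic_conservative_acim F \<nu> \<longrightarrow> (\<exists>t::real. 0 < t \<and> \<nu> = scale_measure (ennreal t) \<mu>))"


section \<open>Symbolic representation\<close>

definition shift :: "(nat \<Rightarrow> 'a) \<Rightarrow> nat \<Rightarrow> 'a" where
  "shift \<omega> = (\<lambda>n. \<omega> (Suc n))"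

definition codes :: "(real \<Rightarrow> real) \<Rightarrow> real \<Rightarrow> (nat \<Rightarrow> bool) \<Rightarrow> real \<Rightarrow> bool" where
  "codes F a \<omega> x \<longleftrightarrow> x \<in> {0..1} \<and> (\<forall>i. (F ^^ i) x \<in> branch_dom a (\<omega> i))"

definition coding :: "(real \<Rightarrow> real) \<Rightarrow> real \<Rightarrow> (nat \<Rightarrow> bool) \<Rightarrow> real" where
  "coding F a \<omega> =
     (let D = {\<omega>. \<exists>x. codes F a \<omega> x}; p = (\<lambda>\<omega>. THE x. codes F a \<omega> x) in
      if \<omega> \<in> D then p \<omega> else Lim (at \<omega> within D) p)"

fun tau :: "(nat \<Rightarrow> bool) \<Rightarrow> nat \<Rightarrow> nat" where
  "tau \<omega> 0 = 1 + Inf {i. \<omega> i}"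
| "tau \<omega> (Suc k) = 1 + Inf {i. tau \<omega> k \<le> i \<and> \<omega> i}"

definition Omega0 :: "(nat \<Rightarrow> bool) set" where
  "Omega0 = UNIV - (\<Union>i. (shift ^^ i) -` {\<lambda>_. False})"

definition Sigma_space :: "(nat \<Rightarrow> nat) set" where
  "Sigma_space = {\<sigma>. \<forall>k. 1 \<le> \<sigma> k}"

definition Sigma_cylinder :: "nat \<Rightarrow> (nat \<Rightarrow> nat) set" where
  "Sigma_cylinder n = {\<sigma>\<in>Sigma_space. \<sigma> 0 = n}"

definition iota :: "(nat \<Rightarrow> bool) \<Rightarrow> nat \<Rightarrow> nat" where
  "iota \<omega> k = (case k of 0 \<Rightarrow> tau \<omega> 0 | Suc j \<Rightarrow> tau \<omega> (Suc j) - tau \<omega> j)"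


section \<open>Potentials\<close>

text \<open>The derivative of a local inverse is one-sided at the endpoints of \<open>[0,1]\<close>.\<close>

definition V_pot :: "(real \<Rightarrow> real) \<Rightarrow> real \<Rightarrow> (nat \<Rightarrow> bool) \<Rightarrow> real" where
  "V_pot F a \<omega> =
     ln \<bar>vector_derivative (local_inv F a (\<omega> 0)) (at (coding F a (shift \<omega>)) within {0..1})\<bar>"

definition W_Omega :: "(real \<Rightarrow> real) \<Rightarrow> real \<Rightarrow> (nat \<Rightarrow> bool) \<Rightarrow> real" where
  "W_Omega F a \<omega> = (\<Sum>i<tau \<omega> 0. V_pot F a ((shift ^^ i) \<omega>))"

definition W_pot :: "(real \<Rightarrow> real) \<Rightarrow> real \<Rightarrow> (nat \<Rightarrow> nat) \<Rightarrow> real" where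
  "W_pot F a \<sigma> = W_Omega F a (the_inv_into Omega0 iota \<sigma>)"

text \<open>
  The guard \<open>\<sigma> \<noteq> \<sigma>'\<close> reflects that the infimum of the empty set is \<open>\<infinity>\<close>, whereas
  \<^term>\<open>Inf {} :: nat\<close> is \<open>0\<close>.
\<close>

definition W1 :: "(real \<Rightarrow> real) \<Rightarrow> real \<Rightarrow> real \<Rightarrow> bool" where
  "W1 F a \<theta> \<longleftrightarrow>
     (\<exists>C>0. \<forall>n\<ge>1.
        (SUP (\<sigma>, \<sigma>') \<in> {(\<sigma>, \<sigma>'). \<sigma> \<in> Sigma_space \<and> \<sigma>' \<in> Sigma_space \<and> \<sigma> \<noteq> \<sigma>' \<and>
                                 Inf {j. \<sigma> j \<noteq> \<sigma>' j} = n}.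
           ereal \<bar>W_pot F a \<sigma> - W_pot F a \<sigma>'\<bar>) \<le> ereal (C * \<theta> ^ n))"

definition W2 :: "(real \<Rightarrow> real) \<Rightarrow> real \<Rightarrow> bool" where
  "W2 F a \<longleftrightarrow>
     (\<forall>n\<ge>1. bdd_above (W_pot F a ` Sigma_cylinder n)) \<and>
     (\<exists>C>0. (\<Sum>n. ennreal (exp (SUP \<sigma>\<in>Sigma_cylinder (Suc n). W_pot F a \<sigma>))) < ennreal C)"

definition admissible_parabolic_map ::
    "(real \<Rightarrow> real) \<Rightarrow> real \<Rightarrow> enat \<Rightarrow> real \<Rightarrow> real \<Rightarrow> real \<Rightarrow> real measure \<Rightarrow> bool" where
  "admissible_parabolic_map F a r c s \<theta> \<mu> \<longleftrightarrow>
     H1 F a \<and> H2 F a r \<and> H3 F a c s \<and> H4 F a \<and> H5 F \<mu> \<and>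
     0 < \<theta> \<and> \<theta> < 1 \<and> W1 F a \<theta> \<and> W2 F a"


section \<open>Markov holes and escape rates\<close>

fun a_seq :: "(real \<Rightarrow> real) \<Rightarrow> real \<Rightarrow> nat \<Rightarrow> real" where
  "a_seq F a 0 = 1"
| "a_seq F a (Suc 0) = a"
| "a_seq F a (Suc (Suc n)) = local_inv F a False (a_seq F a (Suc n))"

definition markov_hole :: "(real \<Rightarrow> real) \<Rightarrow> real \<Rightarrow> nat \<Rightarrow> real set" where
  "markov_hole F a N = {0..a_seq F a N}"

text \<open>Logarithm with \<open>log 0 = -\<infinity>\<close> and \<open>log \<infinity> = \<infinity>\<close>.\<close>

definition ext_ln :: "ennreal \<Rightarrow> ereal" where
  "ext_ln x = (if x = 0 then -\<infinity> else if x = \<infinity> then \<infinity> else ereal (ln (enn2real x)))"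

definition escape_rate :: "real measure \<Rightarrow> (real \<Rightarrow> real) \<Rightarrow> real set \<Rightarrow> ereal" where
  "escape_rate \<mu> F H =
     limsup (\<lambda>n. - (ext_ln (emeasure \<mu> {x \<in> {0..1}. \<forall>j<n. (F ^^ j) x \<notin> H}) / ereal (real n)))"

end

theory Submission
  imports Defs "HOL-Real_Asymp.Real_Asymp"
begin

text \<open>
  Inducing on the second branch gives a full-branch map whose transfer operator contracts the
  log-Hoelder densities, by (W1), towards a fixed density \<open>h\<close>. For the hole \<open>[0,a\<^sub>N]\<close> and a
  candidate rate \<open>\<gamma>\<close>, let \<open>L\<^sub>\<gamma>\<close> be the induced operator in which a return after \<open>j + 1 \<le> N\<close>
  steps is weighted by \<open>exp (\<gamma> (j + 1))\<close> and later returns are dropped. A positive \<open>u\<close> with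
  \<open>L\<^sub>\<gamma> u \<ge> u\<close> (or \<open>\<le> u\<close>), summed along the tower over the inducing scheme, becomes a function
  whose integral over the surviving points decays at most (at least) like \<open>exp (- \<gamma> t)\<close>.
  Taking for \<open>u\<close> the sum of \<open>h\<close> and an approximate solution of a coboundary equation, the sign of
  \<open>L\<^sub>\<gamma> u - u\<close> is, up to second order, that of
  \<open>(\<Sum>j<N. (exp (\<gamma> (j + 1)) - 1) q\<^sub>j) - (\<Sum>j\<ge>N. q\<^sub>j)\<close>, where \<open>q\<^sub>j\<close> is the \<open>h\<close>-mass of \<open>[a\<^bsub>j+1\<^esub>,a\<^sub>j]\<close>.
  As \<open>a\<^sub>n\<close> is asymptotic to a multiple of \<open>n\<close> to the power \<open>- 1 / s\<close> and \<open>h\<close> is continuous and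
  positive at \<open>0\<close>, the zero of this expression has the claimed asymptotics.
\<close>

section \<open>The transfer operator of a full-branch system\<close>

text \<open>No eigenvalue of the induced operators is computed. One-sided inequalities suffice,
  tested at rates \<open>z * rate\<close> with \<open>z \<noteq> 1\<close> fixed: the first-order
  term then has a definite sign and a size comparable with the total perturbation, so the error
  terms cannot reverse it for large \<open>N\<close>. The obstacle is that \<open>F\<close> does not
  expand uniformly near 0 and that \<mu> may be infinite, with a density unbounded at 0. Inducing
  removes the first difficulty. As for the second, survivors stay in \<open>(a_N, 1]\<close>, where
  the density is bounded, and constants depending on \<open>N\<close> do not affect an exponential
  rate. The three regimes come from the product of the rate with \<open>N\<close>. For s \<le> 1 it
  tends to 0, the exponential linearises, and the rate is to first order the mass of the hole
  divided by a truncated mean return time, which converges for s < 1 and grows like a logarithm for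
  s = 1. For s > 1 it tends to a positive constant, every order of the exponential contributes, and
  the constant comes from a transcendental equation.\<close>

lemma integral_ge_const:
  fixes f :: "real \<Rightarrow> real"
  assumes "continuous_on {0..1} f" "\<And>x. x \<in> {0..1} \<Longrightarrow> c \<le> f x"
  shows "c \<le> integral {0..1} f"
proof -
  have "integral {0..1} (\<lambda>_::real. c) \<le> integral {0..1} f"
    by (rule integral_le) (auto intro: assms integrable_continuous_real)
  then show ?thesis by simp
qed

lemma integral_le_const:
  fixes f :: "real \<Rightarrow> real"
  assumes "continuous_on {0..1} f" "\<And>x. x \<in> {0..1} \<Longrightarrow> f x \<le> c"
  shows "integral {0..1} f \<le> c"
proof -
  have "integral {0..1} f \<le> integral {0..1} (\<lambda>_::real. c)"
    by (rule integral_le) (auto intro: assms integrable_continuous_real)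
  then show ?thesis by simp
qed

text \<open>The change of variables enters as the assumption \<open>substitution\<close>, so that
  neither derivatives nor the orientation of a branch occur here. Iterated branches are words:
  \<open>foldr \<Psi> w\<close> composes the branches named by \<open>w\<close>. The exponent
  \<open>Suc (length w)\<close> in \<open>distortion\<close> counts the letter \<open>j\<close>
  besides those of \<open>w\<close>, the way (W1) counts common symbols.\<close>

locale full_branch_system =
  fixes A :: "nat \<Rightarrow> real" and \<Psi> \<l> :: "nat \<Rightarrow> real \<Rightarrow> real" and \<theta> C :: real
  assumes A_0: "A 0 = 1"
    and A_Suc_less: "A (Suc j) < A j"
    and A_lim: "A \<longlonglongrightarrow> 0"
    and theta: "0 < \<theta>" "\<theta> < 1"
    and C_pos: "0 < C"
    and Psi_cont: "continuous_on {0..1} (\<Psi> j)"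
    and Psi_mem: "x \<in> {0..1} \<Longrightarrow> \<Psi> j x \<in> {A (Suc j)..A j}"
    and weight_cont: "continuous_on {0..1} (\<l> j)"
    and weight_pos: "x \<in> {0..1} \<Longrightarrow> 0 < \<l> j x"
    and substitution: "continuous_on {0..1} f \<Longrightarrow>
      integral {0..1} (\<lambda>x. \<l> j x * f (\<Psi> j x)) = integral {A (Suc j)..A j} f"
    and distortion: "x \<in> {0..1} \<Longrightarrow> y \<in> {0..1} \<Longrightarrow>
      \<l> j (foldr \<Psi> w x) \<le> exp (C * \<theta> ^ Suc (length w)) * \<l> j (foldr \<Psi> w y)"
begin

lemma A_decseq: "decseq A"
  using A_Suc_less by (intro decseq_SucI) (simp add: less_imp_le)

lemma A_nonneg: "0 \<le> A n"
  using A_decseq A_lim decseq_ge by blast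

lemma A_pos: "0 < A n"
  using A_nonneg[of "Suc n"] A_Suc_less[of n] by linarith

lemma A_le_1: "A n \<le> 1"
  using A_decseq A_0 by (metis decseqD le0)

lemma Psi_unit: "x \<in> {0..1} \<Longrightarrow> \<Psi> j x \<in> {0..1}"
  using Psi_mem[of x j] A_nonneg[of "Suc j"] A_le_1[of j] by auto

lemma word_unit: "x \<in> {0..1} \<Longrightarrow> foldr \<Psi> w x \<in> {0..1}"
  by (induction w) (use Psi_unit in auto)

lemma gap_sums: "(\<lambda>j. A j - A (Suc j)) sums 1"
  using telescope_sums'[OF A_lim] A_0 by simp

lemma integral_weight: "integral {0..1} (\<l> j) = A j - A (Suc j)"
  using substitution[of "\<lambda>_. 1" j] A_Suc_less[of j] by simp

lemma weight_ratio: "x \<in> {0..1} \<Longrightarrow> y \<in> {0..1} \<Longrightarrow> \<l> j x \<le> exp (C * \<theta>) * \<l> j y"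
  using distortion[of x y j "[]"] by simp

lemma weight_le:
  assumes "x \<in> {0..1}" shows "\<l> j x \<le> exp (C * \<theta>) * (A j - A (Suc j))"
proof -
  have "\<l> j x \<le> integral {0..1} (\<lambda>y. exp (C * \<theta>) * \<l> j y)"
    by (rule integral_ge_const) (intro continuous_intros weight_cont weight_ratio assms, assumption?)+
  then show ?thesis by (simp add: integral_weight)
qed

lemma weight_ge:
  assumes "x \<in> {0..1}" shows "A j - A (Suc j) \<le> exp (C * \<theta>) * \<l> j x"
proof -
  have "integral {0..1} (\<l> j) \<le> exp (C * \<theta>) * \<l> j x"
    by (rule integral_le_const) (intro continuous_intros weight_cont weight_ratio assms, assumption?)+
  then show ?thesis by (simp add: integral_weight)
qed

section \<open>Weighted transfer operators\<close>

definition wtransfer :: "(nat \<Rightarrow> real) \<Rightarrow> (real \<Rightarrow> real) \<Rightarrow> real \<Rightarrow> real" where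
  "wtransfer b f x = (\<Sum>j. b j * (\<l> j x * f (\<Psi> j x)))"

abbreviation "transfer \<equiv> wtransfer (\<lambda>_. 1)"

text \<open>
  Nonnegative functions whose logarithm is Hoelder with constant \<open>k\<close> in the symbolic metric: two
  points with \<open>n\<close> common letters have distance \<open>\<theta> ^ n\<close>.
\<close>

definition reg :: "real \<Rightarrow> (real \<Rightarrow> real) \<Rightarrow> bool" where
  "reg k f \<longleftrightarrow> continuous_on {0..1} f \<and> (\<forall>x\<in>{0..1}. 0 \<le> f x) \<and>
     (\<forall>w. \<forall>x\<in>{0..1}. \<forall>y\<in>{0..1}. f (foldr \<Psi> w x) \<le> exp (k * \<theta> ^ length w) * f (foldr \<Psi> w y))"

lemma comp_Psi_cont:
  "continuous_on {0..1} f \<Longrightarrow> continuous_on {0..1} (\<lambda>x. f (\<Psi> j x))"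
  by (rule continuous_on_compose2[OF _ Psi_cont]) (use Psi_unit in auto)

lemma cont_bound:
  fixes f :: "real \<Rightarrow> real"
  assumes "continuous_on {0..1} f"
  obtains B where "B > 0" "\<And>x. x \<in> {0..1} \<Longrightarrow> \<bar>f x\<bar> \<le> B"
proof -
  have "bounded (f ` {0..1})"
    using assms compact_continuous_image compact_imp_bounded by blast
  then obtain B where "B > 0" "\<forall>y\<in>f ` {0..1}. norm y \<le> B" by (meson bounded_pos)
  then show ?thesis using that by auto
qed

text \<open>By bounded distortion each weight is comparable with its mean, the gap length
  \<open>A j - A (Suc j)\<close>, and these lengths telescope to 1. This one summable majorant
  yields absolute and uniform convergence of the series, continuity and termwise
  integration.\<close>

lemma wtransfer_term_bound:
  assumes "Bseq b" "continuous_on {0..1} f"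
  obtains M where "\<And>j x. x \<in> {0..1} \<Longrightarrow> \<bar>b j * (\<l> j x * f (\<Psi> j x))\<bar> \<le> M * (A j - A (Suc j))"
proof -
  obtain D where D: "D > 0" "\<And>n. norm (b n) \<le> D" using assms(1) by (auto simp: Bseq_def)
  obtain B where B: "B > 0" "\<And>x. x \<in> {0..1} \<Longrightarrow> \<bar>f x\<bar> \<le> B" using cont_bound[OF assms(2)] by blast
  show ?thesis
  proof (rule that)
    fix j and x :: real assume x: "x \<in> {0..1}"
    have "\<bar>b j * (\<l> j x * f (\<Psi> j x))\<bar> = \<bar>b j\<bar> * (\<l> j x * \<bar>f (\<Psi> j x)\<bar>)"
      using weight_pos[OF x, of j] by (simp add: abs_mult)
    also have "\<dots> \<le> D * ((exp (C * \<theta>) * (A j - A (Suc j))) * B)"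
      using D(2)[of j] D(1) B(2)[OF Psi_unit[OF x, of j]] B(1) weight_le[OF x, of j] weight_pos[OF x, of j]
        A_Suc_less[of j]
      by (intro mult_mono) auto
    finally show "\<bar>b j * (\<l> j x * f (\<Psi> j x))\<bar> \<le> (D * exp (C * \<theta>) * B) * (A j - A (Suc j))"
      by (simp add: mult_ac)
  qed
qed

lemma wtransfer_summable_abs:
  assumes "Bseq b" "continuous_on {0..1} f" "x \<in> {0..1}"
  shows "summable (\<lambda>j. \<bar>b j * (\<l> j x * f (\<Psi> j x))\<bar>)"
proof -
  obtain M where "\<And>j x. x \<in> {0..1} \<Longrightarrow> \<bar>b j * (\<l> j x * f (\<Psi> j x))\<bar> \<le> M * (A j - A (Suc j))"
    using wtransfer_term_bound[OF assms(1,2)] by blast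
  then show ?thesis
    using assms(3) by (intro summable_comparison_test'[OF summable_mult[OF sums_summable[OF gap_sums]]]) auto
qed

lemma wtransfer_summable:
  assumes "Bseq b" "continuous_on {0..1} f" "x \<in> {0..1}"
  shows "summable (\<lambda>j. b j * (\<l> j x * f (\<Psi> j x)))"
  using wtransfer_summable_abs[OF assms] by (rule summable_rabs_cancel)

lemma wtransfer_sums:
  assumes "Bseq b" "continuous_on {0..1} f" "x \<in> {0..1}"
  shows "(\<lambda>j. b j * (\<l> j x * f (\<Psi> j x))) sums wtransfer b f x"
  unfolding wtransfer_def using wtransfer_summable[OF assms] by (rule summable_sums)

lemma wtransfer_uniform_limit:
  assumes "Bseq b" "continuous_on {0..1} f"
  shows "uniform_limit {0..1} (\<lambda>n x. \<Sum>j<n. b j * (\<l> j x * f (\<Psi> j x))) (wtransfer b f) sequentially"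
proof -
  obtain M where "\<And>j x. x \<in> {0..1} \<Longrightarrow> \<bar>b j * (\<l> j x * f (\<Psi> j x))\<bar> \<le> M * (A j - A (Suc j))"
    using wtransfer_term_bound[OF assms(1,2)] by blast
  then have "uniform_limit {0..1} (\<lambda>n x. \<Sum>j<n. b j * (\<l> j x * f (\<Psi> j x)))
     (\<lambda>x. \<Sum>j. b j * (\<l> j x * f (\<Psi> j x))) sequentially"
    by (intro Weierstrass_m_test[OF _ summable_mult[OF sums_summable[OF gap_sums]]]) auto
  then show ?thesis by (simp add: wtransfer_def[abs_def])
qed

lemma wtransfer_partial_cont:
  assumes "continuous_on {0..1} f"
  shows "continuous_on {0..1} (\<lambda>x. \<Sum>j<n. b j * (\<l> j x * f (\<Psi> j x)))"
  by (intro continuous_intros weight_cont comp_Psi_cont assms)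

lemma wtransfer_cont:
  assumes "Bseq b" "continuous_on {0..1} f"
  shows "continuous_on {0..1} (wtransfer b f)"
  by (rule uniform_limit_theorem[OF _ wtransfer_uniform_limit[OF assms]])
     (auto intro!: always_eventually wtransfer_partial_cont assms)

lemma wtransfer_integral_sums:
  assumes "Bseq b" "continuous_on {0..1} f"
  shows "(\<lambda>j. b j * integral {A (Suc j)..A j} f) sums integral {0..1} (wtransfer b f)"
proof -
  obtain I J where I: "\<And>n. ((\<lambda>x. \<Sum>j<n. b j * (\<l> j x * f (\<Psi> j x))) has_integral I n) {0..1}"
    and J: "(wtransfer b f has_integral J) {0..1}" "I \<longlonglongrightarrow> J"
    using uniform_limit_integral[OF wtransfer_uniform_limit[OF assms] wtransfer_partial_cont[OF assms(2)]] by auto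
  have "I n = (\<Sum>j<n. b j * integral {A (Suc j)..A j} f)" for n
  proof -
    have "I n = integral {0..1} (\<lambda>x. \<Sum>j<n. b j * (\<l> j x * f (\<Psi> j x)))"
      using I[of n] by (simp add: integral_unique)
    also have "\<dots> = (\<Sum>j<n. integral {0..1} (\<lambda>x. b j * (\<l> j x * f (\<Psi> j x))))"
      by (rule integral_sum)
         (auto intro!: integrable_continuous_real continuous_intros weight_cont comp_Psi_cont assms)
    also have "\<dots> = (\<Sum>j<n. b j * integral {A (Suc j)..A j} f)"
      by (simp add: substitution[OF assms(2)])
    finally show ?thesis .
  qed
  then have "I = (\<lambda>n. \<Sum>j<n. b j * integral {A (Suc j)..A j} f)" by auto
  with J show ?thesis by (simp add: sums_def integral_unique)
qed

lemma integral_gap_telescope: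
  assumes "continuous_on {0..1} (f :: real \<Rightarrow> real)"
  shows "integral {A (Suc j)..A j} f = integral {0..A j} f - integral {0..A (Suc j)} f"
proof -
  have "continuous_on {0..A j} f" by (rule continuous_on_subset[OF assms]) (use A_le_1[of j] in auto)
  then have "f integrable_on {0..A j}" by (rule integrable_continuous_real)
  with Henstock_Kurzweil_Integration.integral_combine[of 0 "A (Suc j)" "A j" f] A_nonneg[of "Suc j"] A_Suc_less[of j]
  show ?thesis by simp
qed

lemma tail_integral_lim:
  assumes "continuous_on {0..1} (f :: real \<Rightarrow> real)"
  shows "(\<lambda>n. integral {0..A n} f) \<longlonglongrightarrow> 0"
proof -
  have "continuous_on {0..1} (\<lambda>x. integral {0..x} f)"
    by (intro indefinite_integral_continuous_1 integrable_continuous_real assms)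
  then have "((\<lambda>x. integral {0..x} f) \<longlongrightarrow> integral {0..0} f) (at 0 within {0..1})"
    unfolding continuous_on_def by (rule bspec) simp
  then have "((\<lambda>x. integral {0..x} f) \<longlongrightarrow> 0) (at 0 within {0..1})" by simp
  moreover have "filterlim A (at 0 within {0..1}) sequentially"
    using A_lim A_pos A_le_1 by (auto simp: filterlim_at A_nonneg intro!: always_eventually)
      (metis less_irrefl)
  ultimately show ?thesis using filterlim_compose by fastforce
qed

lemma integral_gap_sums:
  assumes "continuous_on {0..1} (f :: real \<Rightarrow> real)"
  shows "(\<lambda>j. integral {A (Suc j)..A j} f) sums integral {0..1} f"
  using telescope_sums'[OF tail_integral_lim[OF assms]] A_0
  by (simp add: integral_gap_telescope[OF assms])

text \<open>The gaps \<open>[A (Suc j), A j]\<close> tile \<open>(0,1]\<close>, so the changes of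
  variables in the single branches reassemble the integral.\<close>

lemma transfer_integral:
  assumes "continuous_on {0..1} f"
  shows "integral {0..1} (transfer f) = integral {0..1} f"
  using wtransfer_integral_sums[of "\<lambda>_. 1" f] integral_gap_sums[OF assms] assms
  by (auto simp: sums_iff Bseq_def)

lemma Bseq_one [simp]: "Bseq (\<lambda>_::nat. 1::real)"
  by (rule BseqI'[of _ 1]) simp

lemma wtransfer_cong:
  assumes "\<And>x. x \<in> {0..1} \<Longrightarrow> f x = g x" "x \<in> {0..1}"
  shows "wtransfer b f x = wtransfer b g x"
  unfolding wtransfer_def using assms Psi_unit by (intro suminf_cong) simp

lemma wtransfer_lin:
  assumes "Bseq b" "continuous_on {0..1} f" "continuous_on {0..1} g" "x \<in> {0..1}"
  shows "wtransfer b (\<lambda>x. s * f x + t * g x) x = s * wtransfer b f x + t * wtransfer b g x"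
proof -
  have "(\<lambda>j. s * (b j * (\<l> j x * f (\<Psi> j x))) + t * (b j * (\<l> j x * g (\<Psi> j x)))) sums (s * wtransfer b f x + t * wtransfer b g x)"
    using assms by (intro sums_add sums_mult wtransfer_sums)
  then show ?thesis unfolding wtransfer_def by (simp add: sums_iff algebra_simps)
qed

lemma wtransfer_lin_left:
  assumes "Bseq b" "Bseq b'" "continuous_on {0..1} f" "x \<in> {0..1}"
  shows "wtransfer (\<lambda>j. b j - b' j) f x = wtransfer b f x - wtransfer b' f x"
proof -
  have "(\<lambda>j. b j * (\<l> j x * f (\<Psi> j x)) - b' j * (\<l> j x * f (\<Psi> j x))) sums (wtransfer b f x - wtransfer b' f x)"
    using assms by (intro sums_diff wtransfer_sums)
  then show ?thesis unfolding wtransfer_def by (simp add: sums_iff algebra_simps)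
qed

lemma wtransfer_nonneg:
  assumes "Bseq b" "continuous_on {0..1} f" "x \<in> {0..1}" "\<And>j. 0 \<le> b j" "\<And>x. x \<in> {0..1} \<Longrightarrow> 0 \<le> f x"
  shows "0 \<le> wtransfer b f x"
  unfolding wtransfer_def using assms Psi_unit weight_pos[OF assms(3)]
  by (intro suminf_nonneg wtransfer_summable mult_nonneg_nonneg) (auto simp: less_imp_le)

lemma wtransfer_mono:
  assumes "Bseq b" "continuous_on {0..1} f" "continuous_on {0..1} g" "x \<in> {0..1}" "\<And>j. 0 \<le> b j"
    "\<And>x. x \<in> {0..1} \<Longrightarrow> f x \<le> g x"
  shows "wtransfer b f x \<le> wtransfer b g x"
  unfolding wtransfer_def using assms Psi_unit weight_pos[OF assms(4)]
  by (intro suminf_le wtransfer_summable mult_left_mono) (auto simp: less_imp_le)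

lemma regD:
  assumes "reg k f"
  shows "continuous_on {0..1} f" "x \<in> {0..1} \<Longrightarrow> 0 \<le> f x"
    "x \<in> {0..1} \<Longrightarrow> y \<in> {0..1} \<Longrightarrow> f (foldr \<Psi> w x) \<le> exp (k * \<theta> ^ length w) * f (foldr \<Psi> w y)"
  using assms by (auto simp: reg_def)

text \<open>One more common letter is gained: the factor \<open>\<l> j\<close> costs
  \<open>C\<close> and the composition with \<open>\<Psi> j\<close> costs \<open>k\<close>, both at
  the scale \<open>\<theta> ^ Suc (length w)\<close>. The coefficients \<open>b j\<close> occur
  equally on both sides, so they need not be close to 1.\<close>

lemma wtransfer_reg:
  assumes b: "Bseq b" "\<And>j. 0 \<le> b j" and f: "reg k f"
  shows "reg (\<theta> * (C + k)) (wtransfer b f)"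
  unfolding reg_def
proof (intro conjI ballI allI)
  show "continuous_on {0..1} (wtransfer b f)" using wtransfer_cont b regD(1)[OF f] by blast
  show "0 \<le> wtransfer b f x" if "x \<in> {0..1}" for x
    using wtransfer_nonneg b regD[OF f] that by blast
  fix w :: "nat list" and x y :: real assume x: "x \<in> {0..1}" and y: "y \<in> {0..1}"
  let ?e = "exp (\<theta> * (C + k) * \<theta> ^ length w)"
  have wx: "foldr \<Psi> w x \<in> {0..1}" and wy: "foldr \<Psi> w y \<in> {0..1}" using x y word_unit by auto
  have "wtransfer b f (foldr \<Psi> w x) \<le> (\<Sum>j. ?e * (b j * (\<l> j (foldr \<Psi> w y) * f (\<Psi> j (foldr \<Psi> w y)))))"
    unfolding wtransfer_def
  proof (rule suminf_le)
    fix j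
    have "\<l> j (foldr \<Psi> w x) * f (\<Psi> j (foldr \<Psi> w x))
      \<le> (exp (C * \<theta> ^ Suc (length w)) * \<l> j (foldr \<Psi> w y)) * (exp (k * \<theta> ^ Suc (length w)) * f (\<Psi> j (foldr \<Psi> w y)))"
      using distortion[OF x y, of j w] regD(3)[OF f x y, of "j # w"] weight_pos[OF wx, of j] weight_pos[OF wy, of j]
        regD(2)[OF f Psi_unit[OF wx], of j]
      by (intro mult_mono) auto
    also have "\<dots> = ?e * (\<l> j (foldr \<Psi> w y) * f (\<Psi> j (foldr \<Psi> w y)))"
      by (simp add: exp_add[symmetric] algebra_simps flip: exp_add)
    finally show "b j * (\<l> j (foldr \<Psi> w x) * f (\<Psi> j (foldr \<Psi> w x)))
      \<le> ?e * (b j * (\<l> j (foldr \<Psi> w y) * f (\<Psi> j (foldr \<Psi> w y))))"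
      using mult_left_mono[OF _ b(2)[of j]] by (simp add: mult.left_commute)
  qed (intro wtransfer_summable summable_mult b regD(1)[OF f] wx wy)+
  also have "\<dots> = ?e * wtransfer b f (foldr \<Psi> w y)"
    unfolding wtransfer_def by (intro suminf_mult wtransfer_summable b regD(1)[OF f] wy)
  finally show "wtransfer b f (foldr \<Psi> w x) \<le> ?e * wtransfer b f (foldr \<Psi> w y)" .
qed

lemma reg_scale: "reg k f \<Longrightarrow> 0 \<le> t \<Longrightarrow> reg k (\<lambda>x. t * f x)"
  unfolding reg_def
  by (auto intro!: continuous_intros simp: mult.left_commute[of _ t] intro: mult_left_mono)

lemma reg_bounds:
  assumes "reg k f" "x \<in> {0..1}"
  shows "f x \<le> exp k * integral {0..1} f" "integral {0..1} f \<le> exp k * f x"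
proof -
  note c = regD(1)[OF assms(1)]
  have r: "f x \<le> exp k * f y" if "x \<in> {0..1}" "y \<in> {0..1}" for x y
    using regD(3)[OF assms(1) that, of "[]"] by simp
  have "f x \<le> integral {0..1} (\<lambda>y. exp k * f y)"
    by (rule integral_ge_const) (intro continuous_intros c r assms(2), assumption?)+
  then show "f x \<le> exp k * integral {0..1} f" by simp
  show "integral {0..1} f \<le> exp k * f x"
    by (rule integral_le_const) (intro continuous_intros c r assms(2), assumption?)+
qed

text \<open>
  \<open>K\<close> is chosen so that the transfer operator improves the constant \<open>K\<close> to \<open>K - 1\<close>; this gain
  leaves room to subtract a multiple \<open>\<kappa>\<close> of another density and stay in the class \<open>K\<close>.
\<close>

definition K where "K = (C * \<theta> + 1) / (1 - \<theta>)"
definition "\<kappa> = exp (- 1) / (2 * K - 1) * exp (- 2 * (K - 1))"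

section \<open>Contraction of regular densities\<close>

lemma K_eq: "\<theta> * (C + K) = K - 1"
  using theta by (simp add: K_def field_simps)

lemma K_gt: "1 < K"
proof -
  have "0 < K" unfolding K_def using theta C_pos by (intro divide_pos_pos add_pos_pos mult_pos_pos) auto
  then have "0 < \<theta> * (C + K)" using theta C_pos by (intro mult_pos_pos add_pos_pos)
  then show ?thesis using K_eq by simp
qed

lemma kappa: "0 < \<kappa>" "\<kappa> < 1"
proof -
  show "0 < \<kappa>" unfolding \<kappa>_def using K_gt by auto
  have "exp (- 1::real) / (2 * K - 1) < 1"
    using K_gt by (simp add: field_simps) (smt (verit) exp_le_one_iff)
  moreover have "exp (- 2 * (K - 1)) < 1" using K_gt by simp
  ultimately show "\<kappa> < 1" unfolding \<kappa>_def
    using K_gt by (smt (verit) exp_gt_zero mult_less_cancel_right2)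
qed

lemma transfer_reg: "reg K f \<Longrightarrow> reg (K - 1) (transfer f)"
  using wtransfer_reg[of "\<lambda>_. 1" K f] K_eq by simp

lemma reg_mono:
  assumes "reg k f" "k \<le> k'"
  shows "reg k' f"
  unfolding reg_def
proof (intro conjI ballI allI)
  fix w :: "nat list" and x y :: real assume "x \<in> {0..1}" "y \<in> {0..1}"
  then have "f (foldr \<Psi> w x) \<le> exp (k * \<theta> ^ length w) * f (foldr \<Psi> w y)" using regD[OF assms(1)] by blast
  also have "\<dots> \<le> exp (k' * \<theta> ^ length w) * f (foldr \<Psi> w y)"
    using theta assms(2) regD(2)[OF assms(1) word_unit[OF \<open>y \<in> {0..1}\<close>]] by (intro mult_right_mono) (auto intro!: mult_right_mono)
  finally show "f (foldr \<Psi> w x) \<le> exp (k' * \<theta> ^ length w) * f (foldr \<Psi> w y)" .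
qed (use regD[OF assms(1)] in auto)

text \<open>Origin of \<open>\<kappa>\<close>: both densities lie between
  \<open>exp (- (K - 1))\<close> and \<open>exp (K - 1)\<close>, hence
  \<open>g \<le> exp (2 * (K - 1)) * f\<close>, which the last factor of \<open>\<kappa>\<close>
  compensates; what remains is \<open>\<kappa> * g \<le> ?d * f\<close>. In the worst case the
  subtraction costs a multiple of \<open>exp (K * t) - exp (- (K - 1) * t)\<close>, to be paid by
  relaxing the class from \<open>K - 1\<close> to \<open>K\<close>, that is by
  \<open>exp (K * t) - exp ((K - 1) * t)\<close>. The quotient of payment and cost is at least
  \<open>?d\<close> for 0 < t \<le> 1.\<close>

lemma reg_subtract:
  assumes f: "reg (K - 1) f" "integral {0..1} f = 1" and g: "reg (K - 1) g" "integral {0..1} g = 1"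
  shows "reg K (\<lambda>x. f x - \<kappa> * g x)"
proof -
  let ?d = "exp (- 1) / (2 * K - 1)"
  have "?d < 1" using K_gt by (simp add: field_simps) (smt (verit) exp_le_one_iff)
  have "0 < ?d" using K_gt by simp
  have kg: "\<kappa> * g x \<le> ?d * f x" if "x \<in> {0..1}" for x
  proof -
    have "exp (- 2 * (K - 1)) * g x \<le> exp (- 2 * (K - 1)) * exp (K - 1)"
      using reg_bounds(1)[OF g(1) that] g(2) by simp
    also have "\<dots> = exp (- (K - 1))" by (simp flip: exp_add)
    also have "\<dots> \<le> f x"
    proof -
      have "exp (- (K - 1)) * 1 \<le> exp (- (K - 1)) * (exp (K - 1) * f x)"
        using reg_bounds(2)[OF f(1) that] f(2) by (intro mult_left_mono) auto
      then show ?thesis by (simp add: mult.assoc[symmetric] flip: exp_add)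
    qed
    finally show ?thesis unfolding \<kappa>_def mult.assoc using \<open>0 < ?d\<close> by (intro mult_left_mono) auto
  qed
  show ?thesis unfolding reg_def
  proof (intro conjI ballI allI)
    show "continuous_on {0..1} (\<lambda>x. f x - \<kappa> * g x)"
      by (intro continuous_intros regD(1)[OF f(1)] regD(1)[OF g(1)])
    show "0 \<le> f x - \<kappa> * g x" if "x \<in> {0..1}" for x
    proof -
      have "?d * f x \<le> 1 * f x" using \<open>?d < 1\<close> regD(2)[OF f(1) that] by (intro mult_right_mono) auto
      then show ?thesis using kg[OF that] by simp
    qed
    fix w :: "nat list" and x y :: real assume x: "x \<in> {0..1}" and y: "y \<in> {0..1}"
    define t where "t = \<theta> ^ length w"
    have t: "0 < t" "t \<le> 1" unfolding t_def using theta by (auto intro: power_le_one)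
    define X Y where "X = foldr \<Psi> w x" and "Y = foldr \<Psi> w y"
    have XY: "X \<in> {0..1}" "Y \<in> {0..1}" unfolding X_def Y_def using x y word_unit by auto
    have 1: "f X \<le> exp ((K - 1) * t) * f Y" using regD(3)[OF f(1) x y] by (simp add: X_def Y_def t_def)
    have 2: "exp (- (K - 1) * t) * g Y \<le> g X"
    proof -
      have "exp (- (K - 1) * t) * g Y \<le> exp (- (K - 1) * t) * (exp ((K - 1) * t) * g X)"
        using regD(3)[OF g(1) y x] by (simp add: X_def Y_def t_def)
      also have "\<dots> = g X" by (simp add: mult.assoc[symmetric] left_diff_distrib flip: exp_add)
      finally show ?thesis .
    qed
    \<comment> \<open>Both differences are compared with multiples of \<open>t\<close>:
      \<open>1 - exp (- x) \<le> x\<close> at \<open>x = (2 * K - 1) * t\<close> bounds the left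
      one, and \<open>t * exp (- 1) \<le> 1 - exp (- t)\<close>, valid because
      \<open>t \<le> 1\<close>, bounds the right one. The denominator of \<open>?d\<close> cancels
      the factor \<open>2 * K - 1\<close>.\<close>
    have key: "?d * (exp (K * t) - exp (- (K - 1) * t)) \<le> exp (K * t) - exp ((K - 1) * t)"
    proof -
      have "exp (K * t) - exp (- (K - 1) * t) = exp (K * t) * (1 - exp (- (2 * K - 1) * t))"
        by (simp add: algebra_simps flip: exp_add)
      also have "\<dots> \<le> exp (K * t) * ((2 * K - 1) * t)"
        using exp_ge_add_one_self[of "- (2 * K - 1) * t"]
        by (intro mult_left_mono) (simp_all add: algebra_simps)
      finally have "?d * (exp (K * t) - exp (- (K - 1) * t)) \<le> ?d * (exp (K * t) * ((2 * K - 1) * t))"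
        using \<open>0 < ?d\<close> by (intro mult_left_mono) auto
      also have "\<dots> = exp (K * t) * (t * exp (- 1))" using K_gt by simp
      also have "\<dots> \<le> exp (K * t) * (1 - exp (- t))"
      proof (intro mult_left_mono)
        have "t * exp (-1) \<le> t * exp (- t)" using t by simp
        also have "\<dots> \<le> (exp t - 1) * exp (- t)"
        proof (rule mult_right_mono)
          show "t \<le> exp t - 1" using exp_ge_add_one_self[of t] by linarith
        qed simp
        also have "\<dots> = 1 - exp (- t)" by (simp add: algebra_simps flip: exp_add)
        finally show "t * exp (-1) \<le> 1 - exp (- t)" .
      qed auto
      also have "\<dots> = exp (K * t) - exp ((K - 1) * t)" by (simp add: algebra_simps flip: exp_add)
      finally show ?thesis .
    qed
    have "\<kappa> * g Y * (exp (K * t) - exp (- (K - 1) * t)) \<le> ?d * f Y * (exp (K * t) - exp (- (K - 1) * t))"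
      using kg[OF XY(2)] K_gt t by (intro mult_right_mono) (auto simp: mult_right_mono intro: order_trans[of _ 0])
    also have "\<dots> = f Y * (?d * (exp (K * t) - exp (- (K - 1) * t)))" by simp
    also have "\<dots> \<le> f Y * (exp (K * t) - exp ((K - 1) * t))"
      using key regD(2)[OF f(1) XY(2)] by (rule mult_left_mono)
    finally have 3: "\<kappa> * g Y * (exp (K * t) - exp (- (K - 1) * t)) \<le> f Y * (exp (K * t) - exp ((K - 1) * t))" .
    have 4: "\<kappa> * (exp (- (K - 1) * t) * g Y) \<le> \<kappa> * g X" using 2 kappa by (intro mult_left_mono) auto
    have "f X - \<kappa> * g X \<le> exp (K * t) * (f Y - \<kappa> * g Y)"
      using 1 3 4 by (simp add: algebra_simps)
    then show "f (foldr \<Psi> w x) - \<kappa> * g (foldr \<Psi> w x)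
        \<le> exp (K * \<theta> ^ length w) * (f (foldr \<Psi> w y) - \<kappa> * g (foldr \<Psi> w y))"
      by (simp add: X_def Y_def t_def)
  qed
qed

definition reg_density :: "(real \<Rightarrow> real) \<Rightarrow> bool" where
  "reg_density f \<longleftrightarrow> reg (K - 1) f \<and> integral {0..1} f = 1"

lemma reg_density_transfer: "reg_density f \<Longrightarrow> reg_density (transfer f)"
  unfolding reg_density_def using transfer_reg reg_mono[of "K - 1" f K] transfer_integral regD(1) by auto

lemma reg_density_iter: "reg_density f \<Longrightarrow> reg_density ((transfer ^^ n) f)"
  by (induction n) (auto intro: reg_density_transfer)

lemma reg_density_bounds:
  assumes "reg_density f" "x \<in> {0..1}" shows "0 < f x" "f x \<le> exp K" "exp (- K) \<le> f x"
proof -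
  have 1: "f x \<le> exp (K - 1)" "1 \<le> exp (K - 1) * f x"
    using assms reg_bounds[of "K - 1" f x] unfolding reg_density_def by auto
  have "exp (- K) \<le> exp (- (K - 1))" by simp
  also have "\<dots> \<le> exp (- (K - 1)) * (exp (K - 1) * f x)" using 1(2) by simp
  also have "\<dots> = f x" by (simp add: mult.assoc[symmetric] flip: exp_add)
  finally show "exp (- K) \<le> f x" .
  then show "0 < f x" using exp_gt_zero[of "- K"] by linarith
  have "exp (K - 1) \<le> exp K" by simp
  then show "f x \<le> exp K" using 1(1) by linarith
qed

lemma reg_density_cont: "reg_density f \<Longrightarrow> continuous_on {0..1} f"
  unfolding reg_density_def using regD by blast

text \<open>A coupling argument in density form: the fraction \<open>\<kappa>\<close> of the mass of
  \<open>f\<close> is matched with \<open>g\<close>. The unmatched part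
  \<open>f - \<kappa> * g\<close> has only regularity \<open>K\<close>, but one application of the
  operator brings it back to \<open>K - 1\<close>, so the step can be repeated on it.\<close>

lemma contraction:
  assumes "reg_density f" "reg_density g"
  obtains e where "reg_density e" "\<And>x. x \<in> {0..1} \<Longrightarrow> transfer f x = \<kappa> * transfer g x + (1 - \<kappa>) * e x"
proof
  let ?d = "\<lambda>x. f x - \<kappa> * g x"
  let ?e = "\<lambda>x. (1 / (1 - \<kappa>)) * transfer ?d x"
  have d: "reg K ?d" using reg_subtract assms unfolding reg_density_def by blast
  have "integral {0..1} ?d = 1 - \<kappa>"
    using assms reg_density_cont[OF assms(1)] reg_density_cont[OF assms(2)] unfolding reg_density_def
    by (subst integral_diff) (auto intro!: integrable_continuous_real continuous_intros)
  then have "integral {0..1} (transfer ?d) = 1 - \<kappa>" using transfer_integral regD(1)[OF d] by simp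
  moreover have "reg (K - 1) ?e" using kappa by (intro reg_scale transfer_reg[OF d]) simp
  ultimately show "reg_density ?e" unfolding reg_density_def using kappa by simp
  fix x :: real assume x: "x \<in> {0..1}"
  have "transfer ?d x = transfer f x - \<kappa> * transfer g x"
    using wtransfer_lin[of "\<lambda>_. 1" f g x 1 "- \<kappa>"] x reg_density_cont assms by simp
  then show "transfer f x = \<kappa> * transfer g x + (1 - \<kappa>) * ?e x" using kappa by simp
qed

lemma contraction_iter:
  assumes "reg_density f" "reg_density g"
  shows "\<exists>e. reg_density e \<and> (\<forall>x\<in>{0..1}. (transfer ^^ n) f x =
    (1 - (1 - \<kappa>) ^ n) * (transfer ^^ n) g x + (1 - \<kappa>) ^ n * e x)"
proof (induction n)
  case 0 then show ?case using assms by auto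
next
  case (Suc n)
  then obtain e where e: "reg_density e" "\<And>x. x \<in> {0..1} \<Longrightarrow> (transfer ^^ n) f x =
    (1 - (1 - \<kappa>) ^ n) * (transfer ^^ n) g x + (1 - \<kappa>) ^ n * e x" by blast
  have gn: "reg_density ((transfer ^^ n) g)" using reg_density_iter assms by blast
  obtain e' where e': "reg_density e'"
    "\<And>x. x \<in> {0..1} \<Longrightarrow> transfer e x = \<kappa> * transfer ((transfer ^^ n) g) x + (1 - \<kappa>) * e' x"
    using contraction[OF e(1) gn] by blast
  have "(transfer ^^ Suc n) f x =
    (1 - (1 - \<kappa>) ^ Suc n) * (transfer ^^ Suc n) g x + (1 - \<kappa>) ^ Suc n * e' x" if x: "x \<in> {0..1}" for x
  proof -
    have "(transfer ^^ Suc n) f x = transfer (\<lambda>x. (1 - (1 - \<kappa>) ^ n) * (transfer ^^ n) g x + (1 - \<kappa>) ^ n * e x) x"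
      using wtransfer_cong[OF e(2) x] by simp
    also have "\<dots> = (1 - (1 - \<kappa>) ^ n) * transfer ((transfer ^^ n) g) x + (1 - \<kappa>) ^ n * transfer e x"
      using reg_density_cont[OF gn] reg_density_cont[OF e(1)] x by (intro wtransfer_lin) auto
    finally show ?thesis using e'(2)[OF x] by (simp add: algebra_simps)
  qed
  then show ?case using e'(1) by blast
qed

lemma contraction_bound:
  assumes "reg_density f" "reg_density g" "x \<in> {0..1}"
  shows "\<bar>(transfer ^^ n) f x - (transfer ^^ n) g x\<bar> \<le> exp K * (1 - \<kappa>) ^ n"
proof -
  obtain e where e: "reg_density e" "\<forall>x\<in>{0..1}. (transfer ^^ n) f x =
    (1 - (1 - \<kappa>) ^ n) * (transfer ^^ n) g x + (1 - \<kappa>) ^ n * e x"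
    using contraction_iter[OF assms(1,2)] by blast
  have "(transfer ^^ n) f x - (transfer ^^ n) g x = (1 - \<kappa>) ^ n * (e x - (transfer ^^ n) g x)"
    using e(2) assms(3) by (simp add: algebra_simps)
  moreover have "\<bar>e x - (transfer ^^ n) g x\<bar> \<le> exp K"
    using reg_density_bounds[OF e(1) assms(3)] reg_density_bounds[OF reg_density_iter[OF assms(2), of n] assms(3)] by linarith
  ultimately show ?thesis using kappa by (simp add: abs_mult mult.commute[of "exp K"] mult_left_mono)
qed

lemma reg_density_one: "reg_density (\<lambda>_. 1)"
  using K_gt theta unfolding reg_density_def reg_def by auto

section \<open>The invariant density of the induced system, and mixing\<close>

definition h :: "real \<Rightarrow> real" where
  "h x = lim (\<lambda>n. (transfer ^^ n) (\<lambda>_. 1) x)"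

lemma geometric_null: "(\<lambda>n. M * (1 - \<kappa>) ^ n) \<longlonglongrightarrow> 0"
  using kappa by (intro tendsto_mult_right_zero LIMSEQ_power_zero) auto

lemma iter_diff:
  assumes "x \<in> {0..1}" "m \<le> n"
  shows "\<bar>(transfer ^^ n) (\<lambda>_. 1) x - (transfer ^^ m) (\<lambda>_. 1) x\<bar> \<le> exp K * (1 - \<kappa>) ^ m"
proof -
  have "(transfer ^^ n) (\<lambda>_. 1) = (transfer ^^ m) ((transfer ^^ (n - m)) (\<lambda>_. 1))"
    using assms(2) by (simp flip: funpow_add comp_apply[of "transfer ^^ m" "transfer ^^ (n - m)"])
  then show ?thesis using contraction_bound[OF reg_density_iter[OF reg_density_one] reg_density_one assms(1)] by metis
qed

lemma h_uniform_limit: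
  "uniform_limit {0..1} (\<lambda>n. (transfer ^^ n) (\<lambda>_. 1)) h sequentially"
proof -
  have "uniformly_Cauchy_on {0..1} (\<lambda>n. (transfer ^^ n) (\<lambda>_. 1))"
  proof (rule uniformly_Cauchy_onI')
    fix e :: real assume "e > 0"
    then have "\<forall>\<^sub>F n in sequentially. exp K * (1 - \<kappa>) ^ n < e"
      using geometric_null by (intro order_tendstoD) auto
    then obtain M where M: "\<And>n. n \<ge> M \<Longrightarrow> exp K * (1 - \<kappa>) ^ n < e" by (auto simp: eventually_sequentially)
    show "\<exists>M. \<forall>x\<in>{0..1}. \<forall>m\<ge>M. \<forall>n>m. dist ((transfer ^^ m) (\<lambda>_. 1) x) ((transfer ^^ n) (\<lambda>_. 1) x) < e"
    proof (intro exI[of _ M] ballI allI impI)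
      fix x :: real and m n assume "x \<in> {0..1}" "M \<le> m" "m < n"
      then show "dist ((transfer ^^ m) (\<lambda>_. 1) x) ((transfer ^^ n) (\<lambda>_. 1) x) < e"
        using iter_diff[of x m n] M[of m] unfolding dist_real_def by linarith
    qed
  qed
  then show ?thesis
    using Cauchy_uniformly_convergent uniformly_convergent_uniform_limit_iff h_def[abs_def] by metis
qed

lemma h_lim: "x \<in> {0..1} \<Longrightarrow> (\<lambda>n. (transfer ^^ n) (\<lambda>_. 1) x) \<longlonglongrightarrow> h x"
  using tendsto_uniform_limitI[OF h_uniform_limit] .

lemma h_cont: "continuous_on {0..1} h"
  by (rule uniform_limit_theorem[OF _ h_uniform_limit])
     (auto intro!: always_eventually reg_density_cont reg_density_iter reg_density_one)

lemma h_reg: "reg (K - 1) h"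
  unfolding reg_def
proof (intro conjI ballI allI h_cont)
  have r: "reg (K - 1) ((transfer ^^ n) (\<lambda>_. 1))" for n
    using reg_density_iter[OF reg_density_one, of n] unfolding reg_density_def by (rule conjunct1)
  show "0 \<le> h x" if "x \<in> {0..1}" for x
    using h_lim[OF that] by (rule LIMSEQ_le_const) (use regD(2)[OF r that] in auto)
  fix w :: "nat list" and x y :: real assume xy: "x \<in> {0..1}" "y \<in> {0..1}"
  show "h (foldr \<Psi> w x) \<le> exp ((K - 1) * \<theta> ^ length w) * h (foldr \<Psi> w y)"
    by (rule LIMSEQ_le[OF h_lim[OF word_unit[OF xy(1)]] tendsto_mult[OF tendsto_const h_lim[OF word_unit[OF xy(2)]]]])
       (use regD(3)[OF r xy] in auto)
qed

lemma h_integral: "integral {0..1} h = 1"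
proof -
  obtain I J where I: "\<And>n. ((transfer ^^ n) (\<lambda>_. 1) has_integral I n) {0..1}"
    and J: "(h has_integral J) {0..1}" "I \<longlonglongrightarrow> J"
    using uniform_limit_integral[OF h_uniform_limit reg_density_cont[OF reg_density_iter[OF reg_density_one]]] by auto
  have "I n = 1" for n
    using integral_unique[OF I[of n]] reg_density_iter[OF reg_density_one, of n] unfolding reg_density_def by simp
  then have "I = (\<lambda>_. 1)" by (rule ext)
  then have "J = 1" using J(2) by (simp add: LIMSEQ_const_iff)
  then show ?thesis using integral_unique[OF J(1)] by simp
qed

lemma h_reg_density: "reg_density h" unfolding reg_density_def using h_reg h_integral by simp

lemma wtransfer_abs_le:
  assumes "Bseq b" "\<And>j. 0 \<le> b j" "continuous_on {0..1} f" "x \<in> {0..1}" "\<And>x. x \<in> {0..1} \<Longrightarrow> \<bar>f x\<bar> \<le> M"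
  shows "\<bar>wtransfer b f x\<bar> \<le> M * wtransfer b (\<lambda>_. 1) x"
proof -
  have c: "wtransfer b (\<lambda>_. M) x = M * wtransfer b (\<lambda>_. 1) x" "wtransfer b (\<lambda>x. - M) x = - M * wtransfer b (\<lambda>_. 1) x"
    using wtransfer_lin[OF assms(1) continuous_on_const continuous_on_const assms(4), of M 1 0 0]
      wtransfer_lin[OF assms(1) continuous_on_const continuous_on_const assms(4), of "-M" 1 0 0] by auto
  have "wtransfer b f x \<le> wtransfer b (\<lambda>_. M) x"
    using assms by (intro wtransfer_mono) (auto simp: abs_le_iff)
  moreover have "wtransfer b (\<lambda>_. - M) x \<le> wtransfer b f x"
    using assms by (intro wtransfer_mono) (auto simp: abs_le_iff minus_le_iff)
  ultimately show ?thesis using c by auto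
qed

text \<open>The operator is bounded in the sup norm, with factor
  \<open>transfer (\<lambda>_. 1) x\<close> at the point \<open>x\<close>, so it commutes with the
  uniform limit defining \<open>h\<close>.\<close>

lemma transfer_h:
  assumes x: "x \<in> {0..1}" shows "transfer h x = h x"
proof -
  let ?f = "\<lambda>n. (transfer ^^ n) (\<lambda>_. 1)"
  have hb: "\<bar>?f n y - h y\<bar> \<le> exp K * (1 - \<kappa>) ^ n" if "y \<in> {0..1}" for n y
  proof -
    have "(\<lambda>m. \<bar>?f m y - ?f n y\<bar>) \<longlonglongrightarrow> \<bar>h y - ?f n y\<bar>"
      by (intro tendsto_intros h_lim that)
    then have "\<bar>h y - ?f n y\<bar> \<le> exp K * (1 - \<kappa>) ^ n"
      by (rule LIMSEQ_le_const2) (use iter_diff[OF that] in auto)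
    then show ?thesis by (simp add: abs_minus_commute)
  qed
  have fc: "continuous_on {0..1} (?f n)" for n using reg_density_cont reg_density_iter reg_density_one by blast
  have "\<bar>?f (Suc n) x - transfer h x\<bar> \<le> (exp K * transfer (\<lambda>_. 1) x) * (1 - \<kappa>) ^ n" for n
  proof -
    have eq: "?f (Suc n) x - transfer h x = transfer (\<lambda>y. 1 * ?f n y + (-1) * h y) x"
      by (subst wtransfer_lin[OF Bseq_one fc h_cont x]) simp
    have "\<bar>transfer (\<lambda>y. 1 * ?f n y + (-1) * h y) x\<bar> \<le> (exp K * (1 - \<kappa>) ^ n) * transfer (\<lambda>_. 1) x"
    proof (rule wtransfer_abs_le[OF Bseq_one _ _ x])
      show "continuous_on {0..1} (\<lambda>y. 1 * ?f n y + (-1) * h y)"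
        by (intro continuous_intros fc h_cont)
      show "\<bar>1 * ?f n y + (-1) * h y\<bar> \<le> exp K * (1 - \<kappa>) ^ n" if "y \<in> {0..1}" for y
        using hb[OF that, of n] by simp
    qed simp
    then show ?thesis unfolding eq by (simp only: mult_ac)
  qed
  then have "(\<lambda>n. ?f (Suc n) x - transfer h x) \<longlonglongrightarrow> 0"
    by (intro tendsto_rabs_zero_cancel[OF tendsto_sandwich[OF _ _ tendsto_const
          geometric_null[of "exp K * transfer (\<lambda>_. 1) x"]]]) auto
  moreover have "(\<lambda>n. ?f (Suc n) x) \<longlonglongrightarrow> h x" using h_lim[OF x] by (rule LIMSEQ_Suc)
  ultimately have "(\<lambda>n. ?f (Suc n) x) \<longlonglongrightarrow> transfer h x" by (simp add: LIM_zero_iff)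
  then show ?thesis using LIMSEQ_unique h_lim[OF x] LIMSEQ_Suc by blast
qed

lemma iter_cont: "continuous_on {0..1} f \<Longrightarrow> continuous_on {0..1} ((transfer ^^ n) f)"
  by (induction n) (auto intro: wtransfer_cont)

lemma iter_scale:
  assumes "continuous_on {0..1} f" "x \<in> {0..1}"
  shows "(transfer ^^ n) (\<lambda>x. s * f x) x = s * (transfer ^^ n) f x"
  using assms(2)
proof (induction n arbitrary: x)
  case (Suc n)
  have "(transfer ^^ Suc n) (\<lambda>x. s * f x) x = transfer (\<lambda>x. s * (transfer ^^ n) f x + 0 * 0) x"
    using wtransfer_cong[OF Suc.IH Suc.prems] by simp
  also have "\<dots> = s * (transfer ^^ Suc n) f x"
    by (subst wtransfer_lin[OF Bseq_one iter_cont[OF assms(1)] continuous_on_const Suc.prems]) simp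
  finally show ?case .
qed simp

lemma iter_h: "x \<in> {0..1} \<Longrightarrow> (transfer ^^ n) h x = h x"
proof (induction n arbitrary: x)
  case (Suc n) then show ?case using wtransfer_cong[of "(transfer ^^ n) h" h x] transfer_h by auto
qed simp

text \<open>As \<open>h\<close> is a fixed point, contraction between two densities becomes
  convergence to \<open>h\<close>. By homogeneity the error is proportional to the integral of
  \<open>f\<close>, so errors in the perturbation argument stay linear in the mass of the
  perturbation.\<close>

lemma mixing:
  assumes f: "reg (K - 1) f" and x: "x \<in> {0..1}"
  shows "\<bar>(transfer ^^ n) f x - integral {0..1} f * h x\<bar> \<le> exp K * (1 - \<kappa>) ^ n * integral {0..1} f"
proof -
  let ?s = "integral {0..1} f"
  note c = regD(1)[OF f]
  have s: "0 \<le> ?s" using integral_ge_const[OF c] regD(2)[OF f] by blast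
  \<comment> \<open>When the integral vanishes, \<open>reg_bounds\<close> forces \<open>f\<close> to
    vanish, so any density will do; \<open>h\<close> is taken.\<close>
  define g where "g = (if ?s = 0 then h else (\<lambda>x. (1 / ?s) * f x))"
  have g: "reg_density g"
  proof (cases "?s = 0")
    case False then show ?thesis using s reg_scale[OF f, of "1 / ?s"] by (auto simp: g_def reg_density_def)
  qed (simp add: g_def h_reg_density)
  have fg: "f x = ?s * g x" if "x \<in> {0..1}" for x
    using reg_bounds(1)[OF f that] regD(2)[OF f that] by (auto simp: g_def)
  have cg: "continuous_on {0..1} g" using reg_density_cont g by blast
  have it: "(transfer ^^ n) f y = (transfer ^^ n) (\<lambda>x. ?s * g x) y" if "y \<in> {0..1}" for n y
    using that
  proof (induction n arbitrary: y)
    case (Suc n) then show ?case using wtransfer_cong[of "(transfer ^^ n) f" _ y] by auto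
  qed (use fg in auto)
  have eq: "(transfer ^^ n) f x - ?s * h x = ?s * ((transfer ^^ n) g x - (transfer ^^ n) h x)"
    unfolding it[OF x] iter_h[OF x] iter_scale[OF cg x] by (simp add: algebra_simps)
  have "\<bar>?s * ((transfer ^^ n) g x - (transfer ^^ n) h x)\<bar> \<le> ?s * (exp K * (1 - \<kappa>) ^ n)"
    using contraction_bound[OF g h_reg_density x, of n] s by (simp add: abs_mult mult_left_mono)
  then show ?thesis unfolding eq by (simp only: mult_ac)
qed

section \<open>Perturbation of the transfer operator\<close>

definition q :: "nat \<Rightarrow> real" where "q j = integral {A (Suc j)..A j} h"

lemma q_ge: "A j - A (Suc j) \<le> exp K * q j"
proof -
  have sub: "{A (Suc j)..A j} \<subseteq> {0..1}" using A_nonneg[of "Suc j"] A_le_1[of j] by auto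
  have "integral {A (Suc j)..A j} (\<lambda>_. exp (- K)) \<le> integral {A (Suc j)..A j} h"
  proof (rule integral_le)
    show "h integrable_on {A (Suc j)..A j}"
      by (intro integrable_continuous_real continuous_on_subset[OF h_cont sub])
  qed (use sub reg_density_bounds(3)[OF h_reg_density] in auto)
  then have "exp K * (exp (- K) * (A j - A (Suc j))) \<le> exp K * q j"
    using A_Suc_less[of j] unfolding q_def by (intro mult_left_mono) (auto simp: mult.commute)
  then show ?thesis by (simp add: mult.assoc[symmetric] flip: exp_add)
qed

lemma q_pos: "0 < q j"
  using q_ge[of j] A_Suc_less[of j] by (smt (verit) exp_gt_zero zero_less_mult_pos)

lemma weight_le_q: "x \<in> {0..1} \<Longrightarrow> \<l> j x \<le> exp (C * \<theta> + K) * q j"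
proof -
  assume "x \<in> {0..1}"
  then have "\<l> j x \<le> exp (C * \<theta>) * (A j - A (Suc j))" by (rule weight_le)
  also have "\<dots> \<le> exp (C * \<theta>) * (exp K * q j)" using q_ge by (intro mult_left_mono) auto
  finally show ?thesis by (simp add: exp_add mult.assoc)
qed

lemma wtransfer_h_sums: "Bseq b \<Longrightarrow> (\<lambda>j. b j * q j) sums integral {0..1} (wtransfer b h)"
  using wtransfer_integral_sums[OF _ h_cont] by (simp add: q_def)

text \<open>Every weight is at most a constant multiple of the mass \<open>q j\<close>, uniformly in
  the point, so a perturbation of small total mass is small in the sup norm as well. Applied to a
  correction which itself has the size of that mass, it produces only a quadratic error.\<close>

lemma wtransfer_one_le:
  assumes "Bseq b" "\<And>j. 0 \<le> b j" "x \<in> {0..1}"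
  shows "wtransfer b (\<lambda>_. 1) x \<le> exp (C * \<theta> + K) * integral {0..1} (wtransfer b h)"
proof -
  have 1: "(\<lambda>j. b j * (\<l> j x * 1)) sums wtransfer b (\<lambda>_. 1) x"
    using assms by (intro wtransfer_sums) auto
  have 2: "(\<lambda>j. exp (C * \<theta> + K) * (b j * q j)) sums (exp (C * \<theta> + K) * integral {0..1} (wtransfer b h))"
    using assms by (intro sums_mult wtransfer_h_sums)
  have 3: "b j * (\<l> j x * 1) \<le> exp (C * \<theta> + K) * (b j * q j)" for j
    using mult_left_mono[OF weight_le_q[OF assms(3), of j] assms(2)[of j]] by (simp add: mult_ac)
  show ?thesis by (rule sums_le[OF 3 1 2])
qed

lemma wtransfer_sum:
  assumes "\<And>n. continuous_on {0..1} (G n)" "x \<in> {0..1}"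
  shows "transfer (\<lambda>x. \<Sum>n<T::nat. G n x) x = (\<Sum>n<T. transfer (G n) x)"
proof (induction T)
  case 0 then show ?case by (simp add: wtransfer_def)
next
  case (Suc T)
  have "transfer (\<lambda>x. 1 * (\<Sum>n<T. G n x) + 1 * G T x) x = 1 * transfer (\<lambda>x. \<Sum>n<T. G n x) x + 1 * transfer (G T) x"
    using assms by (intro wtransfer_lin) (auto intro!: continuous_intros)
  then show ?case using Suc by (simp add: add.commute)
qed

text \<open>
  With \<open>E = wtransfer (b - 1) h\<close> of integral \<open>s - t\<close>, the function
  \<open>v = (\<Sum>n<T. transfer^n E - (s - t) h)\<close> solves \<open>v - transfer v = E - (s - t) h\<close> up to the error
  \<open>transfer^T E - (s - t) h\<close>, so that \<open>wtransfer b (h + v) - (h + v)\<close> is \<open>(s - t) h\<close> up to this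
  error and a quadratic term.
\<close>

theorem perturbation:
  assumes eps: "0 < \<epsilon>"
  obtains \<eta> where "0 < \<eta>"
    "\<And>b s t. Bseq b \<Longrightarrow> (\<And>j. 0 \<le> b j) \<Longrightarrow> (\<lambda>j. max 0 (b j - 1) * q j) sums s \<Longrightarrow>
       (\<lambda>j. max 0 (1 - b j) * q j) sums t \<Longrightarrow> s + t \<le> \<eta> \<Longrightarrow>
     \<exists>u e. 0 < e \<and> continuous_on {0..1} u \<and> (\<forall>x\<in>{0..1}. e \<le> u x) \<and>
       (\<epsilon> * (s + t) \<le> s - t \<longrightarrow> (\<forall>x\<in>{0..1}. u x \<le> wtransfer b u x)) \<and>
       (s - t \<le> - \<epsilon> * (s + t) \<longrightarrow> (\<forall>x\<in>{0..1}. wtransfer b u x \<le> u x))"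
proof -
  have "\<forall>\<^sub>F n in sequentially. exp K * (1 - \<kappa>) ^ n < \<epsilon> * exp (- K) / 2"
    using geometric_null eps by (intro order_tendstoD) auto
  \<comment> \<open>The correction is cut after \<open>T\<close> terms. Half of the admissible error
    is reserved for the remainder, the other half for the quadratic term.\<close>
  then obtain T where T: "exp K * (1 - \<kappa>) ^ T < \<epsilon> * exp (- K) / 2"
    by (auto simp: eventually_sequentially)
  define D where "D = (real T + 1) * exp K"
  have D: "D > 0" by (simp add: D_def)
  \<comment> \<open>The first bound keeps \<open>u\<close> above \<open>exp (- K) / 2\<close>, the
    second keeps the quadratic term within its half of the error.\<close>
  define \<eta> where "\<eta> = min (exp (- K) / (2 * D)) (\<epsilon> * exp (- K) / (2 * (D * exp (C * \<theta> + K))))"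
  show thesis
  proof (rule that)
    show "0 < \<eta>" using D eps by (simp add: \<eta>_def)
    fix b :: "nat \<Rightarrow> real" and s t
    assume b: "Bseq b" "\<And>j. 0 \<le> b j" and s: "(\<lambda>j. max 0 (b j - 1) * q j) sums s"
      and t: "(\<lambda>j. max 0 (1 - b j) * q j) sums t" and st: "s + t \<le> \<eta>"
    \<comment> \<open>The two signs are treated apart because \<open>reg\<close> admits nonnegative
      functions only; \<open>mixing\<close> then applies to each part.\<close>
    define bp bm where "bp = (\<lambda>j. max 0 (b j - 1))" and "bm = (\<lambda>j. max 0 (1 - b j))"
    obtain M where M: "\<And>n. \<bar>b n\<bar> \<le> M" using b(1) by (auto simp: Bseq_def)
    have "norm (bp n) \<le> M + 1" "norm (bm n) \<le> M + 1" for n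
      using M[of n] b(2)[of n] by (auto simp: bp_def bm_def)
    then have bp: "Bseq bp" "\<And>j. 0 \<le> bp j" and bm: "Bseq bm" "\<And>j. 0 \<le> bm j"
      by (auto simp: bp_def bm_def intro!: BseqI'[of _ "M + 1"])
    define P Q where "P = wtransfer bp h" and "Q = wtransfer bm h"
    have hK: "reg K h" using h_reg reg_mono by force
    have P: "reg (K - 1) P" and Q: "reg (K - 1) Q"
      using wtransfer_reg[OF bp hK] wtransfer_reg[OF bm hK] K_eq by (simp_all add: P_def Q_def)
    have sP: "integral {0..1} P = s" and tQ: "integral {0..1} Q = t"
      using wtransfer_h_sums[OF bp(1)] wtransfer_h_sums[OF bm(1)] s t unfolding P_def Q_def bp_def bm_def
      by (auto intro: sums_unique2)
    have s0: "0 \<le> s" "0 \<le> t"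
      using integral_ge_const[OF regD(1)[OF P]] regD(2)[OF P] integral_ge_const[OF regD(1)[OF Q]] regD(2)[OF Q] sP tQ
      by auto
    define G where "G n x = (transfer ^^ n) P x - (transfer ^^ n) Q x - (s - t) * h x" for n x
    have Gc: "continuous_on {0..1} (G n)" for n
      unfolding G_def[abs_def] by (intro continuous_intros iter_cont regD(1)[OF P] regD(1)[OF Q] h_cont)
    have Gb: "\<bar>G n x\<bar> \<le> exp K * (1 - \<kappa>) ^ n * (s + t)" if "x \<in> {0..1}" for n x
      using mixing[OF P that, of n] mixing[OF Q that, of n] sP tQ unfolding G_def
      by (simp add: algebra_simps abs_le_iff)
    have GS: "transfer (G n) x = G (Suc n) x" if "x \<in> {0..1}" for n x
    proof -
      have "transfer (\<lambda>x. 1 * (1 * (transfer ^^ n) P x + (-1) * (transfer ^^ n) Q x) + (- (s - t)) * h x) x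
        = 1 * (1 * transfer ((transfer ^^ n) P) x + (-1) * transfer ((transfer ^^ n) Q) x) + (- (s - t)) * transfer h x"
        by (subst wtransfer_lin[OF Bseq_one _ h_cont that], intro continuous_intros iter_cont regD(1)[OF P] regD(1)[OF Q],
            subst wtransfer_lin[OF Bseq_one _ _ that]) (intro iter_cont regD(1)[OF P] regD(1)[OF Q] refl)+
      then show ?thesis using transfer_h[OF that] by (simp add: G_def[abs_def] algebra_simps)
    qed
    define v where "v x = (\<Sum>n<T. G n x)" for x
    have vc: "continuous_on {0..1} v" unfolding v_def[abs_def] by (intro continuous_intros Gc)
    have vb: "\<bar>v x\<bar> \<le> D * (s + t)" if "x \<in> {0..1}" for x
    proof -
      have "\<bar>v x\<bar> \<le> (\<Sum>n<T. \<bar>G n x\<bar>)" unfolding v_def by (rule sum_abs)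
      also have "\<dots> \<le> (\<Sum>n<T. exp K * (s + t))"
      proof (rule sum_mono)
        fix n
        have "exp K * (1 - \<kappa>) ^ n * (s + t) \<le> exp K * 1 * (s + t)"
          using kappa s0 by (intro mult_right_mono mult_left_mono power_le_one) auto
        then show "\<bar>G n x\<bar> \<le> exp K * (s + t)"
          using order_trans[OF Gb[OF that, of n]] unfolding mult_1_right by blast
      qed
      also have "\<dots> \<le> D * (s + t)" using s0 by (simp add: D_def algebra_simps)
      finally show ?thesis .
    qed
    have Tv: "transfer v x = v x - G 0 x + G T x" if "x \<in> {0..1}" for x
    proof -
      have "transfer v x = (\<Sum>n<T. G (Suc n) x)"
        unfolding v_def[abs_def] using wtransfer_sum[of G x T, OF Gc that] GS[OF that] by simp
      moreover have "(\<Sum>n<T. G (Suc n) x) - (\<Sum>n<T. G n x) = G T x - G 0 x"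
        using sum_lessThan_telescope[of "\<lambda>n. G n x" T] by (simp add: sum_subtractf)
      ultimately show ?thesis by (simp add: v_def)
    qed
    define u where "u x = 1 * h x + 1 * v x" for x
    have uc: "continuous_on {0..1} u" unfolding u_def[abs_def] by (intro continuous_intros vc h_cont)
    have hb: "exp (- K) \<le> h x" if "x \<in> {0..1}" for x using reg_density_bounds(3)[OF h_reg_density that] .
    have DB: "D * (s + t) \<le> exp (- K) / 2"
    proof -
      have "D * (s + t) \<le> D * (exp (- K) / (2 * D))" using st D by (intro mult_left_mono) (auto simp: \<eta>_def)
      then show ?thesis using D by simp
    qed
    have DB2: "D * exp (C * \<theta> + K) * (s + t) \<le> \<epsilon> * exp (- K) / 2"
    proof -
      have "D * exp (C * \<theta> + K) * (s + t) \<le> D * exp (C * \<theta> + K) * (\<epsilon> * exp (- K) / (2 * (D * exp (C * \<theta> + K))))"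
        using st D by (intro mult_left_mono) (auto simp: \<eta>_def)
      then show ?thesis using D by simp
    qed
    have Dst: "0 \<le> D * (s + t)" using D s0 by simp
    \<comment> \<open>The tolerance carries the factor \<open>exp (- K)\<close>, a lower bound of
      \<open>h\<close>, so it is dominated by \<open>(s - t) * h\<close> in modulus as soon as
      \<open>\<bar>s - t\<bar> \<ge> \<epsilon> * (s + t)\<close>.\<close>
    have main: "\<bar>wtransfer b u x - u x - (s - t) * h x\<bar> \<le> \<epsilon> * (s + t) * exp (- K)" if x: "x \<in> {0..1}" for x
    proof -
      have "b j - 1 = bp j - bm j" for j by (simp add: bp_def bm_def)
      then have "wtransfer b u x - transfer u x = wtransfer bp u x - wtransfer bm u x"
        using wtransfer_lin_left[OF b(1) Bseq_one uc x] wtransfer_lin_left[OF bp(1) bm(1) uc x] by simp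
      moreover have "wtransfer bp u x = P x + wtransfer bp v x" "wtransfer bm u x = Q x + wtransfer bm v x"
        "transfer u x = h x + (v x - G 0 x + G T x)"
        unfolding u_def[abs_def] P_def Q_def
        using wtransfer_lin[OF bp(1) h_cont vc x, of 1 1] wtransfer_lin[OF bm(1) h_cont vc x, of 1 1]
          wtransfer_lin[OF Bseq_one h_cont vc x, of 1 1] transfer_h[OF x] Tv[OF x] by auto
      moreover have "G 0 x = P x - Q x - (s - t) * h x" by (simp add: G_def)
      \<comment> \<open>The first-order terms cancel, since
        \<open>G 0 = P - Q - (s - t) * h\<close>. What is left is the remainder \<open>G T\<close>
        and the perturbation acting on \<open>v\<close>, where both factors are of order
        \<open>s + t\<close>.\<close>
      ultimately have eq: "wtransfer b u x - u x - (s - t) * h x = G T x + wtransfer bp v x - wtransfer bm v x"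
        by (simp add: u_def)
      have "\<bar>G T x\<bar> \<le> \<epsilon> * exp (- K) / 2 * (s + t)"
        using Gb[OF x, of T] mult_right_mono[OF less_imp_le[OF T], of "s + t"] s0 by linarith
      moreover have "\<bar>wtransfer bp v x\<bar> \<le> D * (s + t) * (exp (C * \<theta> + K) * s)"
        using order_trans[OF wtransfer_abs_le[OF bp vc x vb] mult_left_mono[OF wtransfer_one_le[OF bp x] Dst]]
        unfolding sP[unfolded P_def] .
      moreover have "\<bar>wtransfer bm v x\<bar> \<le> D * (s + t) * (exp (C * \<theta> + K) * t)"
        using order_trans[OF wtransfer_abs_le[OF bm vc x vb] mult_left_mono[OF wtransfer_one_le[OF bm x] Dst]]
        unfolding tQ[unfolded Q_def] .
      moreover have "D * (s + t) * (exp (C * \<theta> + K) * s) + D * (s + t) * (exp (C * \<theta> + K) * t)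
         = (D * exp (C * \<theta> + K) * (s + t)) * (s + t)" by (simp add: algebra_simps)
      moreover have "\<dots> \<le> \<epsilon> * exp (- K) / 2 * (s + t)" using DB2 s0 by (intro mult_right_mono) auto
      moreover have "\<epsilon> * (s + t) * exp (- K) = \<epsilon> * exp (- K) / 2 * (s + t) + \<epsilon> * exp (- K) / 2 * (s + t)"
        by (simp add: algebra_simps)
      ultimately show ?thesis unfolding eq by linarith
    qed
    have st0: "0 \<le> \<epsilon> * (s + t)" using eps s0 by simp
    have "exp (- K) / 2 \<le> u x" if "x \<in> {0..1}" for x
      using hb[OF that] vb[OF that] DB by (simp add: u_def abs_le_iff)
    moreover have "u x \<le> wtransfer b u x" if "x \<in> {0..1}" "\<epsilon> * (s + t) \<le> s - t" for x
    proof -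
      have "\<epsilon> * (s + t) * exp (- K) \<le> (s - t) * h x"
        by (intro mult_mono) ((use that st0 hb[OF that(1)] in linarith) | simp)+
      then show ?thesis using main[OF that(1)] by (simp add: abs_le_iff)
    qed
    moreover have "wtransfer b u x \<le> u x" if "x \<in> {0..1}" "s - t \<le> - \<epsilon> * (s + t)" for x
    proof -
      have "\<epsilon> * (s + t) * exp (- K) \<le> (t - s) * h x"
        by (intro mult_mono) ((use that st0 hb[OF that(1)] in linarith) | simp)+
      then show ?thesis using main[OF that(1)] by (simp add: abs_le_iff algebra_simps)
    qed
    ultimately show "\<exists>u e. 0 < e \<and> continuous_on {0..1} u \<and> (\<forall>x\<in>{0..1}. e \<le> u x) \<and>
       (\<epsilon> * (s + t) \<le> s - t \<longrightarrow> (\<forall>x\<in>{0..1}. u x \<le> wtransfer b u x)) \<and>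
       (s - t \<le> - \<epsilon> * (s + t) \<longrightarrow> (\<forall>x\<in>{0..1}. wtransfer b u x \<le> u x))"
      using uc by (intro exI[of _ u] exI[of _ "exp (- K) / 2"]) auto
  qed
qed

lemma tail_asymp: "(\<lambda>N. integral {0..A N} h / A N) \<longlonglongrightarrow> h 0"
proof -
  have "((\<lambda>u. integral {0..u} h) has_real_derivative h 0) (at 0 within {0..1})"
    using integral_has_real_derivative[OF h_cont, of 0] by simp
  then have "((\<lambda>y. (integral {0..y} h - integral {0..0} h) / (y - 0)) \<longlongrightarrow> h 0) (at 0 within {0..1})"
    by (simp add: has_field_derivative_iff)
  moreover have "filterlim A (at 0 within {0..1}) sequentially"
    using A_lim A_pos A_le_1 by (auto simp: filterlim_at A_nonneg intro!: always_eventually)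
      (metis less_irrefl)
  ultimately have "((\<lambda>N. (integral {0..A N} h - integral {0..0} h) / (A N - 0)) \<longlongrightarrow> h 0) sequentially"
    by (rule filterlim_compose)
  then show ?thesis by simp
qed

lemma h_0_pos: "0 < h 0" using reg_density_bounds(1)[OF h_reg_density] by simp

lemma q_tail: "integral {0..A n} h - integral {0..A (Suc n)} h = q n"
  using integral_gap_telescope[OF h_cont] q_def by simp

end

section \<open>Asymptotics of the threshold\<close>

text \<open>Strict increase is asked for only from \<open>n0\<close> on, because for s = 1 the
  comparison sequence is the logarithm, which is used from 1 on.\<close>

lemma stolz_cesaro:
  fixes a b :: "nat \<Rightarrow> real"
  assumes inc: "\<And>n. n \<ge> n0 \<Longrightarrow> b n < b (Suc n)" and lim: "filterlim b at_top sequentially"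
    and ratio: "(\<lambda>n. (a (Suc n) - a n) / (b (Suc n) - b n)) \<longlonglongrightarrow> l"
  shows "(\<lambda>n. a n / b n) \<longlonglongrightarrow> l"
proof (rule LIMSEQ_I)
  fix e :: real assume e: "e > 0"
  have "\<forall>\<^sub>F n in sequentially. dist ((a (Suc n) - a n) / (b (Suc n) - b n)) l < e / 2"
    using ratio e by (intro tendstoD) auto
  then obtain n1 where n1: "\<And>n. n \<ge> n1 \<Longrightarrow> \<bar>(a (Suc n) - a n) / (b (Suc n) - b n) - l\<bar> < e / 2"
    by (auto simp: eventually_sequentially dist_real_def)
  define m where "m = max n0 n1"
  have incr: "\<bar>(a (Suc n) - l * b (Suc n)) - (a n - l * b n)\<bar> \<le> e / 2 * (b (Suc n) - b n)" if "n \<ge> m" for n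
  proof -
    have d: "b (Suc n) - b n > 0" using inc that by (simp add: m_def)
    have "(a (Suc n) - l * b (Suc n)) - (a n - l * b n) = ((a (Suc n) - a n) / (b (Suc n) - b n) - l) * (b (Suc n) - b n)"
      using d by (simp add: field_simps)
    then show ?thesis using n1[of n] that d by (simp add: m_def abs_mult)
  qed
  have bound: "\<bar>(a n - l * b n) - (a m - l * b m)\<bar> \<le> e / 2 * (b n - b m)" if "n \<ge> m" for n
    using that
  proof (induction n rule: dec_induct)
    case (step n)
    then show ?case using incr[of n] unfolding right_diff_distrib by linarith
  qed simp
  have "\<forall>\<^sub>F n in sequentially. b n > max 1 ((\<bar>a m - l * b m\<bar> + e / 2 * \<bar>b m\<bar> + 1) / (e / 2))"
    using lim unfolding filterlim_at_top_dense by blast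
  then obtain n2 where n2: "\<And>n. n \<ge> n2 \<Longrightarrow> b n > max 1 ((\<bar>a m - l * b m\<bar> + e / 2 * \<bar>b m\<bar> + 1) / (e / 2))"
    by (auto simp: eventually_sequentially)
  show "\<exists>no. \<forall>n\<ge>no. norm (a n / b n - l) < e"
  proof (intro exI[of _ "max m n2"] allI impI)
    fix n assume n: "n \<ge> max m n2"
    have b1: "b n > 1" and b2: "(\<bar>a m - l * b m\<bar> + e / 2 * \<bar>b m\<bar> + 1) / (e / 2) < b n"
      using n2[of n] n by auto
    have b3: "\<bar>a m - l * b m\<bar> + e / 2 * \<bar>b m\<bar> + 1 < e / 2 * b n"
      using b2 e by (simp add: field_simps)
    have "- (e / 2 * b m) \<le> e / 2 * \<bar>b m\<bar>" using e mult_left_mono[of "- b m" "\<bar>b m\<bar>" "e / 2"] by simp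
    moreover have "\<bar>(a n - l * b n) - (a m - l * b m)\<bar> \<le> e / 2 * b n - e / 2 * b m"
      using bound[of n] n by (simp add: right_diff_distrib)
    ultimately have "\<bar>a n - l * b n\<bar> < e / 2 * b n + e / 2 * b n" using b3 by linarith
    then have "\<bar>a n - l * b n\<bar> < e * b n" by simp
    moreover have "a n / b n - l = (a n - l * b n) / b n" using b1 by (simp add: field_simps)
    ultimately show "norm (a n / b n - l) < e" using b1 by (simp add: pos_divide_less_eq abs_divide)
  qed
qed

text \<open>This is the difference quotient of \<open>(1 + x) powr p\<close> at 0, taken along
  \<open>x = 1 / real n\<close>.\<close>

lemma powr_increment:
  "(\<lambda>n. (real (Suc n) powr p - real n powr p) * real n / real n powr p) \<longlonglongrightarrow> p"
proof -
  have "((\<lambda>x. (1 + x) powr p) has_real_derivative p) (at 0)"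
    by (auto intro!: derivative_eq_intros)
  then have "((\<lambda>x. ((1 + x) powr p - 1) / x) \<longlongrightarrow> p) (at 0)"
    by (simp add: has_field_derivative_iff)
  moreover have "filterlim (\<lambda>n. 1 / real n) (at 0) sequentially"
    unfolding filterlim_at using lim_1_over_n eventually_gt_at_top[of "0::nat"]
    by (auto elim!: eventually_mono)
  ultimately have "(\<lambda>n. ((1 + 1 / real n) powr p - 1) / (1 / real n)) \<longlonglongrightarrow> p"
    by (rule filterlim_compose)
  moreover have "\<forall>\<^sub>F n in sequentially. ((1 + 1 / real n) powr p - 1) / (1 / real n) =
      (real (Suc n) powr p - real n powr p) * real n / real n powr p"
    using eventually_gt_at_top[of 0]
  proof eventually_elim
    case (elim n)
    have "real (Suc n) = real n * (1 + 1 / real n)" using elim by (simp add: field_simps)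
    then have "real (Suc n) powr p = real n powr p * (1 + 1 / real n) powr p"
      using elim by (simp add: powr_mult)
    then show ?case using elim by (simp add: field_simps)
  qed
  ultimately show ?thesis by (rule Lim_transform_eventually)
qed

text \<open>The sequence \<open>a n powr (- s)\<close> is asymptotically arithmetic: with
  \<open>a n = a (Suc n) * (1 + w n)\<close> its increment is \<open>a (Suc n) powr (- s)\<close>
  times \<open>1 - (1 + w n) powr (- s)\<close>. The last factor is about \<open>s * w n\<close>,
  and \<open>w n\<close> is about \<open>c * a (Suc n) powr s\<close>, so the increments tend to
  \<open>s * c\<close>. Averaging and inverting the power give the claim.\<close>

lemma backward_orbit_asymp:
  fixes a :: "nat \<Rightarrow> real"
  assumes pos: "\<And>n. 0 < a n" and lim: "a \<longlonglongrightarrow> 0" and orb: "\<And>n. f (a (Suc n)) = a n"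
    and f: "((\<lambda>x. (f x - x) / x powr (s + 1)) \<longlongrightarrow> c) (at_right 0)" and s: "0 < s" and c: "0 < c"
  shows "(\<lambda>n. a n * real n powr (1 / s)) \<longlonglongrightarrow> (s * c) powr (- 1 / s)"
proof -
  have a0: "filterlim (\<lambda>n. a (Suc n)) (at_right 0) sequentially"
    using LIMSEQ_Suc[OF lim] pos by (auto simp: filterlim_at intro!: always_eventually) (metis less_irrefl)
  define w where "w n = (a n - a (Suc n)) / a (Suc n)" for n
  have 1: "(\<lambda>n. w n / a (Suc n) powr s) \<longlonglongrightarrow> c"
  proof -
    have "(f (a (Suc n)) - a (Suc n)) / a (Suc n) powr (s + 1) = w n / a (Suc n) powr s" for n
      using pos[of "Suc n"] by (simp add: orb w_def powr_add)
    then show ?thesis using filterlim_compose[OF f a0] by simp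
  qed
  have "(\<lambda>n. a (Suc n) powr s) \<longlonglongrightarrow> 0 powr s"
    using s pos less_imp_le by (intro tendsto_powr2 tendsto_const LIMSEQ_Suc lim) (auto intro!: always_eventually less_imp_le)
  from tendsto_mult[OF 1 this] have w0: "w \<longlonglongrightarrow> 0"
    using pos s by (simp add: less_imp_neq[symmetric])
  have "\<forall>\<^sub>F n in sequentially. w n / a (Suc n) powr s > 0" using 1 c by (intro order_tendstoD)
  then have wpos: "\<forall>\<^sub>F n in sequentially. w n > 0"
    by eventually_elim (metis pos powr_gt_zero less_irrefl zero_less_divide_iff order.asym)
  have "((\<lambda>x. (1 + x) powr (- s)) has_real_derivative - s) (at 0)"
    by (auto intro!: derivative_eq_intros)
  then have "((\<lambda>x. ((1 + x) powr (- s) - 1) / x) \<longlongrightarrow> - s) (at 0)"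
    by (simp add: has_field_derivative_iff)
  moreover have "filterlim w (at 0) sequentially"
    using w0 wpos by (auto simp: filterlim_at elim!: eventually_mono)
  ultimately have "(\<lambda>n. ((1 + w n) powr (- s) - 1) / w n) \<longlonglongrightarrow> - s" by (rule filterlim_compose)
  from tendsto_minus[OF tendsto_mult[OF this 1]]
  have "(\<lambda>n. - (((1 + w n) powr (- s) - 1) / w n * (w n / a (Suc n) powr s))) \<longlonglongrightarrow> s * c" by simp
  moreover have "\<forall>\<^sub>F n in sequentially. - (((1 + w n) powr (- s) - 1) / w n * (w n / a (Suc n) powr s))
     = (a (Suc n) powr (- s) - a n powr (- s)) / (real (Suc n) - real n)"
    using wpos
  proof eventually_elim
    case (elim n)
    have "a n = a (Suc n) * (1 + w n)" using pos[of "Suc n"] by (simp add: w_def field_simps)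
    then have "a n powr (- s) = a (Suc n) powr (- s) * (1 + w n) powr (- s)"
      using pos elim by (metis powr_mult)
    then show ?case using elim pos[of "Suc n"] by (simp add: powr_minus field_simps)
  qed
  ultimately have "(\<lambda>n. (a (Suc n) powr (- s) - a n powr (- s)) / (real (Suc n) - real n)) \<longlonglongrightarrow> s * c"
    by (rule Lim_transform_eventually)
  then have "(\<lambda>n. a n powr (- s) / real n) \<longlonglongrightarrow> s * c"
    by (intro stolz_cesaro[OF _ filterlim_real_sequentially]) auto
  then have "(\<lambda>n. (a n powr (- s) / real n) powr (- 1 / s)) \<longlonglongrightarrow> (s * c) powr (- 1 / s)"
    using s c by (intro tendsto_powr tendsto_const) auto
  moreover have "\<forall>\<^sub>F n in sequentially. (a n powr (- s) / real n) powr (- 1 / s) = a n * real n powr (1 / s)"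
    using eventually_gt_at_top[of 0]
  proof eventually_elim
    case (elim n)
    have "(a n powr (- s) / real n) powr (- 1 / s) = (a n powr (- s)) powr (- 1 / s) / real n powr (- 1 / s)"
      by (rule powr_divide)
    also have "(a n powr (- s)) powr (- 1 / s) = a n" using pos[of n] s by (simp add: powr_powr)
    also have "real n powr (- 1 / s) = 1 / real n powr (1 / s)" by (simp add: powr_minus_divide)
    finally show ?case by simp
  qed
  ultimately show ?thesis by (rule Lim_transform_eventually)
qed

text \<open>With \<open>T j\<close> the \<open>h\<close>-mass of \<open>[0, A j]\<close> this is the
  mass gained through the weights at rate \<gamma>, to be compared with the loss \<open>T N\<close>;
  the threshold is where gain and loss agree.\<close>

definition excess :: "(nat \<Rightarrow> real) \<Rightarrow> nat \<Rightarrow> real \<Rightarrow> real" where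
  "excess T N \<gamma> = (\<Sum>j<N. (exp (\<gamma> * real (Suc j)) - 1) * (T j - T (Suc j)))"

definition rate :: "real \<Rightarrow> real \<Rightarrow> real \<Rightarrow> real" where
  "rate s d m = (if s < 1 then d * m else if s = 1 then d * (m / (- ln m)) else d * m powr s)"

lemma abel_moment:
  fixes T :: "nat \<Rightarrow> real"
  shows "(\<Sum>j<N. real (Suc j) ^ Suc i * (T j - T (Suc j))) =
    (\<Sum>j<N. (real (Suc j) ^ Suc i - real j ^ Suc i) * T j) - real N ^ Suc i * T N"
  by (induction N) (auto simp: algebra_simps)

text \<open>All exponents are at most \<open>\<gamma> N * real N\<close>, which tends to 0, so
  \<open>exp x - 1\<close> lies between \<open>x\<close> and
  \<open>exp (\<gamma> N * real N) * x\<close> for each of them; the linear term is evaluated by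
  summation by parts. This serves for s \<le> 1.\<close>

lemma excess_small:
  fixes T :: "nat \<Rightarrow> real"
  assumes dec: "\<And>j. T (Suc j) \<le> T j" and pos: "\<And>j. 0 < T j"
    and g0: "\<And>N. 0 \<le> \<gamma> N" and gN: "(\<lambda>N. \<gamma> N * real N) \<longlonglongrightarrow> 0"
    and lim: "(\<lambda>N. \<gamma> N * ((\<Sum>j<N. T j) - real N * T N) / T N) \<longlonglongrightarrow> z"
  shows "(\<lambda>N. excess T N (\<gamma> N) / T N) \<longlonglongrightarrow> z"
proof (rule tendsto_sandwich[OF _ _ lim])
  have M: "(\<Sum>j<N. T j) - real N * T N = (\<Sum>j<N. real (Suc j) * (T j - T (Suc j)))" for N
    using abel_moment[of 0 T N] by simp
  show "\<forall>\<^sub>F N in sequentially. \<gamma> N * ((\<Sum>j<N. T j) - real N * T N) / T N \<le> excess T N (\<gamma> N) / T N"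
  proof (intro always_eventually allI divide_right_mono)
    fix N
    have "\<gamma> N * real (Suc j) * (T j - T (Suc j)) \<le> (exp (\<gamma> N * real (Suc j)) - 1) * (T j - T (Suc j))" for j
      using exp_ge_add_one_self[of "\<gamma> N * real (Suc j)"] dec[of j] by (intro mult_right_mono) linarith+
    then show "\<gamma> N * ((\<Sum>j<N. T j) - real N * T N) \<le> excess T N (\<gamma> N)"
      unfolding M excess_def by (simp add: sum_distrib_left sum_mono mult.assoc)
  qed (simp add: pos less_imp_le)
  show "\<forall>\<^sub>F N in sequentially. excess T N (\<gamma> N) / T N \<le> exp (\<gamma> N * real N) * (\<gamma> N * ((\<Sum>j<N. T j) - real N * T N) / T N)"
  proof (intro always_eventually allI)
    fix N
    have "(exp (\<gamma> N * real (Suc j)) - 1) * (T j - T (Suc j)) \<le> exp (\<gamma> N * real N) * (\<gamma> N * real (Suc j)) * (T j - T (Suc j))"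
      if "j < N" for j
    proof (intro mult_right_mono)
      let ?x = "\<gamma> N * real (Suc j)"
      have "exp ?x * (1 - ?x) \<le> exp ?x * exp (- ?x)"
        using exp_ge_add_one_self[of "- ?x"] by (intro mult_left_mono) simp_all
      then have "exp ?x - 1 \<le> exp ?x * ?x" by (simp add: algebra_simps flip: exp_add)
      also have "\<dots> \<le> exp (\<gamma> N * real N) * ?x"
        using that g0[of N] by (intro mult_right_mono) (auto intro!: mult_left_mono)
      finally show "exp ?x - 1 \<le> exp (\<gamma> N * real N) * ?x" .
    qed (use dec[of j] in simp)
    then have "excess T N (\<gamma> N) \<le> exp (\<gamma> N * real N) * (\<gamma> N * ((\<Sum>j<N. T j) - real N * T N))"
      unfolding M excess_def sum_distrib_left by (intro sum_mono) (simp add: mult.assoc)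
    then show "excess T N (\<gamma> N) / T N \<le> exp (\<gamma> N * real N) * (\<gamma> N * ((\<Sum>j<N. T j) - real N * T N) / T N)"
      using pos[of N] divide_right_mono[of _ _ "T N"] by fastforce
  qed
  show "(\<lambda>N. exp (\<gamma> N * real N) * (\<gamma> N * ((\<Sum>j<N. T j) - real N * T N) / T N)) \<longlonglongrightarrow> z"
    using tendsto_mult[OF tendsto_exp[OF gN] lim] by simp
qed

text \<open>
  The series \<open>y * stable_series \<alpha> y = (\<Sum>i\<ge>1. y^i / i! * \<alpha> / (i - \<alpha>))\<close> is the integral of
  \<open>(exp (y x) - 1) \<alpha> x powr (- \<alpha> - 1)\<close> over \<open>[0,1]\<close>.
\<close>

definition stable_series :: "real \<Rightarrow> real \<Rightarrow> real" where
  "stable_series \<alpha> y = (\<Sum>i. \<alpha> / (fact (Suc i) * (real (Suc i) - \<alpha>)) * y ^ i)"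

lemma stable_series_facts:
  assumes "0 < \<alpha>" "\<alpha> < 1"
  shows "summable (\<lambda>i. \<alpha> / (fact (Suc i) * (real (Suc i) - \<alpha>)) * y ^ i)"
    and "isCont (stable_series \<alpha>) y"
    and "0 \<le> y \<Longrightarrow> y \<le> y' \<Longrightarrow> stable_series \<alpha> y \<le> stable_series \<alpha> y'"
    and "0 \<le> y \<Longrightarrow> \<alpha> / (1 - \<alpha>) \<le> stable_series \<alpha> y"
proof -
  let ?c = "\<lambda>i. \<alpha> / (fact (Suc i) * (real (Suc i) - \<alpha>))"
  have c0: "0 < ?c i" for i using assms by (intro divide_pos_pos mult_pos_pos) auto
  have sm: "summable (\<lambda>i. ?c i * y ^ i)" for y
  proof (rule summable_comparison_test'[where N = 0])
    show "summable (\<lambda>i. \<alpha> / (1 - \<alpha>) * (inverse (fact i) * \<bar>y\<bar> ^ i))"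
      by (intro summable_mult summable_exp)
    fix i :: nat
    have "?c i \<le> \<alpha> / (fact i * (1 - \<alpha>))"
    proof (intro divide_left_mono mult_mono)
      show "fact i \<le> (fact (Suc i) :: real)" by (simp add: fact_mono)
    qed (use assms in \<open>auto intro!: mult_pos_pos\<close>)
    then have "\<bar>?c i\<bar> * \<bar>y\<bar> ^ i \<le> \<alpha> / (fact i * (1 - \<alpha>)) * \<bar>y\<bar> ^ i"
      unfolding abs_of_pos[OF c0] by (intro mult_right_mono zero_le_power abs_ge_zero)
    then show "norm (?c i * y ^ i) \<le> \<alpha> / (1 - \<alpha>) * (inverse (fact i) * \<bar>y\<bar> ^ i)"
      unfolding norm_mult norm_power unfolding real_norm_def abs_of_pos[OF c0] by (simp add: divide_inverse mult_ac)
  qed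
  show "summable (\<lambda>i. ?c i * y ^ i)" by (rule sm)
  show "isCont (stable_series \<alpha>) y"
    unfolding stable_series_def[abs_def] by (rule isCont_powser[OF sm[of "\<bar>y\<bar> + 1"]]) auto
  show "stable_series \<alpha> y \<le> stable_series \<alpha> y'" if "0 \<le> y" "y \<le> y'"
    unfolding stable_series_def using c0 that by (intro suminf_le sm mult_left_mono power_mono) (auto intro: less_imp_le)
  show "\<alpha> / (1 - \<alpha>) \<le> stable_series \<alpha> y" if "0 \<le> y"
  proof -
    have "(\<Sum>i\<in>{0}. ?c i * y ^ i) \<le> stable_series \<alpha> y"
      unfolding stable_series_def
    proof (rule sum_le_suminf[OF sm])
      show "0 \<le> ?c i * y ^ i" for i using less_imp_le[OF c0[of i]] that by (intro mult_nonneg_nonneg zero_le_power)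
    qed simp
    then show ?thesis by simp
  qed
qed

text \<open>Here the largest exponent has limit \<open>y\<close>, which need not be small, so the
  exponential is expanded to all orders. Each moment of the gap masses is divided by its natural
  size \<open>real N ^ Suc i * T N\<close>; summation by parts and averaging give its limit, and
  dominated convergence for series recombines the orders.\<close>

lemma excess_stable:
  fixes T :: "nat \<Rightarrow> real"
  assumes a: "0 < \<alpha>" "\<alpha> < 1" and pos: "\<And>j. 0 < T j"
    and T: "(\<lambda>n. T n * real n powr \<alpha>) \<longlonglongrightarrow> \<tau>" "0 < \<tau>"
    and g0: "\<And>N. 0 \<le> \<gamma> N" and gN: "(\<lambda>N. \<gamma> N * real N) \<longlonglongrightarrow> y"
  shows "(\<lambda>N. excess T N (\<gamma> N) / T N) \<longlonglongrightarrow> y * stable_series \<alpha> y"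
proof -
  \<comment> \<open>By \<open>abel_moment\<close>, \<open>S i N - 1\<close> is the moment of order
    \<open>Suc i\<close> of the gap masses divided by \<open>real N ^ Suc i * T N\<close>.\<close>
  define S where "S i N = (\<Sum>j<N. (real (Suc j) ^ Suc i - real j ^ Suc i) * T j) / (real N ^ Suc i * T N)" for i N
  have S_lim: "S i \<longlonglongrightarrow> real (Suc i) / (real (Suc i) - \<alpha>)" for i
  proof -
    let ?p = "real (Suc i)"
    have ia: "?p - \<alpha> > 0" using a by simp
    have pw: "real n powr ?p = real n ^ Suc i" for n by (subst powr_realpow') auto
    have "(\<lambda>n. ((real (Suc n) powr ?p - real n powr ?p) * real n / real n powr ?p * (T n * real n powr \<alpha>))
        / ((real (Suc n) powr (?p - \<alpha>) - real n powr (?p - \<alpha>)) * real n / real n powr (?p - \<alpha>)))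
        \<longlonglongrightarrow> ?p * \<tau> / (?p - \<alpha>)"
      using ia by (intro tendsto_divide tendsto_mult powr_increment T) auto
    moreover have "\<forall>\<^sub>F n in sequentially. ((real (Suc n) powr ?p - real n powr ?p) * real n / real n powr ?p * (T n * real n powr \<alpha>))
        / ((real (Suc n) powr (?p - \<alpha>) - real n powr (?p - \<alpha>)) * real n / real n powr (?p - \<alpha>))
        = ((\<Sum>j<Suc n. (real (Suc j) ^ Suc i - real j ^ Suc i) * T j) - (\<Sum>j<n. (real (Suc j) ^ Suc i - real j ^ Suc i) * T j))
          / (real (Suc n) powr (?p - \<alpha>) - real n powr (?p - \<alpha>))"
      using eventually_gt_at_top[of 0]
    proof eventually_elim
      case (elim n)
      \<comment> \<open>The powers of \<open>n\<close> inserted above, so that numerator and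
        denominator converge separately, cancel.\<close>
      have quot: "((X - Q * R) * n / (Q * R) * (t * R)) / ((Q' - Q) * n / Q) = (X - Q * R) * t / (Q' - Q)"
        if "n > 0" "Q > 0" "R > 0" for X Q R Q' t n :: real
        using that by (cases "Q' = Q") (simp_all add: field_simps)
      have "real n powr ?p = real n powr (?p - \<alpha>) * real n powr \<alpha>" by (simp flip: powr_add)
      then have "real n ^ Suc i = real n powr (?p - \<alpha>) * real n powr \<alpha>" by (simp only: pw)
      moreover have "real n > 0" "real n powr (?p - \<alpha>) > 0" "real n powr \<alpha> > 0" using elim by auto
      ultimately show ?case unfolding pw sum.lessThan_Suc add_diff_cancel_left' using quot by presburger
    qed
    ultimately have ratio: "(\<lambda>n. ((\<Sum>j<Suc n. (real (Suc j) ^ Suc i - real j ^ Suc i) * T j) - (\<Sum>j<n. (real (Suc j) ^ Suc i - real j ^ Suc i) * T j))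
          / (real (Suc n) powr (?p - \<alpha>) - real n powr (?p - \<alpha>))) \<longlonglongrightarrow> ?p * \<tau> / (?p - \<alpha>)"
      by (rule Lim_transform_eventually)
    have incr: "real n powr (?p - \<alpha>) < real (Suc n) powr (?p - \<alpha>)" for n
      using ia by (intro powr_less_mono2) auto
    have infty: "filterlim (\<lambda>n. real n powr (?p - \<alpha>)) at_top sequentially"
      using ia by real_asymp
    have "(\<lambda>n. (\<Sum>j<n. (real (Suc j) ^ Suc i - real j ^ Suc i) * T j) / real n powr (?p - \<alpha>)) \<longlonglongrightarrow> ?p * \<tau> / (?p - \<alpha>)"
      by (rule stolz_cesaro[OF incr infty ratio])
    then have "(\<lambda>n. (\<Sum>j<n. (real (Suc j) ^ Suc i - real j ^ Suc i) * T j) / real n powr (?p - \<alpha>) / (T n * real n powr \<alpha>))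
       \<longlonglongrightarrow> ?p * \<tau> / (?p - \<alpha>) / \<tau>"
      by (rule tendsto_divide[OF _ T(1)]) (use T(2) in simp)
    moreover have "\<forall>\<^sub>F n in sequentially. (\<Sum>j<n. (real (Suc j) ^ Suc i - real j ^ Suc i) * T j) / real n powr (?p - \<alpha>) / (T n * real n powr \<alpha>) = S i n"
      using eventually_gt_at_top[of 0]
    proof eventually_elim
      case (elim n)
      have "real n powr (?p - \<alpha>) = real n powr ?p / real n powr \<alpha>" by (rule powr_diff)
      moreover have "real n powr ?p > 0" "real n powr \<alpha> > 0" using elim by auto
      ultimately show ?case using elim unfolding S_def pw by (simp add: field_simps del: power_Suc)
    qed
    ultimately have "S i \<longlonglongrightarrow> ?p * \<tau> / (?p - \<alpha>) / \<tau>" by (rule Lim_transform_eventually)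
    then show ?thesis using T(2) by simp
  qed
  have S_nonneg: "0 \<le> S i N" for i N
    unfolding S_def using pos
    by (intro divide_nonneg_nonneg sum_nonneg mult_nonneg_nonneg) (auto intro!: power_mono less_imp_le simp del: power_Suc)
  have "convergent (S 0)" using S_lim convergentI by blast
  then obtain B where B: "\<And>N. \<bar>S 0 N\<bar> \<le> B" using convergent_imp_Bseq[of "S 0"] by (auto simp: Bseq_def)
  \<comment> \<open>A bound linear in \<open>i\<close> and uniform in \<open>N\<close>: after
    division by \<open>fact (Suc i)\<close> it leaves a multiple of an exponential series as
    majorant.\<close>
  have S_le: "S i N \<le> real (Suc i) * B" for i N
  proof (cases "N = 0")
    case False
    have "(real (Suc j) ^ Suc i - real j ^ Suc i) * T j \<le> (real (Suc i) * real N ^ i) * T j" if "j < N" for j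
    proof (intro mult_right_mono)
      have "real (Suc j) ^ Suc i - real j ^ Suc i = (real (Suc j) - real j) * (\<Sum>p<Suc i. real (Suc j) ^ p * real j ^ (Suc i - Suc p))"
        unfolding power_diff_sumr2[of "real (Suc j)" "Suc i" "real j"] by (simp only: mult.commute)
      also have "\<dots> \<le> (\<Sum>p<Suc i. real N ^ i)"
      proof -
        have "real (Suc j) ^ p * real j ^ (Suc i - Suc p) \<le> real N ^ i" if "p < Suc i" for p
        proof -
          have "real (Suc j) ^ p * real j ^ (Suc i - Suc p) \<le> real N ^ p * real N ^ (Suc i - Suc p)"
            using \<open>j < N\<close> by (intro mult_mono power_mono) auto
          also have "\<dots> = real N ^ i" using that by (simp flip: power_add)
          finally show ?thesis .
        qed
        then have "(\<Sum>p<Suc i. real (Suc j) ^ p * real j ^ (Suc i - Suc p)) \<le> (\<Sum>p<Suc i. real N ^ i)"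
          by (intro sum_mono) auto
        then show ?thesis by simp
      qed
      finally show "real (Suc j) ^ Suc i - real j ^ Suc i \<le> real (Suc i) * real N ^ i" by simp
    qed (simp add: pos less_imp_le)
    then have "(\<Sum>j<N. (real (Suc j) ^ Suc i - real j ^ Suc i) * T j) \<le> (real (Suc i) * real N ^ i) * (\<Sum>j<N. T j)"
      unfolding sum_distrib_left by (intro sum_mono) auto
    then have "S i N \<le> (real (Suc i) * real N ^ i) * (\<Sum>j<N. T j) / (real N ^ Suc i * T N)"
      unfolding S_def using less_imp_le[OF pos[of N]] by (intro divide_right_mono mult_nonneg_nonneg zero_le_power) auto
    also have "\<dots> = real (Suc i) * S 0 N" using False by (simp add: S_def)
    also have "\<dots> \<le> real (Suc i) * B" using B[of N] by (intro mult_left_mono) auto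
    finally show ?thesis .
  next
    case True then show ?thesis using B[of 0] by (simp add: S_def)
  qed
  have B0: "0 \<le> B" using B[of 0] by linarith
  obtain Y where Y: "\<And>N. \<bar>\<gamma> N * real N\<bar> \<le> Y"
    using convergent_imp_Bseq[OF convergentI[OF gN]] by (auto simp: Bseq_def)
  have Y0: "0 \<le> Y" using Y[of 0] by simp
  have excess_eq: "(\<lambda>i. (\<gamma> N * real N) ^ Suc i / fact (Suc i) * (S i N - 1)) sums (excess T N (\<gamma> N) / T N)" if "N > 0" for N
  proof -
    have "(\<lambda>i. x ^ Suc i / fact (Suc i)) sums (exp x - 1)" for x :: real
      using exp_converges[of x] sums_Suc_iff[of "\<lambda>i. x ^ i / fact i" "exp x - 1"]
      by (simp add: scaleR_conv_of_real field_simps del: power_Suc fact_Suc)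
    then have "(\<lambda>i. \<Sum>j<N. (\<gamma> N * real (Suc j)) ^ Suc i / fact (Suc i) * (T j - T (Suc j))) sums excess T N (\<gamma> N)"
      unfolding excess_def by (intro sums_sum sums_mult2)
    then have "(\<lambda>i. (\<Sum>j<N. (\<gamma> N * real (Suc j)) ^ Suc i / fact (Suc i) * (T j - T (Suc j))) / T N) sums (excess T N (\<gamma> N) / T N)"
      by (rule sums_divide)
    moreover have "(\<Sum>j<N. (\<gamma> N * real (Suc j)) ^ Suc i / fact (Suc i) * (T j - T (Suc j))) / T N
      = (\<gamma> N * real N) ^ Suc i / fact (Suc i) * (S i N - 1)" for i
    proof -
      have "(\<Sum>j<N. (\<gamma> N * real (Suc j)) ^ Suc i / fact (Suc i) * (T j - T (Suc j)))
        = \<gamma> N ^ Suc i / fact (Suc i) * (\<Sum>j<N. real (Suc j) ^ Suc i * (T j - T (Suc j)))"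
        by (simp add: power_mult_distrib sum_distrib_left mult_ac del: power_Suc fact_Suc)
      also have "\<dots> = \<gamma> N ^ Suc i / fact (Suc i) * (real N ^ Suc i * T N * (S i N - 1))"
        unfolding abel_moment using that pos[of N] by (simp add: S_def right_diff_distrib del: power_Suc fact_Suc)
      finally show ?thesis using pos[of N] by (simp add: power_mult_distrib less_imp_neq[symmetric] del: power_Suc fact_Suc)
    qed
    ultimately show ?thesis by simp
  qed
  have lim_eq: "y ^ Suc i / fact (Suc i) * (real (Suc i) / (real (Suc i) - \<alpha>) - 1) =
      y * (\<alpha> / (fact (Suc i) * (real (Suc i) - \<alpha>)) * y ^ i)" for i
  proof -
    have "real (Suc i) - \<alpha> > 0" using a by simp
    then have "real (Suc i) / (real (Suc i) - \<alpha>) - 1 = \<alpha> / (real (Suc i) - \<alpha>)" by (simp add: field_simps)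
    then show ?thesis by simp
  qed
  have "(\<lambda>N. \<Sum>i. (\<gamma> N * real N) ^ Suc i / fact (Suc i) * (S i N - 1)) \<longlonglongrightarrow>
    (\<Sum>i. y ^ Suc i / fact (Suc i) * (real (Suc i) / (real (Suc i) - \<alpha>) - 1))"
  proof (rule tannerys_theorem[where M = "\<lambda>i. (Y * B + Y) * (inverse (fact i) * Y ^ i)" and F = sequentially,
        THEN conjunct2, THEN conjunct2])
    show "(\<lambda>N. (\<gamma> N * real N) ^ Suc i / fact (Suc i) * (S i N - 1)) \<longlonglongrightarrow>
       y ^ Suc i / fact (Suc i) * (real (Suc i) / (real (Suc i) - \<alpha>) - 1)" for i
      by (intro tendsto_intros gN S_lim; simp)
    show "summable (\<lambda>i. (Y * B + Y) * (inverse (fact i) * Y ^ i))"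
      by (intro summable_mult summable_exp)
    have "norm ((\<gamma> N * real N) ^ Suc i / fact (Suc i) * (S i N - 1)) \<le> (Y * B + Y) * (inverse (fact i) * Y ^ i)" for i N
    proof -
      have "\<bar>S i N - 1\<bar> \<le> real (Suc i) * B + real (Suc i)"
        using S_le[of i N] S_nonneg[of i N] B0 by (simp add: abs_le_iff algebra_simps)
      then have "\<bar>(\<gamma> N * real N) ^ Suc i\<bar> * \<bar>S i N - 1\<bar> \<le> Y ^ Suc i * (real (Suc i) * B + real (Suc i))"
        unfolding power_abs using Y[of N] Y0 by (intro mult_mono power_mono) auto
      then have "\<bar>(\<gamma> N * real N) ^ Suc i\<bar> * \<bar>S i N - 1\<bar> / fact (Suc i) \<le> Y ^ Suc i * (real (Suc i) * B + real (Suc i)) / fact (Suc i)"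
        by (intro divide_right_mono) auto
      also have "\<dots> = (Y * B + Y) * (inverse (fact i) * Y ^ i)"
      proof -
        have "Y ^ Suc i * (real (Suc i) * B + real (Suc i)) / fact (Suc i) = real (Suc i) * (Y ^ Suc i * (B + 1)) / (real (Suc i) * fact i)"
          by (simp add: algebra_simps)
        also have "\<dots> = Y ^ Suc i * (B + 1) / fact i" by (rule mult_divide_mult_cancel_left) simp
        finally show ?thesis by (simp add: divide_inverse algebra_simps)
      qed
      finally show ?thesis by (simp add: abs_mult del: power_Suc fact_Suc)
    qed
    then show "\<forall>\<^sub>F (i, N) in at_top \<times>\<^sub>F sequentially.
        norm ((\<gamma> N * real N) ^ Suc i / fact (Suc i) * (S i N - 1)) \<le> (Y * B + Y) * (inverse (fact i) * Y ^ i)"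
      by (intro always_eventually) auto
  qed auto
  also have "(\<Sum>i. y ^ Suc i / fact (Suc i) * (real (Suc i) / (real (Suc i) - \<alpha>) - 1)) = y * stable_series \<alpha> y"
    unfolding lim_eq stable_series_def by (intro suminf_mult stable_series_facts a)
  finally have "(\<lambda>N. \<Sum>i. (\<gamma> N * real N) ^ Suc i / fact (Suc i) * (S i N - 1)) \<longlonglongrightarrow> y * stable_series \<alpha> y" .
  moreover have "\<forall>\<^sub>F N in sequentially. (\<Sum>i. (\<gamma> N * real N) ^ Suc i / fact (Suc i) * (S i N - 1)) = excess T N (\<gamma> N) / T N"
    using eventually_gt_at_top[of 0]
    by eventually_elim (rule sums_unique[symmetric, OF excess_eq])
  ultimately show ?thesis by (rule Lim_transform_eventually)
qed

text \<open>Instead of solving for the threshold, the limit of the gain-to-loss ratio is computed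
  along \<open>z * rate\<close>. It lies strictly on the same side of 1 as \<open>z\<close>, which
  locates the threshold to first order. The constant \<open>d\<close> is fixed by requiring the
  limit 1 at \<open>z = 1\<close>.\<close>

lemma excess_threshold:
  fixes T A :: "nat \<Rightarrow> real"
  assumes s: "0 < s" and Tdec: "\<And>j. T (Suc j) < T j" and Tpos: "\<And>j. 0 < T j"
    and A: "\<And>j. 0 < A j" "\<And>j. A j \<le> 1"
    and TA: "(\<lambda>N. T N / A N) \<longlonglongrightarrow> h0" "0 < h0"
    and asym: "(\<lambda>n. A n * real n powr (1 / s)) \<longlonglongrightarrow> k" "0 < k"
  obtains d where "0 < d" "\<And>z. 0 < z \<Longrightarrow> \<exists>e. (\<lambda>N. excess T N (z * rate s d (A N)) / T N) \<longlonglongrightarrow> e \<and>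
      (z < 1 \<longrightarrow> e < 1) \<and> (1 < z \<longrightarrow> 1 < e) \<and> 0 \<le> e"
proof -
  have Asymp: "(\<lambda>n. T n * real n powr (1 / s)) \<longlonglongrightarrow> h0 * k"
    using tendsto_mult[OF TA(1) asym(1)] A(1) by (simp add: less_imp_neq[symmetric])
  have Tdec': "T (Suc j) \<le> T j" for j using Tdec less_imp_le by blast
  have AT: "(\<lambda>N. A N / T N) \<longlonglongrightarrow> 1 / h0"
    using tendsto_divide[OF tendsto_const[of 1] TA(1)] TA(2) by simp
  consider "s < 1" | "s = 1" | "1 < s" by linarith
  then show thesis
  proof cases
    case 1
    have N0: "(\<lambda>n. real n powr (1 - 1 / s)) \<longlonglongrightarrow> 0" using s 1 by real_asymp
    have AN: "(\<lambda>n. A n * real n) \<longlonglongrightarrow> 0"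
    proof -
      have "A n * real n powr (1 / s) * real n powr (1 - 1 / s) = A n * real n" for n
        by (cases "n = 0") (simp_all add: mult.assoc flip: powr_add)
      then show ?thesis using tendsto_mult[OF asym(1) N0] by (simp only: mult_zero_right)
    qed
    have TN: "(\<lambda>n. real n * T n) \<longlonglongrightarrow> 0"
      using tendsto_mult[OF TA(1) AN] A(1) by (simp add: less_imp_neq[symmetric] mult.commute)
    have "summable T"
    proof (rule summable_comparison_test_bigo)
      show "summable (\<lambda>n. norm (real n powr (- 1 / s)))"
        using s 1 by (simp add: summable_real_powr_iff)
      show "T \<in> O(\<lambda>n. real n powr (- 1 / s))"
      proof (rule bigoI_tendsto)
        have "T n * real n powr (1 / s) = T n / real n powr (- 1 / s)" for n
          by (simp add: powr_minus_divide)
        then show "(\<lambda>n. T n / real n powr (- 1 / s)) \<longlonglongrightarrow> h0 * k" using Asymp by simp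
      qed (auto intro!: eventually_mono[OF eventually_gt_at_top[of 0]])
    qed
    then have M: "(\<lambda>N. (\<Sum>j<N. T j) - real N * T N) \<longlonglongrightarrow> suminf T"
      using tendsto_diff[OF summable_LIMSEQ TN] by simp
    have Mpos: "0 < suminf T" using \<open>summable T\<close> Tpos by (rule suminf_pos)
    \<comment> \<open>By summation by parts \<open>suminf T\<close> is the mean of
      \<open>Suc j\<close> under the masses \<open>T j - T (Suc j)\<close>, a mean return time. The
      linearised equation is \<open>\<gamma> * suminf T = T N\<close>, and \<open>T N\<close> is
      asymptotic to \<open>h0 * A N\<close>.\<close>
    show thesis
    proof (rule that[of "h0 / suminf T"])
      fix z :: real assume z: "0 < z"
      have "(\<lambda>N. excess T N (z * rate s (h0 / suminf T) (A N)) / T N) \<longlonglongrightarrow> z"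
      proof (rule excess_small[where T = T, OF Tdec' Tpos])
        show "0 \<le> z * rate s (h0 / suminf T) (A N)" for N
          using 1 z TA Mpos A(1)[of N] by (simp add: rate_def)
        show "(\<lambda>N. z * rate s (h0 / suminf T) (A N) * real N) \<longlonglongrightarrow> 0"
          using 1 tendsto_mult[OF tendsto_const[of "z * (h0 / suminf T)"] AN] by (simp add: rate_def mult_ac)
        have "(\<lambda>N. (z * (h0 / suminf T)) * ((A N / T N) * ((\<Sum>j<N. T j) - real N * T N)))
            \<longlonglongrightarrow> (z * (h0 / suminf T)) * (1 / h0 * suminf T)"
          by (intro tendsto_intros AT M)
        then show "(\<lambda>N. z * rate s (h0 / suminf T) (A N) * ((\<Sum>j<N. T j) - real N * T N) / T N) \<longlonglongrightarrow> z"
          using 1 TA Mpos by (simp add: rate_def mult_ac)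
      qed
      then show "\<exists>e. (\<lambda>N. excess T N (z * rate s (h0 / suminf T) (A N)) / T N) \<longlonglongrightarrow> e \<and>
        (z < 1 \<longrightarrow> e < 1) \<and> (1 < z \<longrightarrow> 1 < e) \<and> 0 \<le> e" using z by auto
    qed (use Mpos TA in auto)
  next
    case 2
    have AN: "(\<lambda>n. A n * real n) \<longlonglongrightarrow> k" using asym(1) 2 by simp
    have TN: "(\<lambda>n. T n * real n) \<longlonglongrightarrow> h0 * k" using Asymp 2 by simp
    have linf: "filterlim (\<lambda>n. ln (real n)) at_top sequentially" by real_asymp
    have inv0: "(\<lambda>n. 1 / ln (real n)) \<longlonglongrightarrow> 0" by real_asymp
    have S: "(\<lambda>N. (\<Sum>j<N. T j) / ln (real N)) \<longlonglongrightarrow> h0 * k"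
    proof (rule stolz_cesaro[OF _ linf])
      show "ln (real n) < ln (real (Suc n))" if "n \<ge> 1" for n using that by simp
      have "(\<lambda>n. real n * (ln (real (Suc n)) - ln (real n))) \<longlonglongrightarrow> 1" by real_asymp
      from tendsto_divide[OF TN this]
      have "(\<lambda>n. T n * real n / (real n * (ln (real (Suc n)) - ln (real n)))) \<longlonglongrightarrow> h0 * k" by simp
      moreover have "\<forall>\<^sub>F n in sequentially. T n * real n / (real n * (ln (real (Suc n)) - ln (real n)))
         = ((\<Sum>j<Suc n. T j) - (\<Sum>j<n. T j)) / (ln (real (Suc n)) - ln (real n))"
        using eventually_gt_at_top[of 0] by eventually_elim simp
      ultimately show "(\<lambda>n. ((\<Sum>j<Suc n. T j) - (\<Sum>j<n. T j)) / (ln (real (Suc n)) - ln (real n))) \<longlonglongrightarrow> h0 * k"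
        by (rule Lim_transform_eventually)
    qed
    have M: "(\<lambda>N. ((\<Sum>j<N. T j) - real N * T N) / ln (real N)) \<longlonglongrightarrow> h0 * k"
      using tendsto_diff[OF S tendsto_mult[OF TN inv0]] by (simp add: diff_divide_distrib mult.commute)
    have L: "(\<lambda>n. - ln (A n) / ln (real n)) \<longlonglongrightarrow> 1"
    proof -
      have "(\<lambda>n. 1 - ln (A n * real n) * (1 / ln (real n))) \<longlonglongrightarrow> 1 - ln k * 0"
        using asym(2) by (intro tendsto_intros AN inv0) auto
      moreover have "\<forall>\<^sub>F n in sequentially. 1 - ln (A n * real n) * (1 / ln (real n)) = - ln (A n) / ln (real n)"
        using eventually_gt_at_top[of 1]
      proof eventually_elim
        case (elim n)
        then have "ln (real n) > 0" by simp
        then show ?case using elim A(1)[of n] by (simp add: ln_mult field_simps)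
      qed
      ultimately show ?thesis using Lim_transform_eventually by fastforce
    qed
    have Li: "(\<lambda>n. ln (real n) / (- ln (A n))) \<longlonglongrightarrow> 1"
      using tendsto_divide[OF tendsto_const[of 1] L] by simp
    have Li0: "(\<lambda>n. 1 / (- ln (A n))) \<longlonglongrightarrow> 0"
    proof -
      have "\<forall>\<^sub>F n in sequentially. ln (real n) / (- ln (A n)) * (1 / ln (real n)) = 1 / (- ln (A n))"
        using eventually_gt_at_top[of 1] by eventually_elim simp
      then show ?thesis using tendsto_mult[OF Li inv0] Lim_transform_eventually by fastforce
    qed
    \<comment> \<open>The truncated mean now grows like \<open>h0 * k * ln N\<close>, and
      \<open>- ln (A N)\<close> is asymptotic to \<open>ln N\<close>. The factor \<open>h0\<close>
      cancels against the one in \<open>T N\<close>, which leaves \<open>1 / k\<close>.\<close>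
    show thesis
    proof (rule that[of "1 / k"])
      fix z :: real assume z: "0 < z"
      have "(\<lambda>N. excess T N (z * rate s (1 / k) (A N)) / T N) \<longlonglongrightarrow> z"
      proof (rule excess_small[where T = T, OF Tdec' Tpos])
        show "0 \<le> z * rate s (1 / k) (A N)" for N
        proof -
          have "0 \<le> - ln (A N)" using A[of N] by simp
          then have "0 \<le> 1 / k * (A N / (- ln (A N)))"
            using A(1)[of N] asym(2) by (intro mult_nonneg_nonneg divide_nonneg_nonneg) auto
          then have "0 \<le> z * (1 / k * (A N / (- ln (A N))))" using z by (intro mult_nonneg_nonneg[of z]) auto
          then show ?thesis using 2 by (simp add: rate_def)
        qed
        show "(\<lambda>N. z * rate s (1 / k) (A N) * real N) \<longlonglongrightarrow> 0"
          using 2 tendsto_mult[OF tendsto_const[of "z * (1 / k)"] tendsto_mult[OF AN Li0]] by (simp add: rate_def mult_ac)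
        have "(\<lambda>N. (z * (1 / k)) * ((A N / T N) * (((\<Sum>j<N. T j) - real N * T N) / ln (real N) * (ln (real N) / (- ln (A N))))))
            \<longlonglongrightarrow> (z * (1 / k)) * (1 / h0 * (h0 * k * 1))"
          by (intro tendsto_mult tendsto_const AT M Li)
        moreover have "\<forall>\<^sub>F N in sequentially. (z * (1 / k)) * ((A N / T N) * (((\<Sum>j<N. T j) - real N * T N) / ln (real N) * (ln (real N) / (- ln (A N)))))
          = z * rate s (1 / k) (A N) * ((\<Sum>j<N. T j) - real N * T N) / T N"
          using eventually_gt_at_top[of 1]
        proof eventually_elim
          case (elim N) then have "ln (real N) \<noteq> 0" by simp
          then show ?case using 2 by (simp add: rate_def mult_ac)
        qed
        ultimately have "(\<lambda>N. z * rate s (1 / k) (A N) * ((\<Sum>j<N. T j) - real N * T N) / T N) \<longlonglongrightarrow> (z * (1 / k)) * (1 / h0 * (h0 * k * 1))"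
          by (rule Lim_transform_eventually)
        then show "(\<lambda>N. z * rate s (1 / k) (A N) * ((\<Sum>j<N. T j) - real N * T N) / T N) \<longlonglongrightarrow> z"
          using TA(2) asym(2) by simp
      qed
      then show "\<exists>e. (\<lambda>N. excess T N (z * rate s (1 / k) (A N)) / T N) \<longlonglongrightarrow> e \<and>
        (z < 1 \<longrightarrow> e < 1) \<and> (1 < z \<longrightarrow> 1 < e) \<and> 0 \<le> e" using z by auto
    qed (use asym in auto)
  next
    case 3
    define \<alpha> where "\<alpha> = 1 / s"
    have a: "0 < \<alpha>" "\<alpha> < 1" using 3 by (auto simp: \<alpha>_def)
    define f where "f y = y * stable_series \<alpha> y" for y
    have fpos: "0 < f y" if "0 < y" for y
    proof -
      have "0 < \<alpha> / (1 - \<alpha>)" using a by simp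
      also have "\<dots> \<le> stable_series \<alpha> y" using stable_series_facts(4)[OF a] that by simp
      finally show ?thesis using that by (simp add: f_def)
    qed
    have fmono: "f y < f y'" if "0 < y" "y < y'" for y y'
    proof -
      have ss: "0 < stable_series \<alpha> y" using fpos[OF that(1)] that(1) by (simp add: f_def zero_less_mult_iff)
      have "f y < y' * stable_series \<alpha> y" using that ss by (simp add: f_def)
      also have "\<dots> \<le> f y'" unfolding f_def using that stable_series_facts(3)[OF a, of y y'] by (intro mult_left_mono) auto
      finally show ?thesis .
    qed
    \<comment> \<open>The first coefficient bounds the series from below by
      \<open>\<alpha> / (1 - \<alpha>)\<close>, so \<open>(1 - \<alpha>) / \<alpha>\<close> can
      serve as right endpoint in the intermediate value theorem.\<close>
    have "1 \<le> f ((1 - \<alpha>) / \<alpha>)"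
      unfolding f_def using mult_left_mono[OF stable_series_facts(4)[OF a, of "(1 - \<alpha>) / \<alpha>"], of "(1 - \<alpha>) / \<alpha>"] a by simp
    moreover have "isCont f y" for y
      unfolding f_def[abs_def] by (intro continuous_intros stable_series_facts(2) a)
    ultimately obtain t where t: "0 \<le> t" "f t = 1"
      using IVT[of f 0 1 "(1 - \<alpha>) / \<alpha>"] a by (auto simp: f_def)
    then have tpos: "0 < t" by (cases "t = 0") (auto simp: f_def)
    have AN: "(\<lambda>n. A n powr s * real n) \<longlonglongrightarrow> k powr s"
    proof -
      have "(\<lambda>n. (A n * real n powr (1 / s)) powr s) \<longlonglongrightarrow> k powr s"
        using asym by (intro tendsto_powr tendsto_const) auto
      moreover have "(A n * real n powr (1 / s)) powr s = A n powr s * real n" for n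
        using A(1)[of n] s by (simp add: powr_mult powr_powr)
      ultimately show ?thesis by simp
    qed
    \<comment> \<open>Since \<open>A N powr s * real N\<close> tends to \<open>k powr s\<close>,
      this constant makes the rate times \<open>N\<close> tend to \<open>z * t\<close>, where
      \<open>f t = 1\<close>.\<close>
    show thesis
    proof (rule that[of "t / k powr s"])
      fix z :: real assume z: "0 < z"
      have "(\<lambda>N. excess T N (z * rate s (t / k powr s) (A N)) / T N) \<longlonglongrightarrow> (z * t) * stable_series \<alpha> (z * t)"
      proof (rule excess_stable[where T = T, OF a Tpos])
        show "(\<lambda>n. T n * real n powr \<alpha>) \<longlonglongrightarrow> h0 * k" using Asymp by (simp add: \<alpha>_def)
        show "0 < h0 * k" using TA asym by simp
        show "0 \<le> z * rate s (t / k powr s) (A N)" for N using 3 z tpos by (simp add: rate_def)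
        have "(\<lambda>N. (z * (t / k powr s)) * (A N powr s * real N)) \<longlonglongrightarrow> (z * (t / k powr s)) * k powr s"
          by (intro tendsto_intros AN)
        then show "(\<lambda>N. z * rate s (t / k powr s) (A N) * real N) \<longlonglongrightarrow> z * t"
          using 3 asym(2) by (simp add: rate_def mult.assoc)
      qed
      moreover have "z < 1 \<longrightarrow> f (z * t) < 1" "1 < z \<longrightarrow> 1 < f (z * t)" "0 \<le> f (z * t)"
        using fmono[of "z * t" t] fmono[of t "z * t"] fpos[of "z * t"] t tpos z by auto
      ultimately show "\<exists>e. (\<lambda>N. excess T N (z * rate s (t / k powr s) (A N)) / T N) \<longlonglongrightarrow> e \<and>
        (z < 1 \<longrightarrow> e < 1) \<and> (1 < z \<longrightarrow> 1 < e) \<and> 0 \<le> e" unfolding f_def by blast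
    qed (use tpos asym in auto)
  qed
qed

section \<open>Branches, tower and survivors\<close>

text \<open>Inverse branch of the jump transformation: on points whose itinerary starts with
  \<open>j\<close> zeros and a one it inverts \<open>F ^^ Suc j\<close>. The index is the number of
  zeros, so \<open>j\<close> corresponds to the symbol \<open>Suc j\<close> of \<Sigma>.\<close>

definition ret_branch :: "(real \<Rightarrow> real) \<Rightarrow> (real \<Rightarrow> real) \<Rightarrow> nat \<Rightarrow> real \<Rightarrow> real" where
  "ret_branch \<phi>0 \<phi>1 j x = (\<phi>0 ^^ j) (\<phi>1 x)"

definition chain_deriv :: "(real \<Rightarrow> real) \<Rightarrow> (real \<Rightarrow> real) \<Rightarrow> nat \<Rightarrow> real \<Rightarrow> real" where
  "chain_deriv \<phi>0 d0 j x = (\<Prod>i<j. d0 ((\<phi>0 ^^ i) x))"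

definition ret_deriv ::
    "(real \<Rightarrow> real) \<Rightarrow> (real \<Rightarrow> real) \<Rightarrow> (real \<Rightarrow> real) \<Rightarrow> (real \<Rightarrow> real) \<Rightarrow> nat \<Rightarrow> real \<Rightarrow> real" where
  "ret_deriv \<phi>0 \<phi>1 d0 d1 j x = chain_deriv \<phi>0 d0 j (\<phi>1 x) * d1 x"

text \<open>\<open>d0\<close> and \<open>d1\<close> are absolute values of derivatives, and \<sigma>
  is the orientation of the second branch. Nothing is assumed of \<open>d0\<close> at 0, where (H2)
  gives no extension of the derivative. \<open>F_phi1\<close> leaves out the endpoints: one of them
  is sent to \<open>a\<close>, which belongs to the first branch.\<close>

locale branch_pair =
  fixes F \<phi>0 \<phi>1 d0 d1 :: "real \<Rightarrow> real" and a \<sigma> :: real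
  assumes a01: "0 < a" "a < 1"
    and phi0_cont: "continuous_on {0..1} \<phi>0" and phi0_mono: "strict_mono_on {0..1} \<phi>0"
    and phi0_0: "\<phi>0 0 = 0" and phi0_1: "\<phi>0 1 = a"
    and phi0_less: "0 < y \<Longrightarrow> y \<le> 1 \<Longrightarrow> \<phi>0 y < y"
    and d0_cont: "continuous_on {0<..1} d0" and d0_pos: "0 < y \<Longrightarrow> y \<le> 1 \<Longrightarrow> 0 < d0 y"
    and phi0_deriv: "0 < y \<Longrightarrow> y < 1 \<Longrightarrow> (\<phi>0 has_real_derivative d0 y) (at y)"
    and phi1_cont: "continuous_on {0..1} \<phi>1"
    and phi1_ends: "\<sigma> = 1 \<and> \<phi>1 0 = a \<and> \<phi>1 1 = 1 \<or> \<sigma> = - 1 \<and> \<phi>1 0 = 1 \<and> \<phi>1 1 = a"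
    and d1_cont: "continuous_on {0..1} d1" and d1_pos: "0 \<le> y \<Longrightarrow> y \<le> 1 \<Longrightarrow> 0 < d1 y"
    and phi1_deriv: "0 < y \<Longrightarrow> y < 1 \<Longrightarrow> (\<phi>1 has_real_derivative \<sigma> * d1 y) (at y)"
    and F_mem: "x \<in> {0..1} \<Longrightarrow> F x \<in> {0..1}"
    and F_phi0: "y \<in> {0..1} \<Longrightarrow> F (\<phi>0 y) = y"
    and F_phi1: "0 < y \<Longrightarrow> y < 1 \<Longrightarrow> F (\<phi>1 y) = y"
begin

abbreviation "A n \<equiv> (\<phi>0 ^^ n) 1"
abbreviation "\<Psi> \<equiv> ret_branch \<phi>0 \<phi>1"
abbreviation "D \<equiv> chain_deriv \<phi>0 d0"
abbreviation "\<l> \<equiv> ret_deriv \<phi>0 \<phi>1 d0 d1"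

lemma phi0_mono_le: "x \<in> {0..1} \<Longrightarrow> y \<in> {0..1} \<Longrightarrow> x \<le> y \<Longrightarrow> \<phi>0 x \<le> \<phi>0 y"
  using phi0_mono by (cases "x = y") (auto simp: strict_mono_on_def order_le_less)

lemma phi0_mono_less: "x \<in> {0..1} \<Longrightarrow> y \<in> {0..1} \<Longrightarrow> x < y \<Longrightarrow> \<phi>0 x < \<phi>0 y"
  using phi0_mono by (auto simp: strict_mono_on_def)

lemma phi0_pos: "0 < y \<Longrightarrow> y \<le> 1 \<Longrightarrow> 0 < \<phi>0 y"
  using phi0_mono_less[of 0 y] phi0_0 by simp

lemma phi0_unit: "y \<in> {0..1} \<Longrightarrow> \<phi>0 y \<in> {0..1}"
  using phi0_mono_le[of 0 y] phi0_mono_le[of y 1] phi0_0 phi0_1 a01 by auto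

lemma iter_unit: "y \<in> {0..1} \<Longrightarrow> (\<phi>0 ^^ n) y \<in> {0..1}"
  by (induction n) (use phi0_unit in auto)

lemma iter_pos: "0 < y \<Longrightarrow> y \<le> 1 \<Longrightarrow> 0 < (\<phi>0 ^^ n) y \<and> (\<phi>0 ^^ n) y \<le> 1"
proof (induction n)
  case (Suc n) then show ?case using phi0_pos phi0_unit[of "(\<phi>0 ^^ n) y"] by auto
qed simp

lemma iter_mono: "x \<in> {0..1} \<Longrightarrow> y \<in> {0..1} \<Longrightarrow> x \<le> y \<Longrightarrow> (\<phi>0 ^^ n) x \<le> (\<phi>0 ^^ n) y"
proof (induction n)
  case (Suc n) then show ?case using phi0_mono_le[OF iter_unit iter_unit] by simp
qed simp

lemma iter_mono_less: "x \<in> {0..1} \<Longrightarrow> y \<in> {0..1} \<Longrightarrow> x < y \<Longrightarrow> (\<phi>0 ^^ n) x < (\<phi>0 ^^ n) y"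
proof (induction n)
  case (Suc n) then show ?case using phi0_mono_less[OF iter_unit iter_unit] by simp
qed simp

lemma phi0_iter_cont: "continuous_on {0..1} (\<phi>0 ^^ n)"
proof (induction n)
  case (Suc n)
  have "continuous_on {0..1} (\<lambda>x. \<phi>0 ((\<phi>0 ^^ n) x))"
    by (rule continuous_on_compose2[OF phi0_cont Suc]) (use iter_unit in auto)
  then show ?case by (simp add: comp_def)
qed (simp add: continuous_on_id)

lemma iter_a: "(\<phi>0 ^^ n) a = A (Suc n)"
  by (simp add: funpow_swap1 flip: phi0_1)

lemma A_Suc_lt: "A (Suc n) < A n"
  using phi0_less iter_pos[of 1 n] by simp

lemma A_tendsto_0: "(\<lambda>n. A n) \<longlonglongrightarrow> 0"
proof -
  have dec: "decseq (\<lambda>n. A n)" using A_Suc_lt less_imp_le by (intro decseq_SucI) auto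
  then obtain L where L: "(\<lambda>n. A n) \<longlonglongrightarrow> L"
    using decseq_convergent[of _ 0] iter_pos[of 1] less_imp_le by (metis zero_less_one order_refl)
  have LI: "L \<in> {0..1}"
    using LIMSEQ_le_const[OF L, of 0] LIMSEQ_le_const2[OF L, of 1] iter_unit[of 1] by auto
  have "(\<lambda>n. \<phi>0 (A n)) \<longlonglongrightarrow> \<phi>0 L"
    using continuous_on_tendsto_compose[OF phi0_cont L LI] iter_unit[of 1] by (auto intro!: always_eventually)
  moreover have "(\<lambda>n. \<phi>0 (A n)) \<longlonglongrightarrow> L" using LIMSEQ_Suc[OF L] by simp
  ultimately have "\<phi>0 L = L" using LIMSEQ_unique by blast
  then have "L = 0" using phi0_less[of L] LI by (cases "L = 0") auto
  then show ?thesis using L by simp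
qed

lemma phi1_strict:
  assumes "0 \<le> x" "x < y" "y \<le> 1"
  shows "\<sigma> = 1 \<Longrightarrow> \<phi>1 x < \<phi>1 y" "\<sigma> = - 1 \<Longrightarrow> \<phi>1 y < \<phi>1 x"
proof -
  have c: "continuous_on {x..y} \<phi>1" by (rule continuous_on_subset[OF phi1_cont]) (use assms in auto)
  show "\<phi>1 x < \<phi>1 y" if "\<sigma> = 1"
  proof (rule DERIV_pos_imp_increasing_open[OF assms(2) _ c])
    fix t assume "x < t" "t < y"
    then show "\<exists>z. (\<phi>1 has_real_derivative z) (at t) \<and> 0 < z"
      using phi1_deriv[of t] d1_pos[of t] that assms by (intro exI[of _ "d1 t"]) auto
  qed
  show "\<phi>1 y < \<phi>1 x" if "\<sigma> = - 1"
  proof (rule DERIV_neg_imp_decreasing_open[OF assms(2) _ c])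
    fix t assume "x < t" "t < y"
    then show "\<exists>z. (\<phi>1 has_real_derivative z) (at t) \<and> z < 0"
      using phi1_deriv[of t] d1_pos[of t] that assms by (intro exI[of _ "- d1 t"]) auto
  qed
qed

lemma phi1_range: "y \<in> {0..1} \<Longrightarrow> \<phi>1 y \<in> {a..1}"
  using phi1_strict[of 0 y] phi1_strict[of y 1] phi1_ends by (cases "y = 0"; cases "y = 1") auto

lemma phi1_range_open: "0 < y \<Longrightarrow> y < 1 \<Longrightarrow> a < \<phi>1 y \<and> \<phi>1 y < 1"
  using phi1_strict[of 0 y] phi1_strict[of y 1] phi1_ends by auto

lemma Psi_range: "x \<in> {0..1} \<Longrightarrow> \<Psi> j x \<in> {A (Suc j)..A j}"
  using phi1_range[of x] iter_mono[of a "\<phi>1 x" j] iter_mono[of "\<phi>1 x" 1 j] a01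
  by (auto simp: ret_branch_def iter_a[symmetric] simp del: funpow.simps)

lemma Psi_range_open: "0 < x \<Longrightarrow> x < 1 \<Longrightarrow> A (Suc j) < \<Psi> j x \<and> \<Psi> j x < A j"
  using phi1_range_open[of x] iter_mono_less[of a "\<phi>1 x" j] iter_mono_less[of "\<phi>1 x" 1 j] a01
  by (auto simp: ret_branch_def iter_a[symmetric] simp del: funpow.simps)

lemma D_pos: "0 < x \<Longrightarrow> x \<le> 1 \<Longrightarrow> 0 < D j x"
  unfolding chain_deriv_def using iter_pos d0_pos by (intro prod_pos) auto

lemma D_cont: "continuous_on {0<..1} (D j)"
proof -
  have "continuous_on {0<..1} (\<lambda>x. d0 ((\<phi>0 ^^ i) x))" for i
    by (rule continuous_on_compose2[OF d0_cont continuous_on_subset[OF phi0_iter_cont]]) (use iter_pos in auto)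
  then show ?thesis unfolding chain_deriv_def[abs_def] by (intro continuous_on_prod)
qed

lemma D_Suc: "D (Suc j) x = d0 x * D j (\<phi>0 x)"
  unfolding chain_deriv_def by (subst prod.lessThan_Suc_shift) (simp add: funpow_swap1)

lemma D_add: "D (i + j) x = D i x * D j ((\<phi>0 ^^ i) x)"
proof (induction j)
  case (Suc j)
  have "(\<phi>0 ^^ (j + i)) x = (\<phi>0 ^^ j) ((\<phi>0 ^^ i) x)" by (simp only: funpow_add comp_apply)
  then have e: "(\<phi>0 ^^ (i + j)) x = (\<phi>0 ^^ j) ((\<phi>0 ^^ i) x)" by (simp only: add.commute)
  have "D (i + Suc j) x = D (i + j) x * d0 ((\<phi>0 ^^ (i + j)) x)" by (simp add: chain_deriv_def)
  also have "\<dots> = D i x * (D j ((\<phi>0 ^^ i) x) * d0 ((\<phi>0 ^^ j) ((\<phi>0 ^^ i) x)))" unfolding e Suc.IH by (simp only: mult.assoc)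
  finally show ?case by (simp add: chain_deriv_def)
qed (simp add: chain_deriv_def)

lemma iter_deriv: "0 < y \<Longrightarrow> y < 1 \<Longrightarrow> ((\<phi>0 ^^ j) has_real_derivative D j y) (at y)"
proof (induction j)
  case 0 then show ?case by (simp add: chain_deriv_def id_def)
next
  case (Suc j)
  have "0 < (\<phi>0 ^^ j) y" "(\<phi>0 ^^ j) y < 1"
    using iter_pos[of y j] iter_mono_less[of y 1 j] iter_unit[of 1 j] Suc.prems by auto
  then have "((\<lambda>x. \<phi>0 ((\<phi>0 ^^ j) x)) has_real_derivative d0 ((\<phi>0 ^^ j) y) * D j y) (at y)"
    using DERIV_chain2[OF phi0_deriv Suc.IH] Suc.prems by auto
  then show ?case by (simp add: chain_deriv_def comp_def mult.commute)
qed

lemma Psi_deriv: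
  assumes "0 < y" "y < 1" shows "(\<Psi> j has_real_derivative \<sigma> * \<l> j y) (at y)"
proof -
  have "0 < \<phi>1 y" "\<phi>1 y < 1" using phi1_range_open[OF assms] a01 by auto
  then have "((\<lambda>x. (\<phi>0 ^^ j) (\<phi>1 x)) has_real_derivative D j (\<phi>1 y) * (\<sigma> * d1 y)) (at y)"
    using DERIV_chain2[OF iter_deriv phi1_deriv[OF assms]] by auto
  then show ?thesis by (simp add: ret_branch_def[abs_def] ret_deriv_def mult_ac)
qed

lemma Psi_continuous: "continuous_on {0..1} (\<Psi> j)"
  unfolding ret_branch_def[abs_def]
  by (rule continuous_on_compose2[OF phi0_iter_cont phi1_cont]) (use phi1_range a01 in force)

lemma l_cont: "continuous_on {0..1} (\<l> j)"
proof -
  have "continuous_on {0..1} (\<lambda>x. D j (\<phi>1 x))"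
    by (rule continuous_on_compose2[OF D_cont phi1_cont]) (use phi1_range a01 in force)
  then show ?thesis unfolding ret_deriv_def[abs_def] by (intro continuous_on_mult d1_cont)
qed

lemma l_pos: "x \<in> {0..1} \<Longrightarrow> 0 < \<l> j x"
  unfolding ret_deriv_def using phi1_range[of x] a01 by (intro mult_pos_pos D_pos d1_pos) auto

lemma Psi_ends: "\<sigma> = 1 \<and> \<Psi> j 0 = A (Suc j) \<and> \<Psi> j 1 = A j \<or> \<sigma> = - 1 \<and> \<Psi> j 0 = A j \<and> \<Psi> j 1 = A (Suc j)"
  using phi1_ends
proof (elim disjE conjE)
  assume 1: "\<sigma> = 1" "\<phi>1 0 = a" "\<phi>1 1 = 1"
  show ?thesis unfolding ret_branch_def 1(2,3) iter_a using 1(1) by blast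
next
  assume 1: "\<sigma> = - 1" "\<phi>1 0 = 1" "\<phi>1 1 = a"
  show ?thesis unfolding ret_branch_def 1(2,3) iter_a using 1(1) by blast
qed

lemma Psi_substitution:
  assumes "continuous_on {0..1} f"
  shows "integral {0..1} (\<lambda>x. \<l> j x * f (\<Psi> j x)) = integral {A (Suc j)..A j} f"
proof -
  have "((\<lambda>x. (\<sigma> * \<l> j x) *\<^sub>R f (\<Psi> j x)) has_integral
      (integral {\<Psi> j 0..\<Psi> j 1} f - integral {\<Psi> j 1..\<Psi> j 0} f)) {0..1}"
  proof (rule has_integral_substitution_general[where s = "{0, 1}" and c = 0 and d = 1])
    show "\<Psi> j ` {0..1} \<subseteq> {0..1}"
    proof
      fix y assume "y \<in> \<Psi> j ` {0..1}"
      then obtain x where x: "x \<in> {0..1}" "y = \<Psi> j x" by blast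
      then show "y \<in> {0..1}"
        using Psi_range[OF x(1), of j] iter_unit[of 1 j] iter_unit[of 1 "Suc j"] by (simp del: funpow.simps)
    qed
    show "(\<Psi> j has_real_derivative \<sigma> * \<l> j x) (at x within {0..1})" if "x \<in> {0..1} - {0, 1}" for x
    proof -
      have "0 < x" "x < 1" using that by auto
      then show ?thesis by (rule has_field_derivative_at_within[OF Psi_deriv])
    qed
  qed (use assms Psi_continuous in simp_all)
  then have i: "integral {0..1} (\<lambda>x. \<sigma> * (\<l> j x * f (\<Psi> j x))) = integral {\<Psi> j 0..\<Psi> j 1} f - integral {\<Psi> j 1..\<Psi> j 0} f"
    by (simp only: integral_unique real_scaleR_def mult.assoc)
  \<comment> \<open>Of the two integrals in the substitution formula one extends over an empty
    interval; the sign of the other is that of \<sigma>.\<close>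
  have "{A j..A (Suc j)} = {}" using A_Suc_lt[of j] by auto
  then show ?thesis using Psi_ends[of j] i by (auto simp del: funpow.simps)
qed

end

locale parabolic_branches = branch_pair F \<phi>0 \<phi>1 d0 d1 a \<sigma>
  for F \<phi>0 \<phi>1 d0 d1 :: "real \<Rightarrow> real" and a \<sigma> :: real +
  fixes \<theta> C :: real
  assumes theta01: "0 < \<theta>" "\<theta> < 1" and C_gt_0: "0 < C"
    and ret_distortion: "x \<in> {0..1} \<Longrightarrow> y \<in> {0..1} \<Longrightarrow>
      \<l> j (foldr \<Psi> w x) \<le> exp (C * \<theta> ^ Suc (length w)) * \<l> j (foldr \<Psi> w y)"
begin

sublocale full_branch_system "\<lambda>n. A n" \<Psi> \<l> \<theta> C
proof
  show "A (Suc j) < A j" for j by (rule A_Suc_lt)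
  show "(\<lambda>n. A n) \<longlonglongrightarrow> 0" by (rule A_tendsto_0)
  show "\<Psi> j x \<in> {A (Suc j)..A j}" if "x \<in> {0..1}" for x j by (rule Psi_range[OF that])
  show "0 < \<l> j x" if "x \<in> {0..1}" for x j by (rule l_pos[OF that])
qed (use theta01 C_gt_0 Psi_continuous l_cont Psi_substitution ret_distortion in auto)

end

section \<open>Change of variables for nonnegative functions\<close>

lemma measurable_times_indicator:
  fixes f :: "real \<Rightarrow> real"
  assumes "continuous_on S f" "S \<in> sets borel"
  shows "(\<lambda>x. f x * indicator S x) \<in> borel_measurable borel"
  using borel_measurable_continuous_on_indicator[OF assms(2,1)] by (simp add: mult.commute)

lemma measurable_comp_indicator:
  fixes f :: "real \<Rightarrow> ennreal" and g :: "real \<Rightarrow> real"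
  assumes f: "f \<in> borel_measurable borel" and g: "continuous_on S g" "S \<in> sets borel"
  shows "(\<lambda>x. f (g x) * indicator S x) \<in> borel_measurable borel"
proof -
  note [measurable] = f measurable_times_indicator[OF g] g(2)
  have "(\<lambda>x. f (g x * indicator S x) * indicator S x) \<in> borel_measurable borel" by measurable
  moreover have "(\<lambda>x. f (g x * indicator S x) * indicator S x) = (\<lambda>x. f (g x) * indicator S x)"
    by (auto simp: fun_eq_iff indicator_def)
  ultimately show ?thesis by simp
qed

text \<open>Continuity of the derivative is available on the open interval only, so the substitution
  is made on \<open>[e n, 1 - e n]\<close>, and both sides converge monotonically. The intervals
  \<open>S n\<close> may miss endpoints of the range, which are null.\<close>

lemma nn_integral_substitution_increasing:
  fixes f :: "real \<Rightarrow> ennreal" and g g' :: "real \<Rightarrow> real"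
  assumes f[measurable]: "f \<in> borel_measurable borel"
    and g: "continuous_on {0..1} g" and deriv: "\<And>x. 0 < x \<Longrightarrow> x < 1 \<Longrightarrow> (g has_real_derivative g' x) (at x)"
    and g': "continuous_on {0<..<1} g'" "\<And>x. 0 < x \<Longrightarrow> x < 1 \<Longrightarrow> 0 \<le> g' x"
  shows "(\<integral>\<^sup>+x. f x * indicator {g 0..g 1} x \<partial>lborel) = (\<integral>\<^sup>+x. f (g x) * ennreal (g' x) * indicator {0<..<1} x \<partial>lborel)"
proof -
  \<comment> \<open>The summand 3 makes the interval nondegenerate already for
    \<open>n = 0\<close>.\<close>
  define e where "e n = 1 / (real n + 3)" for n
  have e: "0 < e n" "e n < 1 - e n" "e n < 1" for n by (auto simp: e_def field_simps)
  have e_dec: "e n \<le> e m" if "m \<le> n" for m n using that by (auto simp: e_def field_simps)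
  have e0: "e \<longlonglongrightarrow> 0" unfolding e_def by real_asymp
  have gmono: "g x \<le> g y" if "0 < x" "x \<le> y" "y < 1" for x y
  proof (rule DERIV_nonneg_imp_increasing_open[OF that(2)])
    show "continuous_on {x..y} g" by (rule continuous_on_subset[OF g]) (use that in auto)
    show "\<exists>z. (g has_real_derivative z) (at t) \<and> 0 \<le> z" if "x < t" "t < y" for t
      using deriv[of t] g'(2)[of t] that \<open>0 < x\<close> \<open>y < 1\<close> by (intro exI[of _ "g' t"]) auto
  qed
  define S where "S n = {g (e n)..g (1 - e n)}" for n
  define T where "T n = {e n..1 - e n}" for n
  have incS: "incseq S" unfolding S_def
  proof (intro incseq_SucI subsetI)
    fix n x assume "x \<in> {g (e n)..g (1 - e n)}"
    then show "x \<in> {g (e (Suc n))..g (1 - e (Suc n))}"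
      using gmono[of "e (Suc n)" "e n"] gmono[of "1 - e n" "1 - e (Suc n)"] e[of n] e[of "Suc n"] e_dec[of n "Suc n"]
      by auto
  qed
  have incT: "incseq T" unfolding T_def
  proof (intro incseq_SucI)
    fix n
    show "{e n..1 - e n} \<subseteq> {e (Suc n)..1 - e (Suc n)}" using e_dec[of n "Suc n"] by auto
  qed
  have eq: "(\<integral>\<^sup>+x. f x * indicator (S n) x \<partial>lborel) = (\<integral>\<^sup>+x. f (g x) * ennreal (g' x) * indicator (T n) x \<partial>lborel)" for n
    unfolding S_def T_def
  proof (rule nn_integral_substitution_aux)
    show "continuous_on {e n..1 - e n} g'" by (rule continuous_on_subset[OF g'(1)]) (use e[of n] in auto)
  qed (use e[of n] deriv g' in auto)
  have lim1: "(\<lambda>n. \<integral>\<^sup>+x. f x * indicator (S n) x \<partial>lborel) \<longlonglongrightarrow> (\<integral>\<^sup>+x. f x * indicator (\<Union>n. S n) x \<partial>lborel)"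
  proof (rule nn_integral_LIMSEQ)
    show "incseq (\<lambda>n x. f x * indicator (S n) x)"
      using incS by (auto simp: incseq_def le_fun_def intro!: mult_left_mono split: split_indicator)
    show "(\<lambda>x. f x * indicator (S n) x) \<in> borel_measurable lborel" for n unfolding S_def by measurable
    show "(\<lambda>n. f x * indicator (S n) x) \<longlonglongrightarrow> f x * indicator (\<Union>n. S n) x" for x
    proof (cases "x \<in> (\<Union>n. S n)")
      case True
      then obtain m where "x \<in> S m" by blast
      then have "x \<in> S n" if "n \<ge> m" for n using incS that by (auto simp: incseq_def)
      then have "\<forall>\<^sub>F n in sequentially. x \<in> S n" by (auto simp: eventually_sequentially)
      then show ?thesis using True by (intro tendsto_eventually) (auto elim!: eventually_mono)
    qed simp
  qed
  have Tm: "(\<lambda>x. f (g x) * ennreal (g' x) * indicator B x) \<in> borel_measurable borel"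
    if "B \<subseteq> {0<..<1}" "B \<in> sets borel" for B
  proof -
    note [measurable] = that(2) measurable_comp_indicator[OF f continuous_on_subset[OF g, of "{0<..<1}"]]
      measurable_times_indicator[OF g'(1)]
    have "(\<lambda>x. (f (g x) * indicator {0<..<1} x) * ennreal (g' x * indicator {0<..<1} x) * indicator B x) \<in> borel_measurable borel"
      by (measurable; auto)
    moreover have "(\<lambda>x. (f (g x) * indicator {0<..<1} x) * ennreal (g' x * indicator {0<..<1} x) * indicator B x)
      = (\<lambda>x. f (g x) * ennreal (g' x) * indicator B x)"
      using that(1) by (auto simp: fun_eq_iff indicator_def)
    ultimately show ?thesis by simp
  qed
  have Tsub: "T n \<subseteq> {0<..<1}" for n using e[of n] by (auto simp: T_def)
  have TU: "(\<Union>n. T n) = {0<..<1}"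
  proof
    show "{0<..<1} \<subseteq> (\<Union>n. T n)"
    proof
      fix x :: real assume x: "x \<in> {0<..<1}"
      have "\<forall>\<^sub>F n in sequentially. e n < min x (1 - x)" using e0 x by (intro order_tendstoD) auto
      then obtain n where "e n < min x (1 - x)" by (auto simp: eventually_sequentially)
      then show "x \<in> (\<Union>n. T n)" by (auto simp: T_def intro!: exI[of _ n])
    qed
  qed (use Tsub in blast)
  have lim2: "(\<lambda>n. \<integral>\<^sup>+x. f (g x) * ennreal (g' x) * indicator (T n) x \<partial>lborel)
     \<longlonglongrightarrow> (\<integral>\<^sup>+x. f (g x) * ennreal (g' x) * indicator {0<..<1} x \<partial>lborel)"
  proof (rule nn_integral_LIMSEQ)
    show "incseq (\<lambda>n x. f (g x) * ennreal (g' x) * indicator (T n) x)"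
      using incT by (auto simp: incseq_def le_fun_def intro!: mult_left_mono split: split_indicator)
    show "(\<lambda>x. f (g x) * ennreal (g' x) * indicator (T n) x) \<in> borel_measurable lborel" for n
      using Tm[OF Tsub] by (simp add: T_def)
    show "(\<lambda>n. f (g x) * ennreal (g' x) * indicator (T n) x) \<longlonglongrightarrow> f (g x) * ennreal (g' x) * indicator {0<..<1} x" for x
    proof (cases "x \<in> (\<Union>n. T n)")
      case True
      then obtain m where "x \<in> T m" by blast
      then have "x \<in> T n" if "n \<ge> m" for n using incT that by (auto simp: incseq_def)
      then have "\<forall>\<^sub>F n in sequentially. x \<in> T n" by (auto simp: eventually_sequentially)
      then show ?thesis using True TU by (intro tendsto_eventually) (auto elim!: eventually_mono)
    next
      case False
      then have "indicator (T n) x = (0::ennreal)" for n by simp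
      moreover have "indicator {0<..<1} x = (0::ennreal)" using False TU by simp
      ultimately show ?thesis by simp
    qed
  qed
  have g0: "(\<lambda>n. g (e n)) \<longlonglongrightarrow> g 0" "(\<lambda>n. g (1 - e n)) \<longlonglongrightarrow> g 1"
  proof -
    show "(\<lambda>n. g (e n)) \<longlonglongrightarrow> g 0"
      using continuous_on_tendsto_compose[OF g e0] e by (simp add: less_imp_le)
    have "(\<lambda>n. 1 - e n) \<longlonglongrightarrow> 1" using tendsto_diff[OF tendsto_const e0, of 1] by simp
    then show "(\<lambda>n. g (1 - e n)) \<longlonglongrightarrow> g 1"
      by (rule continuous_on_tendsto_compose[OF g]) (use e in \<open>auto simp: less_imp_le\<close>)
  qed
  have incl1: "(\<Union>n. S n) \<subseteq> {g 0..g 1}"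
  proof
    fix x assume "x \<in> (\<Union>n. S n)"
    then obtain n where x: "g (e n) \<le> x" "x \<le> g (1 - e n)" by (auto simp: S_def)
    have "g 0 \<le> g (e n)"
      by (rule LIMSEQ_le_const2[OF g0(1)]) (use gmono e e_dec in \<open>auto intro!: exI[of _ n]\<close>)
    moreover have "g (1 - e n) \<le> g 1"
      by (rule LIMSEQ_le_const[OF g0(2)]) (use gmono e e_dec in \<open>auto intro!: exI[of _ n]\<close>)
    ultimately show "x \<in> {g 0..g 1}" using x by auto
  qed
  have incl2: "{g 0<..<g 1} \<subseteq> (\<Union>n. S n)"
  proof
    fix x assume x: "x \<in> {g 0<..<g 1}"
    have "\<forall>\<^sub>F n in sequentially. g (e n) < x \<and> x < g (1 - e n)"
      using x g0 by (intro eventually_conj order_tendstoD) auto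
    then obtain n where "g (e n) < x \<and> x < g (1 - e n)" by (auto simp: eventually_sequentially)
    then show "x \<in> (\<Union>n. S n)" by (auto simp: S_def intro!: exI[of _ n])
  qed
  have SU: "x \<in> (\<Union>n. S n) \<longleftrightarrow> x \<in> {g 0..g 1}" if "x \<noteq> g 0" "x \<noteq> g 1" for x
  proof
    show "x \<in> {g 0..g 1}" if "x \<in> (\<Union>n. S n)" using incl1 that by (rule subsetD)
    assume "x \<in> {g 0..g 1}"
    then have "x \<in> {g 0<..<g 1}" using that by simp
    with incl2 show "x \<in> (\<Union>n. S n)" by (rule subsetD)
  qed
  have "(\<integral>\<^sup>+x. f x * indicator (\<Union>n. S n) x \<partial>lborel) = (\<integral>\<^sup>+x. f x * indicator {g 0..g 1} x \<partial>lborel)"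
  proof (rule nn_integral_cong_AE)
    show "AE x in lborel. f x * indicator (\<Union>n. S n) x = f x * indicator {g 0..g 1} x"
      using AE_lborel_singleton[of "g 0"] AE_lborel_singleton[of "g 1"]
    proof eventually_elim
      case (elim x)
      show ?case unfolding indicator_def SU[OF elim] by (rule refl)
    qed
  qed
  then show ?thesis using LIMSEQ_unique[OF lim1] lim2 eq by simp
qed

text \<open>Reduced to the increasing case by reflecting the domain, which preserves Lebesgue
  measure.\<close>

lemma nn_integral_substitution_decreasing:
  fixes f :: "real \<Rightarrow> ennreal" and g g' :: "real \<Rightarrow> real"
  assumes f[measurable]: "f \<in> borel_measurable borel"
    and g: "continuous_on {0..1} g" and deriv: "\<And>x. 0 < x \<Longrightarrow> x < 1 \<Longrightarrow> (g has_real_derivative - g' x) (at x)"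
    and g': "continuous_on {0<..<1} g'" "\<And>x. 0 < x \<Longrightarrow> x < 1 \<Longrightarrow> 0 \<le> g' x"
  shows "(\<integral>\<^sup>+x. f x * indicator {g 1..g 0} x \<partial>lborel) = (\<integral>\<^sup>+x. f (g x) * ennreal (g' x) * indicator {0<..<1} x \<partial>lborel)"
proof -
  have "(\<integral>\<^sup>+x. f x * indicator {g (1 - 0)..g (1 - 1)} x \<partial>lborel) =
      (\<integral>\<^sup>+x. f (g (1 - x)) * ennreal (g' (1 - x)) * indicator {0<..<1} x \<partial>lborel)"
  proof (rule nn_integral_substitution_increasing[OF f])
    show "continuous_on {0..1} (\<lambda>x. g (1 - x))"
      by (rule continuous_on_compose2[OF g]) (auto intro!: continuous_intros)
    show "continuous_on {0<..<1} (\<lambda>x. g' (1 - x))"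
      by (rule continuous_on_compose2[OF g'(1)]) (auto intro!: continuous_intros)
    show "((\<lambda>x. g (1 - x)) has_real_derivative g' (1 - x)) (at x)" if "0 < x" "x < 1" for x
    proof -
      have "((\<lambda>x. 1 - x) has_real_derivative - 1) (at x)" by (auto intro!: derivative_eq_intros)
      moreover have "(g has_real_derivative - g' (1 - x)) (at (1 - x))" using deriv[of "1 - x"] that by simp
      ultimately show ?thesis using DERIV_chain2[of g "- g' (1 - x)" "\<lambda>x. 1 - x" x "- 1" UNIV] by simp
    qed
  qed (use g' in auto)
  also have "\<dots> = (\<integral>\<^sup>+x. f (g x) * ennreal (g' x) * indicator {0<..<1} x \<partial>lborel)"
  proof -
    note [measurable] = measurable_comp_indicator[OF f continuous_on_subset[OF g, of "{0<..<1}"]]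
      measurable_times_indicator[OF g'(1)]
    have "(\<lambda>x. (f (g x) * indicator {0<..<1} x) * ennreal (g' x * indicator {0<..<1} x)) \<in> borel_measurable borel"
      by (measurable; auto)
    moreover have "(\<lambda>x. (f (g x) * indicator {0<..<1} x) * ennreal (g' x * indicator {0<..<1} x))
      = (\<lambda>x. f (g x) * ennreal (g' x) * indicator {0<..<1} x)"
      by (auto simp: fun_eq_iff indicator_def)
    ultimately have m: "(\<lambda>x. f (g x) * ennreal (g' x) * indicator {0<..<1} x) \<in> borel_measurable borel" by simp
    have "indicator {0<..<1} (1 + (- 1) * x) = (indicator {0<..<1} x :: ennreal)" for x :: real
      by (auto simp: indicator_def)
    then show ?thesis using nn_integral_real_affine[OF m, of "- 1" 1] by simp
  qed
  finally show ?thesis by simp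
qed

section \<open>Transfer operator of the map and its open version\<close>

context parabolic_branches begin

text \<open>Nonnegative extended functions are used because the tower density, to which this is
  applied, need not be integrable. The point 0 is left out since the derivative products are not
  controlled there.\<close>

lemma transfer_nn_integral:
  fixes G :: "real \<Rightarrow> ennreal"
  assumes m: "(\<lambda>x. G x * indicator {0<..1} x) \<in> borel_measurable borel"
  shows "(\<integral>\<^sup>+x. G x * indicator {0<..1} x \<partial>lborel) =
    (\<integral>\<^sup>+y. (G (\<phi>0 y) * ennreal (d0 y) + G (\<phi>1 y) * ennreal (d1 y)) * indicator {0<..<1} y \<partial>lborel)"
proof -
  define G' where "G' = (\<lambda>x. G x * indicator {0<..1} x)"
  have [measurable]: "G' \<in> borel_measurable borel" using m by (simp add: G'_def)
  have d0c: "continuous_on {0<..<1} d0" by (rule continuous_on_subset[OF d0_cont]) auto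
  have d1c: "continuous_on {0<..<1} d1" by (rule continuous_on_subset[OF d1_cont]) auto
  have meas: "(\<lambda>y. G' (g y) * ennreal (g' y) * indicator {0<..<1} y) \<in> borel_measurable borel"
    if "continuous_on {0..1} g" "continuous_on {0<..<1} g'" for g g' :: "real \<Rightarrow> real"
  proof -
    note [measurable] = measurable_comp_indicator[OF _ continuous_on_subset[OF that(1), of "{0<..<1}"], of G']
      measurable_times_indicator[OF that(2)]
    have "(\<lambda>x. (G' (g x) * indicator {0<..<1} x) * ennreal (g' x * indicator {0<..<1} x)) \<in> borel_measurable borel"
      by (measurable; auto)
    moreover have "(\<lambda>x. (G' (g x) * indicator {0<..<1} x) * ennreal (g' x * indicator {0<..<1} x))
      = (\<lambda>x. G' (g x) * ennreal (g' x) * indicator {0<..<1} x)"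
      by (auto simp: fun_eq_iff indicator_def)
    ultimately show ?thesis by simp
  qed
  have 0: "(\<integral>\<^sup>+x. G' x * indicator {0..a} x \<partial>lborel) = (\<integral>\<^sup>+y. G' (\<phi>0 y) * ennreal (d0 y) * indicator {0<..<1} y \<partial>lborel)"
    using nn_integral_substitution_increasing[OF _ phi0_cont phi0_deriv d0c, of G'] d0_pos phi0_0 phi0_1
    by (auto intro: less_imp_le)
  have 1: "(\<integral>\<^sup>+x. G' x * indicator {a..1} x \<partial>lborel) = (\<integral>\<^sup>+y. G' (\<phi>1 y) * ennreal (d1 y) * indicator {0<..<1} y \<partial>lborel)"
    using phi1_ends
  proof (elim disjE conjE)
    assume s: "\<sigma> = 1" "\<phi>1 0 = a" "\<phi>1 1 = 1"
    then show ?thesis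
      using nn_integral_substitution_increasing[OF _ phi1_cont _ d1c, of G'] phi1_deriv d1_pos
      by (auto intro: less_imp_le)
  next
    assume s: "\<sigma> = - 1" "\<phi>1 0 = 1" "\<phi>1 1 = a"
    then show ?thesis
      using nn_integral_substitution_decreasing[OF _ phi1_cont _ d1c, of G'] phi1_deriv d1_pos
      by (auto intro: less_imp_le)
  qed
  have "(\<integral>\<^sup>+x. G x * indicator {0<..1} x \<partial>lborel) = (\<integral>\<^sup>+x. G' x * indicator {0..a} x + G' x * indicator {a..1} x \<partial>lborel)"
    using AE_lborel_singleton[of a] a01
    by (intro nn_integral_cong_AE) (auto elim!: eventually_mono simp: G'_def split: split_indicator)
  also have "\<dots> = (\<integral>\<^sup>+x. G' x * indicator {0..a} x \<partial>lborel) + (\<integral>\<^sup>+x. G' x * indicator {a..1} x \<partial>lborel)"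
    by (intro nn_integral_add) measurable
  also have "\<dots> = (\<integral>\<^sup>+y. G' (\<phi>0 y) * ennreal (d0 y) * indicator {0<..<1} y + G' (\<phi>1 y) * ennreal (d1 y) * indicator {0<..<1} y \<partial>lborel)"
    unfolding 0 1 by (intro nn_integral_add[symmetric]) (use meas phi0_cont phi1_cont d0c d1c in auto)
  also have "\<dots> = (\<integral>\<^sup>+y. (G (\<phi>0 y) * ennreal (d0 y) + G (\<phi>1 y) * ennreal (d1 y)) * indicator {0<..<1} y \<partial>lborel)"
  proof (intro nn_integral_cong)
    fix y
    show "G' (\<phi>0 y) * ennreal (d0 y) * indicator {0<..<1} y + G' (\<phi>1 y) * ennreal (d1 y) * indicator {0<..<1} y
      = (G (\<phi>0 y) * ennreal (d0 y) + G (\<phi>1 y) * ennreal (d1 y)) * indicator {0<..<1} y"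
    proof (cases "y \<in> {0<..<1}")
      case True
      then have "\<phi>0 y \<in> {0<..1}" "\<phi>1 y \<in> {0<..1}"
        using phi0_pos[of y] phi0_unit[of y] phi1_range[of y] a01 by auto
      then show ?thesis using True by (simp add: G'_def)
    qed simp
  qed
  finally show ?thesis .
qed

text \<open>
  Summing \<open>u\<close> along the tower turns the induced operator into the open transfer operator of \<open>F\<close>:
  by \<open>resolvent_step\<close>, the latter maps \<open>resolvent N \<gamma> u\<close> to \<open>exp (- \<gamma>)\<close> times itself plus a
  multiple of \<open>L\<^sub>\<gamma> u - u\<close>.
\<close>

definition resolvent :: "nat \<Rightarrow> real \<Rightarrow> (real \<Rightarrow> real) \<Rightarrow> real \<Rightarrow> real" where
  "resolvent N \<gamma> u x =
     (\<Sum>j<N. exp (\<gamma> * real j) * (if A N < (\<phi>0 ^^ j) x then 1 else 0) * D j x * u ((\<phi>0 ^^ j) x))"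

definition letter_weight :: "nat \<Rightarrow> real \<Rightarrow> nat \<Rightarrow> real" where
  "letter_weight N \<gamma> j = (if j < N then exp (\<gamma> * real (Suc j)) else 0)"

lemma letter_weight_Bseq: "Bseq (letter_weight N \<gamma>)"
proof (rule BseqI')
  fix j
  have "letter_weight N \<gamma> j \<le> (\<Sum>i<N. exp (\<gamma> * real (Suc i)))"
    by (auto simp: letter_weight_def intro!: sum_nonneg member_le_sum)
  then show "norm (letter_weight N \<gamma> j) \<le> (\<Sum>i<N. exp (\<gamma> * real (Suc i)))"
    by (simp add: letter_weight_def)
qed

lemma wtransfer_letter_weight:
  "wtransfer (letter_weight N \<gamma>) u x = (\<Sum>j<N. exp (\<gamma> * real (Suc j)) * (\<l> j x * u (\<Psi> j x)))"
  unfolding wtransfer_def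
  by (subst suminf_finite[of "{..<N}"]) (auto simp: letter_weight_def)

lemma iter_le: "0 < x \<Longrightarrow> x \<le> 1 \<Longrightarrow> (\<phi>0 ^^ j) x \<le> x"
proof (induction j)
  case (Suc j)
  then have "0 < (\<phi>0 ^^ j) x \<and> (\<phi>0 ^^ j) x \<le> 1" using iter_pos by blast
  then have "\<phi>0 ((\<phi>0 ^^ j) x) < (\<phi>0 ^^ j) x" using phi0_less by blast
  then show ?case using Suc by simp
qed simp

lemma A_mono: "m \<le> n \<Longrightarrow> A n \<le> A m"
  using A_decseq by (rule decseqD)

lemma resolvent_below:
  assumes "0 < x" "x \<le> A N" shows "resolvent N \<gamma> u x = 0"
proof -
  have "\<not> A N < (\<phi>0 ^^ j) x" for j using iter_le[of x j] assms A_le_1[of N] by auto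
  then show ?thesis by (simp add: resolvent_def)
qed

lemma resolvent_step:
  assumes N: "1 \<le> N" and y: "A N < y" "y < 1"
  shows "d0 y * resolvent N \<gamma> u (\<phi>0 y) + d1 y * resolvent N \<gamma> u (\<phi>1 y) =
    exp (- \<gamma>) * (resolvent N \<gamma> u y - u y + wtransfer (letter_weight N \<gamma>) u y)"
proof -
  have y0: "0 < y" using y A_pos[of N] by linarith
  define f where "f j = exp (\<gamma> * real j) * (if A N < (\<phi>0 ^^ j) y then 1 else 0) * D j y * u ((\<phi>0 ^^ j) y)" for j
  have f0: "f 0 = u y" using y by (simp add: f_def chain_deriv_def)
  have "(\<phi>0 ^^ N) y \<le> A N" using iter_mono[of y 1 N] y y0 by simp
  \<comment> \<open>After \<open>N\<close> backward steps every point lies in the hole, so the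
    shifted sum closes up without a boundary term at \<open>j = N\<close>.\<close>
  then have fN: "f N = 0" by (simp add: f_def)
  have e: "exp (\<gamma> * real j) = exp (- \<gamma>) * exp (\<gamma> * real (Suc j))" for j
    by (simp add: algebra_simps flip: exp_add)
  have "d0 y * resolvent N \<gamma> u (\<phi>0 y) = exp (- \<gamma>) * (\<Sum>j<N. f (Suc j))"
    unfolding resolvent_def sum_distrib_left
  proof (rule sum.cong[OF refl])
    fix j
    have sw: "(\<phi>0 ^^ j) (\<phi>0 y) = (\<phi>0 ^^ Suc j) y" by (simp add: funpow_swap1)
    show "d0 y * (exp (\<gamma> * real j) * (if A N < (\<phi>0 ^^ j) (\<phi>0 y) then 1 else 0) * D j (\<phi>0 y) * u ((\<phi>0 ^^ j) (\<phi>0 y)))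
      = exp (- \<gamma>) * f (Suc j)"
      unfolding f_def sw D_Suc e[of j] by (simp only: mult_ac)
  qed
  also have "(\<Sum>j<N. f (Suc j)) = (\<Sum>j<N. f j) - u y"
    using sum.lessThan_Suc_shift[of f N] sum.lessThan_Suc[of f N] f0 fN by simp
  also have "(\<Sum>j<N. f j) = resolvent N \<gamma> u y" by (simp add: resolvent_def f_def)
  finally have 1: "d0 y * resolvent N \<gamma> u (\<phi>0 y) = exp (- \<gamma>) * (resolvent N \<gamma> u y - u y)" .
  have 2: "d1 y * resolvent N \<gamma> u (\<phi>1 y) = exp (- \<gamma>) * wtransfer (letter_weight N \<gamma>) u y"
    unfolding resolvent_def wtransfer_letter_weight sum_distrib_left
  proof (rule sum.cong[OF refl])
    fix j assume "j \<in> {..<N}"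
    \<comment> \<open>On the second branch the hole condition holds for every \<open>j < N\<close>,
      which is why \<open>letter_weight\<close> may be cut off exactly at \<open>N\<close>.\<close>
    then have "A N \<le> A (Suc j)" by (intro A_mono) simp
    also have "\<dots> < (\<phi>0 ^^ j) (\<phi>1 y)" using Psi_range_open[of y j] y y0 by (simp add: ret_branch_def)
    finally have c: "A N < (\<phi>0 ^^ j) (\<phi>1 y)" .
    show "d1 y * (exp (\<gamma> * real j) * (if A N < (\<phi>0 ^^ j) (\<phi>1 y) then 1 else 0) * D j (\<phi>1 y) * u ((\<phi>0 ^^ j) (\<phi>1 y))) =
      exp (- \<gamma>) * (exp (\<gamma> * real (Suc j)) * (\<l> j y * u (\<Psi> j y)))"
      unfolding if_P[OF c] e[of j] ret_deriv_def ret_branch_def by (simp only: mult_ac mult_1)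
  qed
  show ?thesis unfolding 1 2 by (simp add: algebra_simps)
qed

lemma resolvent_nonneg:
  assumes "\<And>x. x \<in> {0..1} \<Longrightarrow> 0 \<le> u x" "0 < x" "x \<le> 1"
  shows "0 \<le> resolvent N \<gamma> u x"
  unfolding resolvent_def
  using assms D_pos[OF assms(2,3)] iter_unit[of x] by (intro sum_nonneg mult_nonneg_nonneg) (auto intro: less_imp_le)

lemma resolvent_ge:
  assumes "1 \<le> N" "\<And>x. x \<in> {0..1} \<Longrightarrow> 0 \<le> u x" "A N < x" "x \<le> 1"
  shows "u x \<le> resolvent N \<gamma> u x"
proof -
  have x0: "0 < x" using assms A_pos[of N] by linarith
  let ?f = "\<lambda>j. exp (\<gamma> * real j) * (if A N < (\<phi>0 ^^ j) x then 1 else 0) * D j x * u ((\<phi>0 ^^ j) x)"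
  have "(\<Sum>j\<in>{0}. ?f j) \<le> (\<Sum>j<N. ?f j)"
    using assms D_pos[OF x0 assms(4)] iter_unit[of x] x0
    by (intro sum_mono2 mult_nonneg_nonneg) (auto intro: less_imp_le)
  then show ?thesis using assms(3) by (simp add: resolvent_def chain_deriv_def)
qed

text \<open>The bound depends on \<open>N\<close>: it rests on compactness of
  \<open>[A N, 1]\<close>, where the products \<open>D j\<close> are continuous.\<close>

lemma resolvent_bound:
  assumes u: "continuous_on {0..1} u"
  obtains M where "0 < M" "\<And>x. A N < x \<Longrightarrow> x \<le> 1 \<Longrightarrow> resolvent N \<gamma> u x \<le> M"
proof -
  obtain B where B: "0 < B" "\<And>x. x \<in> {0..1} \<Longrightarrow> \<bar>u x\<bar> \<le> B" using cont_bound[OF u] by blast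
  have "\<exists>E. \<forall>x\<in>{A N..1}. \<bar>D j x\<bar> \<le> E" for j
  proof -
    have "continuous_on {A N..1} (D j)" by (rule continuous_on_subset[OF D_cont]) (use A_pos[of N] in auto)
    then have "bounded (D j ` {A N..1})" by (intro compact_imp_bounded compact_continuous_image) auto
    then show ?thesis unfolding bounded_iff by auto
  qed
  then obtain E where E: "\<And>j x. x \<in> {A N..1} \<Longrightarrow> \<bar>D j x\<bar> \<le> E j" by metis
  have "resolvent N \<gamma> u x \<le> (\<Sum>j<N. exp (\<gamma> * real j) * \<bar>E j\<bar> * B)" if x: "A N < x" "x \<le> 1" for x
    unfolding resolvent_def
  proof (rule sum_mono)
    fix j
    have x0: "0 < x" using x A_pos[of N] by linarith
    have "D j x * u ((\<phi>0 ^^ j) x) \<le> \<bar>D j x\<bar> * \<bar>u ((\<phi>0 ^^ j) x)\<bar>" by (simp flip: abs_mult)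
    also have "\<dots> \<le> \<bar>E j\<bar> * B" using E[of x j] B(2)[OF iter_unit, of x j] x x0 by (intro mult_mono) auto
    finally have "exp (\<gamma> * real j) * (D j x * u ((\<phi>0 ^^ j) x)) \<le> exp (\<gamma> * real j) * (\<bar>E j\<bar> * B)"
      by (intro mult_left_mono) auto
    moreover have "0 \<le> \<bar>E j\<bar> * B" using B(1) by simp
    ultimately show "exp (\<gamma> * real j) * (if A N < (\<phi>0 ^^ j) x then 1 else 0) * D j x * u ((\<phi>0 ^^ j) x)
      \<le> exp (\<gamma> * real j) * \<bar>E j\<bar> * B" by (cases "A N < (\<phi>0 ^^ j) x") (simp_all add: mult.assoc)
  qed
  moreover have "0 \<le> (\<Sum>j<N. exp (\<gamma> * real j) * \<bar>E j\<bar> * B)" using B by (intro sum_nonneg) simp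
  ultimately show ?thesis by (intro that[of "(\<Sum>j<N. exp (\<gamma> * real j) * \<bar>E j\<bar> * B) + 1"]) force+
qed

lemma iter_term_measurable:
  assumes u: "continuous_on {0..1} (u :: real \<Rightarrow> real)"
  shows "(\<lambda>x. D j x * u ((\<phi>0 ^^ j) x) * indicator {0<..1} x) \<in> borel_measurable borel"
proof (rule measurable_times_indicator)
  show "continuous_on {0<..1} (\<lambda>x. D j x * u ((\<phi>0 ^^ j) x))"
    by (intro continuous_on_mult D_cont continuous_on_compose2[OF u continuous_on_subset[OF phi0_iter_cont]])
       (use iter_unit in \<open>force simp: less_imp_le\<close>)+
qed simp

lemma resolvent_measurable:
  assumes u: "continuous_on {0..1} u"
  shows "(\<lambda>x. resolvent N \<gamma> u x * indicator {0<..1} x) \<in> borel_measurable borel"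
proof -
  have ic: "continuous_on {0<..1} (\<phi>0 ^^ j)" for j by (rule continuous_on_subset[OF phi0_iter_cont]) auto
  note [measurable] = iter_term_measurable[OF u] measurable_times_indicator[OF ic]
  have "(\<lambda>x. \<Sum>j<N. exp (\<gamma> * real j) * (if A N < (\<phi>0 ^^ j) x * indicator {0<..1} x then 1 else 0) *
      (D j x * u ((\<phi>0 ^^ j) x) * indicator {0<..1} x)) \<in> borel_measurable borel"
    by measurable
  moreover have "(\<lambda>x. \<Sum>j<N. exp (\<gamma> * real j) * (if A N < (\<phi>0 ^^ j) x * indicator {0<..1} x then 1 else 0) *
      (D j x * u ((\<phi>0 ^^ j) x) * indicator {0<..1} x)) = (\<lambda>x. resolvent N \<gamma> u x * indicator {0<..1} x)"
    by (auto simp: resolvent_def fun_eq_iff indicator_def mult.assoc)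
  ultimately show ?thesis by simp
qed

end

section \<open>Lebesgue measure on the unit interval; escape rates from exponential bounds\<close>

lemma sets_unit_lebesgue: "B \<in> sets unit_lebesgue \<longleftrightarrow> B \<subseteq> {0..1} \<and> B \<in> sets borel"
  unfolding unit_lebesgue_def by (subst sets_restrict_space_iff) auto

lemma space_unit_lebesgue [simp]: "space unit_lebesgue = {0..1}"
  by (simp add: unit_lebesgue_def space_restrict_space)

lemma nn_integral_unit_lebesgue:
  "(\<integral>\<^sup>+x. f x \<partial>unit_lebesgue) = (\<integral>\<^sup>+x. f x * indicator {0..1} x \<partial>lborel)"
  unfolding unit_lebesgue_def by (rule nn_integral_restrict_space) simp

lemma emeasure_unit_lebesgue: "B \<subseteq> {0..1} \<Longrightarrow> emeasure unit_lebesgue B = emeasure lborel B"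
  unfolding unit_lebesgue_def by (intro emeasure_restrict_space) auto

lemma ext_ln_le: "x \<le> ennreal y \<Longrightarrow> 0 < y \<Longrightarrow> ext_ln x \<le> ereal (ln y)"
  by (cases x) (auto simp: ext_ln_def top_unique)

lemma ext_ln_ge: "ennreal y \<le> x \<Longrightarrow> 0 < y \<Longrightarrow> ereal (ln y) \<le> ext_ln x"
  by (cases x) (auto simp: ext_ln_def top_unique)

text \<open>The prefactor \<open>c\<close> and the shift between \<open>Suc t\<close> and
  \<open>t\<close> change the quotient by terms of order \<open>1 / n\<close> only, so they
  disappear in the limit.\<close>

lemma escape_rate_ge:
  assumes c: "0 < c" and le: "\<And>t. emeasure \<mu> {x \<in> {0..1}. \<forall>j<Suc t. (F ^^ j) x \<notin> H} \<le> ennreal (c * exp (- \<gamma> * real t))"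
  shows "ereal \<gamma> \<le> escape_rate \<mu> F H"
proof -
  let ?S = "\<lambda>n. {x \<in> {0..1}. \<forall>j<n. (F ^^ j) x \<notin> H}"
  let ?e = "\<lambda>n. ereal (\<gamma> * (real n - 1) / real n - ln c / real n)"
  have "?e \<longlonglongrightarrow> ereal \<gamma>" by (rule tendsto_ereal) real_asymp
  then have "ereal \<gamma> = limsup ?e" by (intro lim_imp_Limsup[symmetric]) auto
  also have "\<dots> \<le> escape_rate \<mu> F H"
    unfolding escape_rate_def
  proof (rule Limsup_mono)
    show "\<forall>\<^sub>F n in sequentially. ?e n \<le> - (ext_ln (emeasure \<mu> (?S n)) / ereal (real n))"
      using eventually_gt_at_top[of 0]
    proof eventually_elim
      case (elim n)
      then obtain t where t: "n = Suc t" by (cases n) auto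
      have "ext_ln (emeasure \<mu> (?S n)) \<le> ereal (ln (c * exp (- \<gamma> * real t)))"
        unfolding t using le[of t] c by (intro ext_ln_le) auto
      also have "ln (c * exp (- \<gamma> * real t)) = ln c - \<gamma> * (real n - 1)" using c t by (simp add: ln_mult)
      finally have "ext_ln (emeasure \<mu> (?S n)) / ereal (real n) \<le> ereal (ln c - \<gamma> * (real n - 1)) / ereal (real n)"
        using elim by (intro ereal_divide_right_mono) auto
      then have "- (ereal (ln c - \<gamma> * (real n - 1)) / ereal (real n)) \<le> - (ext_ln (emeasure \<mu> (?S n)) / ereal (real n))"
        unfolding ereal_minus_le_minus .
      moreover have "- (ereal (ln c - \<gamma> * (real n - 1)) / ereal (real n)) = ?e n"
        using elim by (simp add: diff_divide_distrib)
      ultimately show ?case by (simp only:)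
    qed
  qed
  finally show ?thesis .
qed

lemma escape_rate_le:
  assumes c: "0 < c" and le: "\<And>t. ennreal (c * exp (- \<gamma> * real t)) \<le> emeasure \<mu> {x \<in> {0..1}. \<forall>j<Suc t. (F ^^ j) x \<notin> H}"
  shows "escape_rate \<mu> F H \<le> ereal \<gamma>"
proof -
  let ?S = "\<lambda>n. {x \<in> {0..1}. \<forall>j<n. (F ^^ j) x \<notin> H}"
  let ?e = "\<lambda>n. ereal (\<gamma> * (real n - 1) / real n - ln c / real n)"
  have "?e \<longlonglongrightarrow> ereal \<gamma>" by (rule tendsto_ereal) real_asymp
  then have "limsup ?e = ereal \<gamma>" by (intro lim_imp_Limsup) auto
  moreover have "escape_rate \<mu> F H \<le> limsup ?e"
    unfolding escape_rate_def
  proof (rule Limsup_mono)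
    show "\<forall>\<^sub>F n in sequentially. - (ext_ln (emeasure \<mu> (?S n)) / ereal (real n)) \<le> ?e n"
      using eventually_gt_at_top[of 0]
    proof eventually_elim
      case (elim n)
      then obtain t where t: "n = Suc t" by (cases n) auto
      have "ereal (ln (c * exp (- \<gamma> * real t))) \<le> ext_ln (emeasure \<mu> (?S n))"
        unfolding t using le[of t] c by (intro ext_ln_ge) auto
      moreover have "ln (c * exp (- \<gamma> * real t)) = ln c - \<gamma> * (real n - 1)" using c t by (simp add: ln_mult)
      ultimately have "ereal (ln c - \<gamma> * (real n - 1)) / ereal (real n) \<le> ext_ln (emeasure \<mu> (?S n)) / ereal (real n)"
        using elim by (intro ereal_divide_right_mono) auto
      then have "- (ext_ln (emeasure \<mu> (?S n)) / ereal (real n)) \<le> - (ereal (ln c - \<gamma> * (real n - 1)) / ereal (real n))"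
        unfolding ereal_minus_le_minus .
      moreover have "- (ereal (ln c - \<gamma> * (real n - 1)) / ereal (real n)) = ?e n"
        using elim by (simp add: diff_divide_distrib)
      ultimately show ?case by (simp only:)
    qed
  qed
  ultimately show ?thesis by simp
qed

lemma suminf_ennreal_head: "(\<Sum>i. f i) = f 0 + (\<Sum>i. f (Suc i))" for f :: "nat \<Rightarrow> ennreal"
proof -
  have "(\<lambda>n. f 0 + (\<Sum>i<n. f (Suc i))) \<longlonglongrightarrow> f 0 + (\<Sum>i. f (Suc i))"
    by (intro tendsto_add tendsto_const summable_LIMSEQ summableI)
  moreover have "(\<lambda>n. \<Sum>i<Suc n. f i) \<longlonglongrightarrow> (\<Sum>i. f i)"
    by (intro LIMSEQ_Suc summable_LIMSEQ summableI)
  ultimately show ?thesis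
    unfolding sum.lessThan_Suc_shift using LIMSEQ_unique by blast
qed

section \<open>Mass of the survivors\<close>

locale parabolic_system = parabolic_branches +
  fixes \<mu> :: "real measure"
  assumes acim: "H5 F \<mu>"
begin

lemma sets_mu: "sets \<mu> = sets unit_lebesgue"
  using acim unfolding H5_def ergodic_conservative_acim_def equivalent_to_lebesgue_def by auto

lemma F_measurable: "F \<in> measurable unit_lebesgue unit_lebesgue"
  using acim sets_mu unfolding H5_def ergodic_conservative_acim_def invariant_measure_def
  by (metis measurable_cong_sets)

lemma F_preimage:
  assumes "B \<in> sets borel" "B \<subseteq> {0..1}" shows "{x \<in> {0..1}. F x \<in> B} \<in> sets borel"
proof -
  have "F -` B \<inter> space unit_lebesgue \<in> sets unit_lebesgue"
    using assms by (intro measurable_sets[OF F_measurable]) (simp add: sets_unit_lebesgue)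
  moreover have "F -` B \<inter> space unit_lebesgue = {x \<in> {0..1}. F x \<in> B}" by auto
  ultimately show ?thesis by (simp add: sets_unit_lebesgue)
qed

definition survivors :: "nat \<Rightarrow> nat \<Rightarrow> real set" where
  "survivors N t = {x \<in> {0..1}. \<forall>j<t. (F ^^ j) x \<notin> {0..A N}}"

lemma survivors_Suc: "survivors N (Suc t) = {x \<in> {0..1}. A N < x \<and> F x \<in> survivors N t}"
  unfolding survivors_def All_less_Suc2 funpow_Suc_right comp_apply funpow_0 using F_mem by fastforce

lemma survivors_borel: "survivors N t \<in> sets borel"
proof (induction t)
  case (Suc t)
  have "survivors N t \<subseteq> {0..1}" by (auto simp: survivors_def)
  then have "{x \<in> {0..1}. F x \<in> survivors N t} \<inter> {A N<..} \<in> sets borel"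
    by (intro sets.Int F_preimage Suc greaterThan_borel)
  moreover have "{x \<in> {0..1}. F x \<in> survivors N t} \<inter> {A N<..} = survivors N (Suc t)"
    unfolding survivors_Suc by auto
  ultimately show ?case by simp
qed (simp add: survivors_def)

lemma survivors_Suc_sub: "survivors N (Suc t) \<subseteq> {A N<..1}"
  unfolding survivors_Suc by auto

text \<open>Localises the transfer identity to points outside the hole with image in
  \<open>B\<close>. The hole condition remains on the first branch only, since
  \<open>\<phi>1\<close> takes values above \<open>a\<close> on the open interval and
  \<open>A N \<le> a\<close>.\<close>

lemma preimage_nn_integral:
  fixes U :: "real \<Rightarrow> real"
  assumes U: "(\<lambda>x. U x * indicator {0<..1} x) \<in> borel_measurable borel"
    and B: "B \<in> sets borel" "B \<subseteq> {0..1}" and N: "1 \<le> N"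
  shows "(\<integral>\<^sup>+x. ennreal (U x) * indicator {x \<in> {0..1}. A N < x \<and> F x \<in> B} x \<partial>lborel) =
    (\<integral>\<^sup>+y. (ennreal (U (\<phi>0 y)) * indicator {A N<..} (\<phi>0 y) * ennreal (d0 y) + ennreal (U (\<phi>1 y)) * ennreal (d1 y))
       * indicator (B \<inter> {0<..<1}) y \<partial>lborel)"
proof -
  let ?G = "\<lambda>x. ennreal (U x) * indicator {x \<in> {0..1}. A N < x \<and> F x \<in> B} x"
  note [measurable] = U F_preimage[OF B]
  have sub: "{x \<in> {0..1}. A N < x \<and> F x \<in> B} = {x \<in> {0..1}. F x \<in> B} \<inter> {A N<..}" by auto
  have "(\<lambda>x. ennreal (U x * indicator {0<..1} x) * indicator ({x \<in> {0..1}. F x \<in> B} \<inter> {A N<..}) x) \<in> borel_measurable borel"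
    by measurable
  moreover have "(\<lambda>x. ennreal (U x * indicator {0<..1} x) * indicator ({x \<in> {0..1}. F x \<in> B} \<inter> {A N<..}) x) = (\<lambda>x. ?G x * indicator {0<..1} x)"
    unfolding sub using A_pos[of N] by (auto simp: fun_eq_iff indicator_def)
  ultimately have m: "(\<lambda>x. ?G x * indicator {0<..1} x) \<in> borel_measurable borel" by simp
  have "(\<integral>\<^sup>+x. ?G x \<partial>lborel) = (\<integral>\<^sup>+x. ?G x * indicator {0<..1} x \<partial>lborel)"
    using A_pos[of N] by (intro nn_integral_cong) (auto simp: indicator_def)
  also have "\<dots> = (\<integral>\<^sup>+y. (?G (\<phi>0 y) * ennreal (d0 y) + ?G (\<phi>1 y) * ennreal (d1 y)) * indicator {0<..<1} y \<partial>lborel)"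
    by (rule transfer_nn_integral[OF m])
  also have "\<dots> = (\<integral>\<^sup>+y. (ennreal (U (\<phi>0 y)) * indicator {A N<..} (\<phi>0 y) * ennreal (d0 y) + ennreal (U (\<phi>1 y)) * ennreal (d1 y))
       * indicator (B \<inter> {0<..<1}) y \<partial>lborel)"
  proof (intro nn_integral_cong)
    fix y
    show "(?G (\<phi>0 y) * ennreal (d0 y) + ?G (\<phi>1 y) * ennreal (d1 y)) * indicator {0<..<1} y =
       (ennreal (U (\<phi>0 y)) * indicator {A N<..} (\<phi>0 y) * ennreal (d0 y) + ennreal (U (\<phi>1 y)) * ennreal (d1 y))
       * indicator (B \<inter> {0<..<1}) y"
    proof (cases "y \<in> {0<..<1}")
      case True
      have "A N \<le> a" using A_mono[OF N] phi0_1 by simp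
      then have p1: "\<phi>1 y \<in> {0..1}" "A N < \<phi>1 y" "F (\<phi>1 y) = y"
        using True phi1_range_open[of y] a01 F_phi1[of y] by auto
      have p0: "\<phi>0 y \<in> {0..1}" "F (\<phi>0 y) = y" using True phi0_unit[of y] F_phi0[of y] by auto
      show ?thesis using True p0 p1 by (auto simp: indicator_def)
    qed simp
  qed
  finally show ?thesis .
qed

lemma resolvent_integral_step:
  assumes u: "continuous_on {0..1} u" "\<And>x. x \<in> {0..1} \<Longrightarrow> 0 \<le> u x"
    and B: "B \<in> sets borel" "B \<subseteq> {A N<..1}" and N: "1 \<le> N"
  shows "(\<integral>\<^sup>+x. ennreal (resolvent N \<gamma> u x) * indicator {x \<in> {0..1}. A N < x \<and> F x \<in> B} x \<partial>lborel) =
    (\<integral>\<^sup>+y. ennreal (exp (- \<gamma>) * (resolvent N \<gamma> u y - u y + wtransfer (letter_weight N \<gamma>) u y)) * indicator B y \<partial>lborel)"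
proof -
  let ?U = "resolvent N \<gamma> u"
  have B1: "B \<subseteq> {0..1}" using B(2) A_pos[of N] by force
  show ?thesis
    unfolding preimage_nn_integral[OF resolvent_measurable[OF u(1)] B(1) B1 N]
  proof (intro nn_integral_cong_AE eventually_mono[OF AE_lborel_singleton[of 1]])
    fix y :: real assume y1: "y \<noteq> 1"
    show "(ennreal (?U (\<phi>0 y)) * indicator {A N<..} (\<phi>0 y) * ennreal (d0 y) + ennreal (?U (\<phi>1 y)) * ennreal (d1 y))
       * indicator (B \<inter> {0<..<1}) y = ennreal (exp (- \<gamma>) * (?U y - u y + wtransfer (letter_weight N \<gamma>) u y)) * indicator B y"
    proof (cases "y \<in> B")
      case True
      then have y: "A N < y" "y < 1" using B(2) y1 by auto
      then have y0: "0 < y" using A_pos[of N] by linarith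
      have r0: "0 < \<phi>0 y" "\<phi>0 y \<le> 1" "0 < \<phi>1 y" "\<phi>1 y \<le> 1"
        using phi0_pos[of y] phi0_unit[of y] phi1_range[of y] y y0 a01 by auto
      have "ennreal (?U (\<phi>0 y)) * indicator {A N<..} (\<phi>0 y) = ennreal (?U (\<phi>0 y))"
        using resolvent_below[of "\<phi>0 y" N \<gamma> u] r0 by (auto simp: indicator_def not_less)
      moreover have "ennreal (?U (\<phi>0 y)) * ennreal (d0 y) + ennreal (?U (\<phi>1 y)) * ennreal (d1 y)
         = ennreal (d0 y * ?U (\<phi>0 y) + d1 y * ?U (\<phi>1 y))"
        using resolvent_nonneg[OF u(2)] r0 d0_pos[of y] d1_pos[of y] y y0
        by (simp add: ennreal_mult' ennreal_plus less_imp_le mult.commute)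
      ultimately show ?thesis
        using resolvent_step[OF N y, of \<gamma> u] True y y0 by simp
    qed simp
  qed
qed

text \<open>The index is shifted so that \<open>t = 0\<close> already excludes the hole; on the
  remaining set \<open>resolvent\<close> is bounded for continuous \<open>u\<close>.\<close>

definition survivor_mass :: "nat \<Rightarrow> real \<Rightarrow> (real \<Rightarrow> real) \<Rightarrow> nat \<Rightarrow> ennreal" where
  "survivor_mass N \<gamma> u t =
     (\<integral>\<^sup>+x. ennreal (resolvent N \<gamma> u x) * indicator (survivors N (Suc t)) x \<partial>lborel)"

lemma survivors_1: "survivors N (Suc 0) = {A N<..1}"
proof -
  have "survivors N 0 = {0..1}" by (auto simp: survivors_def)
  moreover have "x \<in> {0..1} \<and> A N < x \<and> F x \<in> {0..1} \<longleftrightarrow> x \<in> {A N<..1}" for x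
    using F_mem[of x] A_pos[of N] by auto
  ultimately show ?thesis unfolding survivors_Suc by blast
qed

lemma survivor_mass_step:
  assumes u: "continuous_on {0..1} u" "\<forall>x\<in>{0..1}. 0 \<le> u x" and N: "1 \<le> N"
  shows "survivor_mass N \<gamma> u (Suc t) = (\<integral>\<^sup>+y. ennreal (exp (- \<gamma>) *
      (resolvent N \<gamma> u y - u y + wtransfer (letter_weight N \<gamma>) u y)) * indicator (survivors N (Suc t)) y \<partial>lborel)"
    and "ennreal (exp (- \<gamma>)) * survivor_mass N \<gamma> u t =
      (\<integral>\<^sup>+y. ennreal (exp (- \<gamma>) * resolvent N \<gamma> u y) * indicator (survivors N (Suc t)) y \<partial>lborel)"
proof -
  show "survivor_mass N \<gamma> u (Suc t) = (\<integral>\<^sup>+y. ennreal (exp (- \<gamma>) *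
      (resolvent N \<gamma> u y - u y + wtransfer (letter_weight N \<gamma>) u y)) * indicator (survivors N (Suc t)) y \<partial>lborel)"
    unfolding survivor_mass_def survivors_Suc[of N "Suc t"]
    by (rule resolvent_integral_step[OF u(1) _ survivors_borel survivors_Suc_sub N]) (use u(2) in auto)
  note [measurable] = resolvent_measurable[OF u(1), of N \<gamma>] survivors_borel
  have "(\<lambda>x. ennreal (resolvent N \<gamma> u x * indicator {0<..1} x) * indicator (survivors N (Suc t)) x) \<in> borel_measurable borel"
    by measurable
  moreover have "(\<lambda>x. ennreal (resolvent N \<gamma> u x * indicator {0<..1} x) * indicator (survivors N (Suc t)) x)
     = (\<lambda>x. ennreal (resolvent N \<gamma> u x) * indicator (survivors N (Suc t)) x)"
    using survivors_Suc_sub[of N t] A_pos[of N] by (fastforce simp: fun_eq_iff indicator_def)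
  ultimately have "(\<lambda>x. ennreal (resolvent N \<gamma> u x) * indicator (survivors N (Suc t)) x) \<in> borel_measurable lborel"
    by simp
  then show "ennreal (exp (- \<gamma>)) * survivor_mass N \<gamma> u t =
      (\<integral>\<^sup>+y. ennreal (exp (- \<gamma>) * resolvent N \<gamma> u y) * indicator (survivors N (Suc t)) y \<partial>lborel)"
    unfolding survivor_mass_def
    by (subst nn_integral_cmult[symmetric]) (auto simp: ennreal_mult' mult.assoc)
qed

lemma exp_step: "ennreal (exp (- \<gamma> * real (Suc t))) = ennreal (exp (- \<gamma>)) * ennreal (exp (- \<gamma> * real t))"
proof -
  have "exp (- \<gamma> * real (Suc t)) = exp (- \<gamma>) * exp (- \<gamma> * real t)" by (simp add: algebra_simps flip: exp_add)
  then show ?thesis by (simp only: ennreal_mult exp_ge_zero)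
qed

lemma survivor_mass_growth:
  assumes u: "continuous_on {0..1} u" "\<forall>x\<in>{0..1}. 0 \<le> u x" and N: "1 \<le> N"
    and sub: "\<And>x. x \<in> {0..1} \<Longrightarrow> u x \<le> wtransfer (letter_weight N \<gamma>) u x"
  shows "ennreal (exp (- \<gamma> * real t)) * survivor_mass N \<gamma> u 0 \<le> survivor_mass N \<gamma> u t"
proof (induction t)
  case (Suc t)
  have "ennreal (exp (- \<gamma>)) * survivor_mass N \<gamma> u t \<le> survivor_mass N \<gamma> u (Suc t)"
    unfolding survivor_mass_step[OF u N]
    by (intro nn_integral_mono) (auto simp: indicator_def survivors_def sub intro!: ennreal_leI)
  then show ?case
    unfolding exp_step mult.assoc using mult_left_mono[OF Suc, of "ennreal (exp (- \<gamma>))"] order_trans by simp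
qed simp

lemma survivor_mass_decay:
  assumes u: "continuous_on {0..1} u" "\<forall>x\<in>{0..1}. 0 \<le> u x" and N: "1 \<le> N"
    and super: "\<And>x. x \<in> {0..1} \<Longrightarrow> wtransfer (letter_weight N \<gamma>) u x \<le> u x"
  shows "survivor_mass N \<gamma> u t \<le> ennreal (exp (- \<gamma> * real t)) * survivor_mass N \<gamma> u 0"
proof (induction t)
  case (Suc t)
  have "survivor_mass N \<gamma> u (Suc t) \<le> ennreal (exp (- \<gamma>)) * survivor_mass N \<gamma> u t"
    unfolding survivor_mass_step[OF u N]
    by (intro nn_integral_mono) (auto simp: indicator_def survivors_def super intro!: ennreal_leI)
  then show ?case
    unfolding exp_step mult.assoc using mult_left_mono[OF Suc, of "ennreal (exp (- \<gamma>))"] order_trans by simp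
qed simp

lemma survivor_mass_le:
  assumes "continuous_on {0..1} u"
  obtains M where "0 < M" "\<And>t. survivor_mass N \<gamma> u t \<le> ennreal M * emeasure lborel (survivors N (Suc t))"
proof -
  obtain M where M: "0 < M" "\<And>x. A N < x \<Longrightarrow> x \<le> 1 \<Longrightarrow> resolvent N \<gamma> u x \<le> M" using resolvent_bound[OF assms] by blast
  have "survivor_mass N \<gamma> u t \<le> (\<integral>\<^sup>+x. ennreal M * indicator (survivors N (Suc t)) x \<partial>lborel)" for t
    unfolding survivor_mass_def using survivors_Suc_sub[of N t] M
    by (intro nn_integral_mono) (auto simp: indicator_def intro!: ennreal_leI)
  then show thesis using that[OF M(1)] survivors_borel by (simp add: nn_integral_cmult_indicator)
qed

lemma survivor_mass_ge:
  assumes N: "1 \<le> N" and e: "0 < e" "\<And>x. x \<in> {0..1} \<Longrightarrow> e \<le> u x"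
  shows "ennreal e * emeasure lborel (survivors N (Suc t)) \<le> survivor_mass N \<gamma> u t"
proof -
  have "(\<integral>\<^sup>+x. ennreal e * indicator (survivors N (Suc t)) x \<partial>lborel) \<le> survivor_mass N \<gamma> u t"
    unfolding survivor_mass_def
  proof (intro nn_integral_mono)
    fix x
    show "ennreal e * indicator (survivors N (Suc t)) x \<le> ennreal (resolvent N \<gamma> u x) * indicator (survivors N (Suc t)) x"
    proof (cases "x \<in> survivors N (Suc t)")
      case True
      then have x: "A N < x" "x \<le> 1" using subsetD[OF survivors_Suc_sub True] by simp_all
      then have "e \<le> u x" using e(2)[of x] A_pos[of N] by auto
      also have "u x \<le> resolvent N \<gamma> u x"
        using x e by (intro resolvent_ge N) (auto intro: order_trans[OF less_imp_le])
      finally show ?thesis by (simp add: True ennreal_leI)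
    qed simp
  qed
  then show ?thesis using survivors_borel by (simp add: nn_integral_cmult_indicator)
qed

text \<open>On the survivors \<open>resolvent\<close> lies between \<open>e\<close> and a bound
  \<open>M\<close>, so \<open>survivor_mass\<close> is comparable with Lebesgue measure and its
  growth carries over. \<open>M\<close> depends on \<open>N\<close>, which is harmless because
  \<open>N\<close> stays fixed while \<open>t\<close> grows.\<close>

lemma survivors_lower:
  assumes N: "1 \<le> N" and u: "continuous_on {0..1} u" "0 < e" "\<And>x. x \<in> {0..1} \<Longrightarrow> e \<le> u x"
    and sub: "\<And>x. x \<in> {0..1} \<Longrightarrow> u x \<le> wtransfer (letter_weight N \<gamma>) u x"
  shows "\<exists>c>0. \<forall>t. ennreal (c * exp (- \<gamma> * real t)) \<le> emeasure lborel (survivors N (Suc t))"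
proof -
  have u0: "\<forall>x\<in>{0..1}. 0 \<le> u x" using u(2,3) by (meson less_imp_le order_trans)
  obtain M where M: "0 < M" "\<And>t. survivor_mass N \<gamma> u t \<le> ennreal M * emeasure lborel (survivors N (Suc t))"
    using survivor_mass_le[OF u(1)] by blast
  have A1: "A N < 1" using A_Suc_less[of 0] A_mono[OF N] by simp
  have J0: "ennreal (e * (1 - A N)) \<le> survivor_mass N \<gamma> u 0"
    using survivor_mass_ge[OF N u(2,3), where t = 0 and \<gamma> = \<gamma>] A1 u(2) unfolding survivors_1 by (simp add: ennreal_mult')
  show ?thesis
  proof (intro exI[of _ "e * (1 - A N) / M"] conjI allI)
    show "0 < e * (1 - A N) / M" using A1 u(2) M(1) by simp
    fix t
    have "ennreal M * ennreal (e * (1 - A N) / M * exp (- \<gamma> * real t)) = ennreal (exp (- \<gamma> * real t)) * ennreal (e * (1 - A N))"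
      using M(1) A1 u(2) by (simp add: ennreal_mult'[symmetric] mult.commute)
    also have "\<dots> \<le> ennreal (exp (- \<gamma> * real t)) * survivor_mass N \<gamma> u 0" using J0 by (rule mult_left_mono) simp
    also have "\<dots> \<le> survivor_mass N \<gamma> u t" by (rule survivor_mass_growth[OF u(1) u0 N sub])
    also have "\<dots> \<le> ennreal M * emeasure lborel (survivors N (Suc t))" by (rule M(2))
    finally show "ennreal (e * (1 - A N) / M * exp (- \<gamma> * real t)) \<le> emeasure lborel (survivors N (Suc t))"
      using M(1) by (subst (asm) ennreal_mult_le_mult_iff) auto
  qed
qed

lemma survivors_upper:
  assumes N: "1 \<le> N" and u: "continuous_on {0..1} u" "0 < e" "\<And>x. x \<in> {0..1} \<Longrightarrow> e \<le> u x"
    and super: "\<And>x. x \<in> {0..1} \<Longrightarrow> wtransfer (letter_weight N \<gamma>) u x \<le> u x"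
  shows "\<exists>c>0. \<forall>t. emeasure lborel (survivors N (Suc t)) \<le> ennreal (c * exp (- \<gamma> * real t))"
proof -
  have u0: "\<forall>x\<in>{0..1}. 0 \<le> u x" using u(2,3) by (meson less_imp_le order_trans)
  obtain M where M: "0 < M" "\<And>t. survivor_mass N \<gamma> u t \<le> ennreal M * emeasure lborel (survivors N (Suc t))"
    using survivor_mass_le[OF u(1)] by blast
  have A1: "A N < 1" using A_Suc_less[of 0] A_mono[OF N] by simp
  have "emeasure lborel (survivors N (Suc 0)) \<le> ennreal 1"
    unfolding survivors_1 using A1 A_pos[of N] by (simp del: ennreal_1 add: ennreal_leI)
  then have "ennreal M * emeasure lborel (survivors N (Suc 0)) \<le> ennreal M * ennreal 1"
    by (rule mult_left_mono) simp
  with M(2)[of 0] have J0: "survivor_mass N \<gamma> u 0 \<le> ennreal M" by (simp add: order_trans)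
  show ?thesis
  proof (intro exI[of _ "M / e"] conjI allI)
    show "0 < M / e" using u(2) M(1) by simp
    fix t
    have "ennreal e * emeasure lborel (survivors N (Suc t)) \<le> survivor_mass N \<gamma> u t"
      by (rule survivor_mass_ge[OF N u(2,3)])
    also have "\<dots> \<le> ennreal (exp (- \<gamma> * real t)) * survivor_mass N \<gamma> u 0"
      by (rule survivor_mass_decay[OF u(1) u0 N super])
    also have "\<dots> \<le> ennreal (exp (- \<gamma> * real t)) * ennreal M" using J0 by (rule mult_left_mono) simp
    also have "\<dots> = ennreal e * ennreal (M / e * exp (- \<gamma> * real t))"
      using M(1) u(2) by (simp add: ennreal_mult'[symmetric] mult.commute)
    finally show "emeasure lborel (survivors N (Suc t)) \<le> ennreal (M / e * exp (- \<gamma> * real t))"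
      using u(2) by (subst (asm) ennreal_mult_le_mult_iff) auto
  qed
qed

end

section \<open>Equivalent measures and the tower measure\<close>

lemma equivalent_lower_bound:
  assumes "equivalent_to_lebesgue \<nu>"
  shows "\<exists>\<delta>>0. \<forall>B\<in>sets unit_lebesgue. ennreal \<delta> * emeasure unit_lebesgue B \<le> emeasure \<nu> B"
proof -
  obtain h \<delta> where h: "h \<in> borel_measurable unit_lebesgue" "\<nu> = density unit_lebesgue h"
    "0 < \<delta>" "AE x in unit_lebesgue. ennreal \<delta> \<le> h x"
    using assms unfolding equivalent_to_lebesgue_def by blast
  have "ennreal \<delta> * emeasure unit_lebesgue B \<le> emeasure \<nu> B" if B: "B \<in> sets unit_lebesgue" for B
  proof -
    have "ennreal \<delta> * emeasure unit_lebesgue B = (\<integral>\<^sup>+x. ennreal \<delta> * indicator B x \<partial>unit_lebesgue)"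
      using B by (simp add: nn_integral_cmult_indicator)
    also have "\<dots> \<le> (\<integral>\<^sup>+x. h x * indicator B x \<partial>unit_lebesgue)"
      using h(4) by (intro nn_integral_mono_AE) (auto elim!: eventually_mono split: split_indicator)
    also have "\<dots> = emeasure \<nu> B" unfolding h(2) using h(1) B by (simp add: emeasure_density)
    finally show ?thesis .
  qed
  then show ?thesis using h(3) by blast
qed

lemma equivalent_null:
  assumes "equivalent_to_lebesgue \<nu>" "B \<in> sets unit_lebesgue"
  shows "emeasure \<nu> B = 0 \<longleftrightarrow> emeasure unit_lebesgue B = 0"
proof
  obtain \<delta> where "0 < \<delta>" "ennreal \<delta> * emeasure unit_lebesgue B \<le> emeasure \<nu> B"
    using equivalent_lower_bound[OF assms(1)] assms(2) by blast
  then show "emeasure unit_lebesgue B = 0" if "emeasure \<nu> B = 0" using that by simp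
  obtain h where h: "h \<in> borel_measurable unit_lebesgue" "\<nu> = density unit_lebesgue h"
    using assms unfolding equivalent_to_lebesgue_def by blast
  show "emeasure \<nu> B = 0" if "emeasure unit_lebesgue B = 0"
  proof -
    have "B \<in> null_sets unit_lebesgue" using that assms(2) by auto
    then have "B \<in> null_sets \<nu>" unfolding h(2) null_sets_density_iff[OF h(1)]
      using assms(2) by (auto dest: AE_not_in)
    then show ?thesis by auto
  qed
qed

lemma equivalent_sets:
  assumes "equivalent_to_lebesgue \<nu>" shows "sets \<nu> = sets unit_lebesgue" "space \<nu> = {0..1}"
  using assms unfolding equivalent_to_lebesgue_def by auto

lemma equivalent_ergodic_conservative:
  assumes "equivalent_to_lebesgue \<mu>" "equivalent_to_lebesgue \<nu>"
  shows "ergodic \<mu> F \<Longrightarrow> ergodic \<nu> F" "conservative \<mu> F \<Longrightarrow> conservative \<nu> F"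
proof -
  note s = equivalent_sets[OF assms(1)] equivalent_sets[OF assms(2)]
  have n: "emeasure \<mu> B = 0 \<longleftrightarrow> emeasure \<nu> B = 0" if "B \<in> sets unit_lebesgue" for B
    using equivalent_null assms that by simp
  have c: "{0..1} - B \<in> sets unit_lebesgue" if "B \<in> sets unit_lebesgue" for B
    using that by (auto simp: sets_unit_lebesgue intro: sets.Diff)
  show "ergodic \<nu> F" if "ergodic \<mu> F"
    using that n c unfolding ergodic_def s by blast
  show "conservative \<nu> F" if "conservative \<mu> F"
    using that n unfolding conservative_def s by blast
qed

lemma sigma_finite_unit_lebesgue: "sigma_finite_measure unit_lebesgue"
proof -
  have "finite_measure unit_lebesgue"
    by (rule finite_measureI) (simp add: emeasure_unit_lebesgue)
  then show ?thesis by (simp add: finite_measure_def)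
qed

context parabolic_system begin

text \<open>
  The invariant measure of the tower over \<open>h\<close> is equivalent to Lebesgue measure. Since ergodicity
  and conservativity only depend on the null sets, it inherits them from \<open>\<mu>\<close>, and by uniqueness
  it is a multiple of \<open>\<mu>\<close>; this bounds the density of \<open>\<mu>\<close> away from \<open>0\<close>.
\<close>

definition tower :: "real \<Rightarrow> ennreal" where
  "tower x = (\<Sum>j. ennreal (D j x * h ((\<phi>0 ^^ j) x)))"

definition tower_measure :: "real measure" where
  "tower_measure = density unit_lebesgue (\<lambda>x. tower x * indicator {0<..1} x)"

lemma h_lower: "x \<in> {0..1} \<Longrightarrow> exp (- K) \<le> h x" and h_upper: "x \<in> {0..1} \<Longrightarrow> h x \<le> exp K"
  and h_gt_0: "x \<in> {0..1} \<Longrightarrow> 0 < h x"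
  using reg_density_bounds[OF h_reg_density] by auto

lemma tower_measurable [measurable]: "(\<lambda>x. tower x * indicator {0<..1} x) \<in> borel_measurable borel"
proof -
  note [measurable] = iter_term_measurable[OF h_cont]
  have "(\<lambda>x. \<Sum>j. ennreal (D j x * h ((\<phi>0 ^^ j) x) * indicator {0<..1} x)) \<in> borel_measurable borel" by measurable
  moreover have "(\<lambda>x. \<Sum>j. ennreal (D j x * h ((\<phi>0 ^^ j) x) * indicator {0<..1} x)) = (\<lambda>x. tower x * indicator {0<..1} x)"
    by (auto simp: tower_def fun_eq_iff indicator_def)
  ultimately show ?thesis by simp
qed

lemma tower_measurable_unit: "(\<lambda>x. tower x * indicator {0<..1} x) \<in> borel_measurable unit_lebesgue"
  unfolding unit_lebesgue_def by (intro measurable_restrict_space1) simp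

lemma tower_ge: "0 < x \<Longrightarrow> x \<le> 1 \<Longrightarrow> ennreal (exp (- K)) \<le> tower x"
proof -
  assume x: "0 < x" "x \<le> 1"
  have "ennreal (exp (- K)) \<le> ennreal (D 0 x * h ((\<phi>0 ^^ 0) x))"
    using h_lower[of x] x by (intro ennreal_leI) (simp add: chain_deriv_def)
  also have "\<dots> \<le> tower x" unfolding tower_def by (subst suminf_ennreal_head) simp
  finally show ?thesis .
qed

lemma Psi_surj:
  assumes "x \<in> {A (Suc i)..A i}" obtains y where "y \<in> {0..1}" "\<Psi> i y = x"
proof -
  from Psi_ends[of i] show thesis
  proof (elim disjE conjE)
    assume "\<Psi> i 0 = A (Suc i)" "\<Psi> i 1 = A i"
    then show thesis using IVT'[of "\<Psi> i" 0 x 1] assms Psi_continuous that by auto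
  next
    assume "\<Psi> i 0 = A i" "\<Psi> i 1 = A (Suc i)"
    then show thesis using IVT2'[of "\<Psi> i" 1 x 0] assms Psi_continuous that by auto
  qed
qed

text \<open>Writing \<open>x = \<Psi> i y\<close>, the chain rule turns \<open>D j x\<close> into
  the quotient of \<open>\<l> (i + j) y\<close> by \<open>\<l> i y\<close>. Both are comparable with
  gap lengths, and the gaps \<open>A (i + j) - A (i + Suc j)\<close> telescope. In the constant,
  \<open>exp K\<close> bounds \<open>h\<close> and each of the two weights contributes one
  \<open>exp (C * \<theta>)\<close>.\<close>

lemma tower_bound_gap:
  assumes x: "x \<in> {A (Suc i)..A i}"
  shows "tower x \<le> ennreal (exp (K + 2 * (C * \<theta>)) / (A i - A (Suc i)))"
proof -
  obtain y where y: "y \<in> {0..1}" "\<Psi> i y = x" using Psi_surj[OF x] by blast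
  let ?c = "exp (K + 2 * (C * \<theta>)) / (A i - A (Suc i))"
  have g: "0 < A i - A (Suc i)" using A_Suc_lt[of i] by simp
  have x01: "0 < x" "x \<le> 1" using x A_pos[of "Suc i"] A_le_1[of i] by auto
  have bound: "D j x * h ((\<phi>0 ^^ j) x) \<le> ?c * (A (i + j) - A (i + Suc j))" for j
  proof -
    have "\<l> (i + j) y = D j x * \<l> i y"
      unfolding ret_deriv_def D_add using y(2) by (simp add: ret_branch_def)
    then have D: "D j x = \<l> (i + j) y / \<l> i y" using l_pos[OF y(1), of i] by simp
    have "D j x \<le> (exp (C * \<theta>) * (A (i + j) - A (i + Suc j))) / ((A i - A (Suc i)) / exp (C * \<theta>))"
      unfolding D
    proof (rule frac_le)
      show "\<l> (i + j) y \<le> exp (C * \<theta>) * (A (i + j) - A (i + Suc j))" using weight_le[OF y(1), of "i + j"] by simp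
      show "(A i - A (Suc i)) / exp (C * \<theta>) \<le> \<l> i y" using weight_ge[OF y(1), of i] by (simp add: field_simps)
      show "0 < (A i - A (Suc i)) / exp (C * \<theta>)" using g by simp
      show "0 \<le> exp (C * \<theta>) * (A (i + j) - A (i + Suc j))" using A_Suc_lt[of "i + j"] by simp
    qed
    also have "\<dots> = exp (2 * (C * \<theta>)) / (A i - A (Suc i)) * (A (i + j) - A (i + Suc j))"
      unfolding mult_2 exp_add by (simp del: funpow.simps)
    finally have Dj: "D j x \<le> exp (2 * (C * \<theta>)) / (A i - A (Suc i)) * (A (i + j) - A (i + Suc j))" .
    have "0 \<le> exp (2 * (C * \<theta>)) / (A i - A (Suc i)) * (A (i + j) - A (i + Suc j))"
      using Dj D_pos[OF x01, of j] by linarith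
    moreover have "(\<phi>0 ^^ j) x \<in> {0..1}" using iter_unit[of x j] x01 by simp
    ultimately have "D j x * h ((\<phi>0 ^^ j) x) \<le> exp (2 * (C * \<theta>)) / (A i - A (Suc i)) * (A (i + j) - A (i + Suc j)) * exp K"
      by (intro mult_mono Dj h_upper less_imp_le[OF h_gt_0])
    then show ?thesis unfolding exp_add by (simp only: mult_ac times_divide_eq_left times_divide_eq_right)
  qed
  have "(\<lambda>j. A (i + j)) \<longlonglongrightarrow> 0" using LIMSEQ_ignore_initial_segment[OF A_tendsto_0, of i] by (simp add: add.commute)
  then have "(\<lambda>j. A (i + j) - A (i + Suc j)) sums (A (i + 0) - 0)" by (rule telescope_sums')
  then have s: "(\<lambda>j. ?c * (A (i + j) - A (i + Suc j))) sums (?c * A i)" by (intro sums_mult) simp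
  have "tower x \<le> (\<Sum>j. ennreal (?c * (A (i + j) - A (i + Suc j))))"
    unfolding tower_def using bound by (intro suminf_le summableI ennreal_leI) auto
  also have "\<dots> = ennreal (?c * A i)"
    using g A_Suc_lt by (intro suminf_ennreal_eq s) (auto intro!: mult_nonneg_nonneg simp: less_imp_le)
  also have "\<dots> \<le> ennreal ?c" using g A_le_1[of i] by (intro ennreal_leI mult_left_le) auto
  finally show ?thesis .
qed

lemma gap_exists:
  assumes "1 \<le> N" "A N \<le> x" "x \<le> 1" obtains i where "i < N" "x \<in> {A (Suc i)..A i}"
proof -
  have ex: "A (Suc (N - 1)) \<le> x" using assms(1,2) by (cases N) auto
  define i where "i = (LEAST i. A (Suc i) \<le> x)"
  have 1: "A (Suc i) \<le> x" unfolding i_def using ex by (rule LeastI)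
  have 2: "i \<le> N - 1" unfolding i_def using ex by (rule Least_le)
  have "x \<le> A i"
  proof (cases i)
    case (Suc k)
    then have "\<not> A (Suc k) \<le> x" using not_less_Least[of k "\<lambda>i. A (Suc i) \<le> x"] i_def by simp
    then show ?thesis using Suc by simp
  qed (use assms in simp)
  then show thesis using 1 2 assms(1) by (intro that[of i]) auto
qed

lemma tower_bound:
  assumes "1 \<le> N" obtains M where "0 < M" "\<And>x. A N \<le> x \<Longrightarrow> x \<le> 1 \<Longrightarrow> tower x \<le> ennreal M"
proof -
  define M where "M = (\<Sum>i<N. exp (K + 2 * (C * \<theta>)) / (A i - A (Suc i)))"
  have nn: "0 \<le> exp (K + 2 * (C * \<theta>)) / (A i - A (Suc i))" for i using A_Suc_lt[of i] by simp
  have "tower x \<le> ennreal M" if x: "A N \<le> x" "x \<le> 1" for x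
  proof -
    obtain i where i: "i < N" "x \<in> {A (Suc i)..A i}" using gap_exists[OF assms x] by blast
    have "tower x \<le> ennreal (exp (K + 2 * (C * \<theta>)) / (A i - A (Suc i)))" by (rule tower_bound_gap[OF i(2)])
    also have "\<dots> \<le> ennreal M" unfolding M_def
      by (intro ennreal_leI member_le_sum nn) (use i in auto)
    finally show ?thesis .
  qed
  moreover have "0 \<le> M" unfolding M_def by (intro sum_nonneg nn)
  moreover have "ennreal M \<le> ennreal (M + 1)" by (intro ennreal_leI) simp
  ultimately show thesis by (intro that[of "M + 1"]) (linarith, meson order_trans)
qed

text \<open>The first branch reproduces every term of the series except the one for
  \<open>j = 0\<close>; the second contributes \<open>transfer h y = h y\<close>, which is exactly
  that term.\<close>

lemma tower_step:
  assumes y: "0 < y" "y < 1"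
  shows "tower (\<phi>0 y) * ennreal (d0 y) + tower (\<phi>1 y) * ennreal (d1 y) = tower y"
proof -
  have t0: "tower (\<phi>0 y) * ennreal (d0 y) = (\<Sum>j. ennreal (D (Suc j) y * h ((\<phi>0 ^^ Suc j) y)))"
  proof -
    have "ennreal (D j (\<phi>0 y) * h ((\<phi>0 ^^ j) (\<phi>0 y))) * ennreal (d0 y) = ennreal (D (Suc j) y * h ((\<phi>0 ^^ Suc j) y))" for j
    proof -
      have sw: "(\<phi>0 ^^ j) (\<phi>0 y) = (\<phi>0 ^^ Suc j) y" by (simp add: funpow_swap1)
      have "0 \<le> d0 y" using d0_pos y by (simp add: less_imp_le)
      then show ?thesis unfolding D_Suc sw by (subst ennreal_mult''[symmetric]) (simp_all add: mult_ac)
    qed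
    then show ?thesis unfolding tower_def ennreal_suminf_multc[symmetric] by simp
  qed
  have t1: "tower (\<phi>1 y) * ennreal (d1 y) = ennreal (h y)"
  proof -
    have y01: "y \<in> {0..1}" using y by simp
    have "ennreal (D j (\<phi>1 y) * h ((\<phi>0 ^^ j) (\<phi>1 y))) * ennreal (d1 y) = ennreal (\<l> j y * h (\<Psi> j y))" for j
    proof -
      have "0 \<le> d1 y" using d1_pos y by (simp add: less_imp_le)
      then show ?thesis unfolding ret_deriv_def ret_branch_def by (subst ennreal_mult''[symmetric]) (simp_all add: mult_ac)
    qed
    then have "tower (\<phi>1 y) * ennreal (d1 y) = (\<Sum>j. ennreal (\<l> j y * h (\<Psi> j y)))"
      unfolding tower_def ennreal_suminf_multc[symmetric] by simp
    also have "\<dots> = ennreal (transfer h y)"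
      using wtransfer_sums[OF Bseq_one h_cont y01] l_pos[OF y01] h_gt_0[OF Psi_unit[OF y01]]
      by (intro suminf_ennreal_eq) (auto intro!: mult_nonneg_nonneg simp: less_imp_le)
    finally show ?thesis using transfer_h[OF y01] by simp
  qed
  have "tower y = ennreal (h y) + (\<Sum>j. ennreal (D (Suc j) y * h ((\<phi>0 ^^ Suc j) y)))"
    unfolding tower_def by (subst suminf_ennreal_head) (simp add: chain_deriv_def)
  then show ?thesis unfolding t0 t1 by (simp only: add.commute)
qed

lemma tower_equivalent: "equivalent_to_lebesgue tower_measure"
  unfolding equivalent_to_lebesgue_def
proof (intro bexI[OF _ tower_measurable_unit] conjI)
  show "tower_measure = density unit_lebesgue (\<lambda>x. tower x * indicator {0<..1} x)" by (rule tower_measure_def)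
  have "AE x in lborel. x \<noteq> (0::real)" by (rule AE_lborel_singleton)
  then have "AE x in lborel. x \<in> {0..1} \<longrightarrow> ennreal (exp (- K)) \<le> tower x * indicator {0<..1} x"
    by eventually_elim (use tower_ge in auto)
  then have "AE x in unit_lebesgue. ennreal (exp (- K)) \<le> tower x * indicator {0<..1} x"
    unfolding unit_lebesgue_def by (subst AE_restrict_space_iff) auto
  then show "\<exists>\<delta>>0. AE x in unit_lebesgue. ennreal \<delta> \<le> tower x * indicator {0<..1} x" by (intro exI[of _ "exp (- K)"]) simp
qed

lemma tower_emeasure:
  assumes "B \<in> sets unit_lebesgue"
  shows "emeasure tower_measure B = (\<integral>\<^sup>+x. tower x * indicator {0<..1} x * indicator B x \<partial>lborel)"
proof -
  have "emeasure tower_measure B = (\<integral>\<^sup>+x. tower x * indicator {0<..1} x * indicator B x \<partial>unit_lebesgue)"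
    unfolding tower_measure_def by (rule emeasure_density[OF tower_measurable_unit assms])
  also have "\<dots> = (\<integral>\<^sup>+x. tower x * indicator {0<..1} x * indicator B x \<partial>lborel)"
    unfolding nn_integral_unit_lebesgue by (intro nn_integral_cong) (auto simp: indicator_def)
  finally show ?thesis .
qed

lemma tower_invariant: "invariant_measure tower_measure F"
proof -
  note s = equivalent_sets[OF tower_equivalent]
  have F: "F \<in> measurable tower_measure tower_measure"
    using F_measurable measurable_cong_sets[OF s(1) s(1)] by blast
  have "distr tower_measure tower_measure F = tower_measure"
  proof (rule measure_eqI)
    fix B assume "B \<in> sets (distr tower_measure tower_measure F)"
    then have B: "B \<in> sets unit_lebesgue" by (simp add: s)
    then have Bb: "B \<in> sets borel" "B \<subseteq> {0..1}" by (auto simp: sets_unit_lebesgue)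
    let ?P = "{x \<in> {0..1}. F x \<in> B}"
    have P: "?P \<in> sets borel" by (rule F_preimage[OF Bb])
    have "emeasure (distr tower_measure tower_measure F) B = emeasure tower_measure (F -` B \<inter> space tower_measure)"
      using F B s by (intro emeasure_distr) auto
    also have "F -` B \<inter> space tower_measure = ?P" using s by auto
    also have "emeasure tower_measure ?P = (\<integral>\<^sup>+x. (tower x * indicator ?P x) * indicator {0<..1} x \<partial>lborel)"
      using P by (subst tower_emeasure) (auto simp: sets_unit_lebesgue intro!: nn_integral_cong simp: mult_ac)
    also have "\<dots> = (\<integral>\<^sup>+y. ((tower (\<phi>0 y) * indicator ?P (\<phi>0 y)) * ennreal (d0 y) + (tower (\<phi>1 y) * indicator ?P (\<phi>1 y)) * ennreal (d1 y)) * indicator {0<..<1} y \<partial>lborel)"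
    proof (rule transfer_nn_integral)
      note [measurable] = P
      have "(\<lambda>x. (tower x * indicator {0<..1} x) * indicator ?P x) \<in> borel_measurable borel" by measurable
      then show "(\<lambda>x. (tower x * indicator ?P x) * indicator {0<..1} x) \<in> borel_measurable borel"
        by (simp only: mult_ac)
    qed
    also have "\<dots> = (\<integral>\<^sup>+y. tower y * indicator {0<..1} y * indicator B y \<partial>lborel)"
    proof (intro nn_integral_cong_AE eventually_mono[OF AE_lborel_singleton[of 1]])
      fix y :: real assume y1: "y \<noteq> 1"
      show "((tower (\<phi>0 y) * indicator ?P (\<phi>0 y)) * ennreal (d0 y) + (tower (\<phi>1 y) * indicator ?P (\<phi>1 y)) * ennreal (d1 y)) * indicator {0<..<1} y
        = tower y * indicator {0<..1} y * indicator B y"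
      proof (cases "y \<in> {0<..<1}")
        case True
        then have y: "0 < y" "y < 1" by auto
        have "\<phi>0 y \<in> {0..1}" "F (\<phi>0 y) = y" using phi0_unit[of y] F_phi0[of y] y by auto
        then have i0: "indicator ?P (\<phi>0 y) = (indicator B y :: ennreal)" by (simp add: indicator_def)
        have "\<phi>1 y \<in> {0..1}" "F (\<phi>1 y) = y" using phi1_range_open[OF y] a01 F_phi1[OF y] by auto
        then have i1: "indicator ?P (\<phi>1 y) = (indicator B y :: ennreal)" by (simp add: indicator_def)
        have "(tower (\<phi>0 y) * indicator B y) * ennreal (d0 y) + (tower (\<phi>1 y) * indicator B y) * ennreal (d1 y)
          = (tower (\<phi>0 y) * ennreal (d0 y) + tower (\<phi>1 y) * ennreal (d1 y)) * indicator B y"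
          by (simp add: algebra_simps)
        then show ?thesis unfolding i0 i1 tower_step[OF y] using y by simp
      qed (use y1 in \<open>auto simp: indicator_def\<close>)
    qed
    also have "\<dots> = emeasure tower_measure B" by (rule tower_emeasure[OF B, symmetric])
    finally show "emeasure (distr tower_measure tower_measure F) B = emeasure tower_measure B" .
  qed simp
  then show ?thesis using F by (simp add: invariant_measure_def)
qed

text \<open>The total mass may be infinite, but the density is finite at every point, being bounded
  outside each \<open>[0, A n]\<close>.\<close>

lemma tower_sigma_finite: "sigma_finite_measure tower_measure"
proof -
  have fin: "tower x * indicator {0<..1} x \<noteq> \<infinity>" for x
  proof (cases "x \<in> {0<..1}")
    case True
    have "\<forall>\<^sub>F n in sequentially. A n < x" using A_tendsto_0 True by (intro order_tendstoD) auto
    then obtain n where n: "A n < x" "1 \<le> n"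
      by (metis (mono_tags, lifting) eventually_sequentially max.cobounded1 max.cobounded2)
    obtain M where "\<And>x. A n \<le> x \<Longrightarrow> x \<le> 1 \<Longrightarrow> tower x \<le> ennreal M" using tower_bound[OF n(2)] by blast
    then have "tower x \<le> ennreal M" using n True by auto
    then show ?thesis using True by (auto simp: top_unique)
  qed simp
  show ?thesis unfolding tower_measure_def
    using sigma_finite_measure.sigma_finite_iff_density_finite[OF sigma_finite_unit_lebesgue tower_measurable_unit] fin
    by simp
qed

lemma mu_lower: "\<exists>\<delta>>0. \<forall>B. B \<in> sets borel \<longrightarrow> B \<subseteq> {0..1} \<longrightarrow> ennreal \<delta> * emeasure lborel B \<le> emeasure \<mu> B"
proof -
  have "equivalent_to_lebesgue \<mu>" using acim by (auto simp: H5_def ergodic_conservative_acim_def)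
  then obtain \<delta> where "0 < \<delta>" "\<forall>B\<in>sets unit_lebesgue. ennreal \<delta> * emeasure unit_lebesgue B \<le> emeasure \<mu> B"
    using equivalent_lower_bound by blast
  then show ?thesis by (auto simp: sets_unit_lebesgue emeasure_unit_lebesgue intro!: exI[of _ \<delta>])
qed

lemma mu_upper:
  assumes N: "1 \<le> N"
  shows "\<exists>M>0. \<forall>B. B \<in> sets borel \<longrightarrow> B \<subseteq> {A N<..1} \<longrightarrow> emeasure \<mu> B \<le> ennreal M * emeasure lborel B"
proof -
  have "ergodic_conservative_acim F \<mu>" using acim by (simp add: H5_def)
  then have "ergodic_conservative_acim F tower_measure"
    unfolding ergodic_conservative_acim_def
    using tower_sigma_finite tower_equivalent tower_invariant equivalent_ergodic_conservative[of \<mu> tower_measure F] by blast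
  then obtain t where t: "0 < t" "tower_measure = scale_measure (ennreal t) \<mu>"
    using acim unfolding H5_def by blast
  obtain M where M: "0 < M" "\<And>x. A N \<le> x \<Longrightarrow> x \<le> 1 \<Longrightarrow> tower x \<le> ennreal M" using tower_bound[OF N] by blast
  have "emeasure \<mu> B \<le> ennreal (M / t) * emeasure lborel B" if B: "B \<in> sets borel" "B \<subseteq> {A N<..1}" for B
  proof -
    have Bs: "B \<in> sets unit_lebesgue" using B A_pos[of N] by (auto simp: sets_unit_lebesgue)
    have "ennreal t * emeasure \<mu> B = emeasure tower_measure B" unfolding t(2) by simp
    also have "\<dots> \<le> (\<integral>\<^sup>+x. ennreal M * indicator B x \<partial>lborel)"
      unfolding tower_emeasure[OF Bs] using B(2) M(2) A_pos[of N]
      by (intro nn_integral_mono) (auto simp: indicator_def)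
    also have "\<dots> = ennreal t * (ennreal (M / t) * emeasure lborel B)"
      using B(1) t(1) M(1) by (simp add: nn_integral_cmult_indicator mult.assoc[symmetric] ennreal_mult'[symmetric])
    finally show ?thesis using t(1) by (subst (asm) ennreal_mult_le_mult_iff) auto
  qed
  then show ?thesis using M(1) t(1) by (intro exI[of _ "M / t"]) auto
qed

section \<open>Escape rates from sub- and supersolutions\<close>

lemma escape_le:
  assumes N: "1 \<le> N" and u: "continuous_on {0..1} u" "0 < e" "\<And>x. x \<in> {0..1} \<Longrightarrow> e \<le> u x"
    and sub: "\<And>x. x \<in> {0..1} \<Longrightarrow> u x \<le> wtransfer (letter_weight N \<gamma>) u x"
  shows "escape_rate \<mu> F {0..A N} \<le> ereal \<gamma>"
proof -
  obtain c where c: "0 < c" "\<And>t. ennreal (c * exp (- \<gamma> * real t)) \<le> emeasure lborel (survivors N (Suc t))"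
    using survivors_lower[OF assms] by blast
  obtain \<delta> where d: "0 < \<delta>" "\<And>B. B \<in> sets borel \<Longrightarrow> B \<subseteq> {0..1} \<Longrightarrow> ennreal \<delta> * emeasure lborel B \<le> emeasure \<mu> B"
    using mu_lower by blast
  show ?thesis
  proof (rule escape_rate_le[of "\<delta> * c"])
    fix t
    have "ennreal (\<delta> * c * exp (- \<gamma> * real t)) = ennreal \<delta> * ennreal (c * exp (- \<gamma> * real t))"
      using d(1) c(1) by (simp add: ennreal_mult'[symmetric] mult.assoc)
    also have "\<dots> \<le> ennreal \<delta> * emeasure lborel (survivors N (Suc t))" using c(2) by (rule mult_left_mono) simp
    also have "\<dots> \<le> emeasure \<mu> (survivors N (Suc t))"
      by (rule d(2)[OF survivors_borel]) (auto simp: survivors_def)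
    finally show "ennreal (\<delta> * c * exp (- \<gamma> * real t)) \<le> emeasure \<mu> {x \<in> {0..1}. \<forall>j<Suc t. (F ^^ j) x \<notin> {0..A N}}"
      unfolding survivors_def .
  qed (use c d in simp)
qed

lemma escape_ge:
  assumes N: "1 \<le> N" and u: "continuous_on {0..1} u" "0 < e" "\<And>x. x \<in> {0..1} \<Longrightarrow> e \<le> u x"
    and super: "\<And>x. x \<in> {0..1} \<Longrightarrow> wtransfer (letter_weight N \<gamma>) u x \<le> u x"
  shows "ereal \<gamma> \<le> escape_rate \<mu> F {0..A N}"
proof -
  obtain c where c: "0 < c" "\<And>t. emeasure lborel (survivors N (Suc t)) \<le> ennreal (c * exp (- \<gamma> * real t))"
    using survivors_upper[OF assms] by blast
  obtain M where M: "0 < M" "\<And>B. B \<in> sets borel \<Longrightarrow> B \<subseteq> {A N<..1} \<Longrightarrow> emeasure \<mu> B \<le> ennreal M * emeasure lborel B"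
    using mu_upper[OF N] by blast
  show ?thesis
  proof (rule escape_rate_ge[of "M * c"])
    fix t
    have "emeasure \<mu> (survivors N (Suc t)) \<le> ennreal M * emeasure lborel (survivors N (Suc t))"
      by (rule M(2)[OF survivors_borel survivors_Suc_sub])
    also have "\<dots> \<le> ennreal M * ennreal (c * exp (- \<gamma> * real t))" using c(2) by (rule mult_left_mono) simp
    also have "\<dots> = ennreal (M * c * exp (- \<gamma> * real t))"
      using M(1) c(1) by (simp add: ennreal_mult'[symmetric] mult.assoc)
    finally show "emeasure \<mu> {x \<in> {0..1}. \<forall>j<Suc t. (F ^^ j) x \<notin> {0..A N}} \<le> ennreal (M * c * exp (- \<gamma> * real t))"
      unfolding survivors_def .
  qed (use c M in simp)
qed

text \<open>Evaluates the two masses of \<open>perturbation\<close> for the weights with hole. For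
  \<gamma> \<ge> 0 the weights are at least 1 below \<open>N\<close> and 0 from \<open>N\<close> on,
  so the positive part of \<open>b - 1\<close> lives on \<open>j < N\<close> and the negative part
  on \<open>j \<ge> N\<close>, where the masses \<open>q j\<close> telescope.\<close>

lemma excess_sums:
  assumes g: "0 \<le> \<gamma>"
  defines "T \<equiv> \<lambda>n. integral {0..A n} h"
  shows "(\<lambda>j. max 0 (letter_weight N \<gamma> j - 1) * q j) sums excess T N \<gamma>"
    "(\<lambda>j. max 0 (1 - letter_weight N \<gamma> j) * q j) sums T N"
proof -
  have q: "q j = T j - T (Suc j)" for j using q_tail[of j] by (simp add: T_def)
  have w1: "1 \<le> letter_weight N \<gamma> j" if "j < N" for j using g that by (simp add: letter_weight_def)
  have w0: "letter_weight N \<gamma> j = 0" if "\<not> j < N" for j using that by (simp add: letter_weight_def)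
  have "(\<lambda>j. max 0 (letter_weight N \<gamma> j - 1) * q j) sums (\<Sum>j<N. max 0 (letter_weight N \<gamma> j - 1) * q j)"
    by (rule sums_finite) (auto simp: w0)
  also have "(\<Sum>j<N. max 0 (letter_weight N \<gamma> j - 1) * q j) = excess T N \<gamma>"
    unfolding excess_def using w1 by (intro sum.cong) (auto simp: q letter_weight_def)
  finally show "(\<lambda>j. max 0 (letter_weight N \<gamma> j - 1) * q j) sums excess T N \<gamma>" .
  have "(\<lambda>i. T (i + N)) \<longlonglongrightarrow> 0"
    unfolding T_def by (rule LIMSEQ_ignore_initial_segment[OF tail_integral_lim[OF h_cont]])
  then have "(\<lambda>i. T (i + N) - T (Suc i + N)) sums (T (0 + N) - 0)" by (rule telescope_sums')
  then have "(\<lambda>i. max 0 (1 - letter_weight N \<gamma> (i + N)) * q (i + N)) sums T N" by (simp add: q w0)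
  moreover have "(\<Sum>j<N. max 0 (1 - letter_weight N \<gamma> j) * q j) = 0" using w1 by (intro sum.neutral) auto
  ultimately show "(\<lambda>j. max 0 (1 - letter_weight N \<gamma> j) * q j) sums T N"
    using sums_iff_shift[of "\<lambda>j. max 0 (1 - letter_weight N \<gamma> j) * q j" N "T N"] by simp
qed

text \<open>For \<open>z > 1\<close> the gain eventually exceeds the loss, so there is a
  subsolution, which bounds the escape rate above by \<open>z * rate\<close>; for
  \<open>z < 1\<close> a supersolution bounds it below. Letting \<open>z\<close> approach 1 from
  both sides gives the limit.\<close>

theorem escape_asymptotics:
  assumes s: "0 < s" and asym: "(\<lambda>n. A n * real n powr (1 / s)) \<longlonglongrightarrow> k" "0 < k"
  shows "\<exists>d>0. (\<lambda>N. escape_rate \<mu> F {0..A N} / ereal (rate s d (A N))) \<longlonglongrightarrow> 1"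
proof -
  define T where "T n = integral {0..A n} h" for n
  have T: "T (Suc n) < T n" "0 < T n" for n
  proof -
    show *: "T (Suc n) < T n" for n using q_pos[of n] q_tail[of n] by (simp add: T_def)
    have "decseq T" using * by (intro decseq_SucI less_imp_le)
    moreover have "T \<longlonglongrightarrow> 0" unfolding T_def by (rule tail_integral_lim[OF h_cont])
    ultimately have "0 \<le> T (Suc n)" by (rule decseq_ge)
    then show "0 < T n" using *[of n] by linarith
  qed
  obtain d where d: "0 < d" "\<And>z. 0 < z \<Longrightarrow> \<exists>e. (\<lambda>N. excess T N (z * rate s d (A N)) / T N) \<longlonglongrightarrow> e \<and>
      (z < 1 \<longrightarrow> e < 1) \<and> (1 < z \<longrightarrow> 1 < e) \<and> 0 \<le> e"
    using excess_threshold[OF s T A_pos A_le_1 tail_asymp[folded T_def] h_0_pos asym] by blast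
  have rate_pos: "0 < rate s d (A N)" if "1 \<le> N" for N
  proof -
    have "A N < 1" using A_Suc_lt[of 0] A_mono[OF that] by simp
    then have "0 < A N / (- ln (A N))" using A_pos[of N] by (intro divide_pos_pos) simp_all
    then have "0 < d * (A N / (- ln (A N)))" using d(1) by (rule mult_pos_pos[rotated])
    then show ?thesis using d(1) A_pos[of N] by (simp add: rate_def)
  qed
  have key: "\<forall>\<^sub>F N in sequentially. (1 < z \<longrightarrow> escape_rate \<mu> F {0..A N} \<le> ereal (z * rate s d (A N))) \<and>
      (z < 1 \<longrightarrow> ereal (z * rate s d (A N)) \<le> escape_rate \<mu> F {0..A N})" if z: "0 < z" "z \<noteq> 1" for z
  proof -
    obtain e where e: "(\<lambda>N. excess T N (z * rate s d (A N)) / T N) \<longlonglongrightarrow> e"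
      "z < 1 \<Longrightarrow> e < 1" "1 < z \<Longrightarrow> 1 < e" "0 \<le> e" using d(2)[OF z(1)] by blast
    define E where "E N = excess T N (z * rate s d (A N)) / T N" for N
    have E: "E \<longlonglongrightarrow> e" using e(1) by (simp add: E_def[abs_def])
    have "(\<lambda>N. (E N - 1) / (E N + 1)) \<longlonglongrightarrow> (e - 1) / (e + 1)"
      using e(4) by (intro tendsto_intros E) auto
    \<comment> \<open>Half of the limit of \<open>\<bar>s - t\<bar> / (s + t)\<close>, which in
      terms of \<open>E\<close> is the modulus of \<open>(E N - 1) / (E N + 1)\<close>. Halving
      makes the required inequalities strict in the limit, hence true eventually.\<close>
    define \<epsilon> where "\<epsilon> = \<bar>e - 1\<bar> / (e + 1) / 2"
    have "e \<noteq> 1" using e z by force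
    then have eps: "0 < \<epsilon>" using e(4) by (simp add: \<epsilon>_def)
    obtain \<eta> where \<eta>: "0 < \<eta>" and pert: "\<And>b s t. Bseq b \<Longrightarrow> (\<And>j. 0 \<le> b j) \<Longrightarrow> (\<lambda>j. max 0 (b j - 1) * q j) sums s \<Longrightarrow>
       (\<lambda>j. max 0 (1 - b j) * q j) sums t \<Longrightarrow> s + t \<le> \<eta> \<Longrightarrow>
     \<exists>u e. 0 < e \<and> continuous_on {0..1} u \<and> (\<forall>x\<in>{0..1}. e \<le> u x) \<and>
       (\<epsilon> * (s + t) \<le> s - t \<longrightarrow> (\<forall>x\<in>{0..1}. u x \<le> wtransfer b u x)) \<and>
       (s - t \<le> - \<epsilon> * (s + t) \<longrightarrow> (\<forall>x\<in>{0..1}. wtransfer b u x \<le> u x))"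
      using perturbation[OF eps] by blast
    \<comment> \<open>The total perturbation \<open>s + t\<close> equals
      \<open>T N * (E N + 1)\<close> and tends to 0, so the smallness condition of
      \<open>perturbation\<close> is met eventually.\<close>
    have "(\<lambda>N. T N * (E N + 1)) \<longlonglongrightarrow> 0 * (e + 1)"
      unfolding T_def by (intro tendsto_intros E tail_integral_lim h_cont)
    then have "\<forall>\<^sub>F N in sequentially. T N * (E N + 1) < \<eta>" using \<eta> by (intro order_tendstoD) auto
    moreover have "\<forall>\<^sub>F N in sequentially. 1 < z \<longrightarrow> \<epsilon> < (E N - 1) / (E N + 1)"
    proof (cases "1 < z")
      case True
      have "0 < (e - 1) / (e + 1)" "\<epsilon> = (e - 1) / (e + 1) / 2" using e(3)[OF True] by (simp_all add: \<epsilon>_def)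
      moreover have "w / 2 < w" if "0 < w" for w :: real using that by simp
      ultimately have "\<epsilon> < (e - 1) / (e + 1)" by metis
      then have "\<forall>\<^sub>F N in sequentially. \<epsilon> < (E N - 1) / (E N + 1)"
        using \<open>(\<lambda>N. (E N - 1) / (E N + 1)) \<longlonglongrightarrow> (e - 1) / (e + 1)\<close> by (intro order_tendstoD)
      then show ?thesis by eventually_elim simp
    qed simp
    moreover have "\<forall>\<^sub>F N in sequentially. z < 1 \<longrightarrow> (E N - 1) / (E N + 1) < - \<epsilon>"
    proof (cases "z < 1")
      case True
      have "0 < (1 - e) / (e + 1)" "\<epsilon> = (1 - e) / (e + 1) / 2" using e(2)[OF True] e(4) by (simp_all add: \<epsilon>_def)
      moreover have "(e - 1) / (e + 1) = - ((1 - e) / (e + 1))" by (simp add: diff_divide_distrib)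
      moreover have "- w < - (w / 2)" if "0 < w" for w :: real using that by simp
      ultimately have "(e - 1) / (e + 1) < - \<epsilon>" by metis
      then have "\<forall>\<^sub>F N in sequentially. (E N - 1) / (E N + 1) < - \<epsilon>"
        using \<open>(\<lambda>N. (E N - 1) / (E N + 1)) \<longlonglongrightarrow> (e - 1) / (e + 1)\<close> by (intro order_tendstoD)
      then show ?thesis by eventually_elim simp
    qed simp
    moreover have "\<forall>\<^sub>F N in sequentially. - 1 < E N" using E e(4) by (intro order_tendstoD) auto
    ultimately show ?thesis using eventually_ge_at_top[of 1]
    proof eventually_elim
      case (elim N)
      let ?g = "z * rate s d (A N)" and ?t = "T N" and ?s = "T N * E N"
      have s: "?s = excess T N ?g" using T(2)[of N] by (simp add: E_def)
      have g0: "0 \<le> ?g" using z rate_pos[of N] elim by simp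
      have st: "?s + ?t \<le> \<eta>" using elim by (simp add: algebra_simps)
      have w0: "0 \<le> letter_weight N ?g j" for j by (simp add: letter_weight_def)
      obtain u e' where u: "0 < e'" "continuous_on {0..1} u" "\<forall>x\<in>{0..1}. e' \<le> u x"
         "\<epsilon> * (?s + ?t) \<le> ?s - ?t \<longrightarrow> (\<forall>x\<in>{0..1}. u x \<le> wtransfer (letter_weight N ?g) u x)"
         "?s - ?t \<le> - \<epsilon> * (?s + ?t) \<longrightarrow> (\<forall>x\<in>{0..1}. wtransfer (letter_weight N ?g) u x \<le> u x)"
        using pert[OF letter_weight_Bseq _ excess_sums[OF g0, of N, folded T_def, folded s] st] w0 by blast
      have "E N + 1 \<noteq> 0" using elim by linarith
      then have id1: "?s - ?t = T N * (E N + 1) * ((E N - 1) / (E N + 1))"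
        by (simp add: right_diff_distrib[of "T N" "E N" 1, simplified, symmetric])
      have id2: "\<epsilon> * (?s + ?t) = T N * (E N + 1) * \<epsilon>"
        "- \<epsilon> * (?s + ?t) = T N * (E N + 1) * (- \<epsilon>)"
        by (simp_all add: algebra_simps)
      note id = id1 id2
      have p: "0 \<le> T N * (E N + 1)" using T(2)[of N] elim by simp
      show ?case
      proof (intro conjI impI)
        assume "1 < z"
        then have "\<epsilon> * (?s + ?t) \<le> ?s - ?t" unfolding id using elim by (intro mult_left_mono p) auto
        then show "escape_rate \<mu> F {0..A N} \<le> ereal ?g" using u elim by (intro escape_le[of N u e']) auto
      next
        assume "z < 1"
        then have "?s - ?t \<le> - \<epsilon> * (?s + ?t)" unfolding id using elim by (intro mult_left_mono p) auto
        then show "ereal ?g \<le> escape_rate \<mu> F {0..A N}" using u elim by (intro escape_ge[of N u e']) auto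
      qed
    qed
  qed
  have "(\<lambda>N. escape_rate \<mu> F {0..A N} / ereal (rate s d (A N))) \<longlonglongrightarrow> 1"
  proof (rule order_tendstoI)
    fix a :: ereal assume "a < 1"
    then obtain z where z: "max a 0 < ereal z" "ereal z < 1" using ereal_dense2[of "max a 0" 1] by auto
    then have z': "0 < z" "z < 1" by auto
    then have "0 < z" "z \<noteq> 1" by auto
    from key[OF this] eventually_ge_at_top[of 1]
    show "\<forall>\<^sub>F N in sequentially. a < escape_rate \<mu> F {0..A N} / ereal (rate s d (A N))"
    proof eventually_elim
      case (elim N)
      note r = rate_pos[OF elim(2)]
      have "ereal z = ereal (z * rate s d (A N)) / ereal (rate s d (A N))" using r by simp
      also have "\<dots> \<le> escape_rate \<mu> F {0..A N} / ereal (rate s d (A N))"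
        using elim r z' by (intro ereal_divide_right_mono) auto
      finally show ?case using z(1) by (auto intro: less_le_trans)
    qed
  next
    fix a :: ereal assume "1 < a"
    then obtain z where z: "1 < ereal z" "ereal z < a" using ereal_dense2[of 1 a] by auto
    then have z': "1 < z" by auto
    then have "0 < z" "z \<noteq> 1" by auto
    from key[OF this] eventually_ge_at_top[of 1]
    show "\<forall>\<^sub>F N in sequentially. escape_rate \<mu> F {0..A N} / ereal (rate s d (A N)) < a"
    proof eventually_elim
      case (elim N)
      note r = rate_pos[OF elim(2)]
      have "escape_rate \<mu> F {0..A N} / ereal (rate s d (A N)) \<le> ereal (z * rate s d (A N)) / ereal (rate s d (A N))"
        using elim r z' by (intro ereal_divide_right_mono) auto
      also have "\<dots> = ereal z" using r by simp
      finally show ?case using z(2) by (auto intro: le_less_trans)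
    qed
  qed
  then show ?thesis using d(1) by blast
qed

end

section \<open>Admissible parabolic maps\<close>

locale admissible =
  fixes F :: "real \<Rightarrow> real" and a c s \<theta> :: real and r :: enat and \<mu> :: "real measure"
  assumes adm: "admissible_parabolic_map F a r c s \<theta> \<mu>"
begin

lemma a01: "0 < a" "a < 1" and F_maps: "F \<in> {0..1} \<rightarrow> {0..1}"
  and F_monotone: "mono_on (branch_dom a i) F \<or> antimono_on (branch_dom a i) F"
  and F_onto: "F ` {0..a} = {0..1}" and F_dense: "closure (F ` {a<..1}) = {0..1}"
  and F_0: "F 0 = 0" and c_pos: "0 < c" and s_pos: "0 < s"
  and deriv_asymp: "(\<lambda>x. branch_deriv F a x - 1) \<sim>[at_right 0] (\<lambda>x. c * x powr s)"
  and th: "0 < \<theta>" "\<theta> < 1"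
  using adm unfolding admissible_parabolic_map_def H1_def H3_def by (auto simp: branch_dom_def)

lemma F_in: "x \<in> {0..1} \<Longrightarrow> F x \<in> {0..1}"
  using F_maps by auto

text \<open>A decreasing branch starting at \<open>F 0 = 0\<close> could not reach 1.\<close>

lemma F_mono0: "0 \<le> x \<Longrightarrow> x \<le> y \<Longrightarrow> y \<le> a \<Longrightarrow> F x \<le> F y"
proof -
  assume xy: "0 \<le> x" "x \<le> y" "y \<le> a"
  from F_monotone[of False] show "F x \<le> F y"
  proof
    assume "mono_on (branch_dom a False) F"
    then show ?thesis using xy by (auto simp: branch_dom_def monotone_on_def)
  next
    assume anti: "antimono_on (branch_dom a False) F"
    have "1 \<in> F ` {0..a}" using F_onto by simp
    then obtain z where "z \<in> {0..a}" "F z = 1" by auto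
    moreover have "F z \<le> F 0" using anti \<open>z \<in> {0..a}\<close> a01 by (auto simp: branch_dom_def monotone_on_def)
    ultimately show ?thesis using F_0 by simp
  qed
qed

lemma F_a: "F a = 1"
proof -
  have "1 \<in> F ` {0..a}" using F_onto by simp
  then obtain z where "z \<in> {0..a}" "F z = 1" by auto
  then have "1 \<le> F a" using F_mono0[of z a] by auto
  then show ?thesis using F_in[of a] a01 by auto
qed

text \<open>(H2) does not constrain the values of \<open>F\<close> at 0 and \<open>a\<close>.
  Continuity there comes from (H1), since a monotone function onto an interval has no jumps.\<close>

lemma F_cont0: "continuous_on {0..a} F"
  unfolding continuous_on_iff
proof (intro ballI allI impI)
  fix x e :: real assume x: "x \<in> {0..a}" and e: "0 < e"
  have lo: "\<exists>d>0. \<forall>y\<in>{0..a}. x - d < y \<longrightarrow> F x - e < F y"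
  proof (cases "F x - e < 0")
    case True
    then show ?thesis using F_in a01 by (intro exI[of _ 1]) force
  next
    case False
    then have "F x - e / 2 \<in> F ` {0..a}" using F_onto F_in[of x] x a01 e by auto
    then obtain z where z: "z \<in> {0..a}" "F z = F x - e / 2" by auto
    then have "z < x" using F_mono0[of x z] x e by (cases "z < x") auto
    moreover have "F x - e < F y" if "y \<in> {0..a}" "x - (x - z) < y" for y
      using F_mono0[of z y] z that e by auto
    ultimately show ?thesis by (intro exI[of _ "x - z"]) auto
  qed
  have hi: "\<exists>d>0. \<forall>y\<in>{0..a}. y < x + d \<longrightarrow> F y < F x + e"
  proof (cases "1 < F x + e")
    case True
    then show ?thesis using F_in a01 by (intro exI[of _ 1]) force
  next
    case False
    then have "F x + e / 2 \<in> F ` {0..a}" using F_onto F_in[of x] x a01 e by auto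
    then obtain z where z: "z \<in> {0..a}" "F z = F x + e / 2" by auto
    then have "x < z" using F_mono0[of z x] x e by (cases "x < z") auto
    moreover have "F y < F x + e" if "y \<in> {0..a}" "y < x + (z - x)" for y
      using F_mono0[of y z] z that e by auto
    ultimately show ?thesis by (intro exI[of _ "z - x"]) auto
  qed
  obtain d1 where d1: "d1 > 0" "\<And>y. y \<in> {0..a} \<Longrightarrow> x - d1 < y \<Longrightarrow> F x - e < F y" using lo by blast
  obtain d2 where d2: "d2 > 0" "\<And>y. y \<in> {0..a} \<Longrightarrow> y < x + d2 \<Longrightarrow> F y < F x + e" using hi by blast
  show "\<exists>d>0. \<forall>x'\<in>{0..a}. dist x' x < d \<longrightarrow> dist (F x') (F x) < e"
  proof (intro exI[of _ "min d1 d2"] conjI ballI impI)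
    fix y assume "y \<in> {0..a}" "dist y x < min d1 d2"
    then show "dist (F y) (F x) < e" using d1(2)[of y] d2(2)[of y] by (auto simp: dist_real_def abs_less_iff)
  qed (use d1 d2 in auto)
qed

lemma Cr_on_deriv:
  assumes "Cr_on r f S" "1 \<le> r"
  obtains f' where "\<And>x. x \<in> S \<Longrightarrow> (f has_real_derivative f' x) (at x within S)" "continuous_on S f'" "continuous_on S f"
proof -
  obtain D where D: "\<And>x. x \<in> S \<Longrightarrow> D 0 x = f x"
    "\<And>i x. enat i < r \<Longrightarrow> x \<in> S \<Longrightarrow> (D i has_real_derivative D (Suc i) x) (at x within S)"
    "\<And>i. enat i \<le> r \<Longrightarrow> continuous_on S (D i)"
    using assms(1) unfolding Cr_on_def by blast
  have r: "enat 0 < r" "enat 1 \<le> r" "enat 0 \<le> r"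
    using assms(2) by (cases r; simp add: one_enat_def)+
  show thesis
  proof (rule that[of "D 1"])
    show "(f has_real_derivative D 1 x) (at x within S)" if "x \<in> S" for x
      by (rule has_field_derivative_transform_within[of "D 0" _ _ _ 1]) (use D(1) D(2)[OF r(1) that] that in auto)
    show "continuous_on S f" using D(3)[OF r(3)] D(1) continuous_on_cong by metis
  qed (rule D(3)[OF r(2)])
qed

lemma r_ge_1: "1 \<le> r" and ext0: "Cr_extends r F {0<..<a} {0<..a}" and ext1: "Cr_extends r F {a<..<1} {a..1}"
  using adm unfolding admissible_parabolic_map_def H2_def by auto

lemma left_branch:
  obtains f' where "continuous_on {0<..a} f'" "\<And>x. 0 < x \<Longrightarrow> x < a \<Longrightarrow> (F has_real_derivative f' x) (at x)"
proof -
  obtain g where g: "Cr_on r g {0<..a}" "\<And>x. x \<in> {0<..<a} \<Longrightarrow> g x = F x" using ext0 unfolding Cr_extends_def by blast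
  obtain f' where f': "\<And>x. x \<in> {0<..a} \<Longrightarrow> (g has_real_derivative f' x) (at x within {0<..a})" "continuous_on {0<..a} f'"
    using Cr_on_deriv[OF g(1) r_ge_1] by blast
  have "(F has_real_derivative f' x) (at x)" if "0 < x" "x < a" for x
  proof -
    have "(g has_real_derivative f' x) (at x within {0<..<a})"
      by (rule DERIV_subset[OF f'(1)]) (use that in auto)
    then have "(F has_real_derivative f' x) (at x within {0<..<a})"
      by (rule has_field_derivative_transform_within[where d = 1]) (use that g(2) in auto)
    then show ?thesis using that at_within_open[of x "{0<..<a}"] by simp
  qed
  then show thesis using f'(2) that by blast
qed

text \<open>The extension in (H2) is tied to \<open>F\<close> on the open interval only. Its
  agreement with \<open>F\<close> at 1 has to be derived: by monotonicity a jump there would leave a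
  gap in the image, against density in \<open>[0,1]\<close>.\<close>

lemma right_branch:
  obtains g f' where "continuous_on {a..1} g" "continuous_on {a..1} f'" "\<And>x. a < x \<Longrightarrow> x \<le> 1 \<Longrightarrow> g x = F x"
    "\<And>x. a < x \<Longrightarrow> x < 1 \<Longrightarrow> (F has_real_derivative f' x) (at x)"
    "\<And>x. a < x \<Longrightarrow> x < 1 \<Longrightarrow> (g has_real_derivative f' x) (at x)"
    "g ` {a..1} = {0..1}"
proof -
  obtain g where g: "Cr_on r g {a..1}" "\<And>x. x \<in> {a<..<1} \<Longrightarrow> g x = F x" using ext1 unfolding Cr_extends_def by blast
  obtain f' where f': "\<And>x. x \<in> {a..1} \<Longrightarrow> (g has_real_derivative f' x) (at x within {a..1})" "continuous_on {a..1} f'"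
    "continuous_on {a..1} g"
    using Cr_on_deriv[OF g(1) r_ge_1] by blast
  have gd: "(g has_real_derivative f' x) (at x)" if "a < x" "x < 1" for x
  proof -
    have "(g has_real_derivative f' x) (at x within {a<..<1})"
      by (rule DERIV_subset[OF f'(1)]) (use that in auto)
    then show ?thesis using that at_within_open[of x "{a<..<1}"] by simp
  qed
  have Fd: "(F has_real_derivative f' x) (at x)" if "a < x" "x < 1" for x
    by (rule has_field_derivative_transform_within_open[OF gd[OF that], of "{a<..<1}"]) (use that g(2) in auto)
  have glim: "(g \<longlongrightarrow> g 1) (at_left 1)"
  proof -
    have "(g \<longlongrightarrow> g 1) (at 1 within {a..1})" using f'(3) a01 by (auto simp: continuous_on_def)
    then show ?thesis using a01 by (simp add: at_within_Icc_at_left)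
  qed
  have ev: "\<forall>\<^sub>F x in at_left 1. a < x \<and> x < 1"
    using a01 by (auto simp: eventually_at_left_field)
  have gF: "(F \<longlongrightarrow> g 1) (at_left 1)"
    using glim by (rule Lim_transform_eventually) (use ev g(2) in \<open>auto elim!: eventually_mono\<close>)
  have cl: "{0..1} \<subseteq> T" if "closed T" "F ` {a<..1} \<subseteq> T" for T
    using closure_minimal[OF that(2,1)] F_dense by simp
  have F1: "F 1 \<in> {0..1}" using F_in by simp
  have g1: "0 \<le> g 1" "g 1 \<le> 1"
  proof -
    have "\<forall>\<^sub>F x in at_left 1. 0 \<le> F x \<and> F x \<le> 1" using ev by eventually_elim (use F_in a01 in force)
    then have "\<forall>\<^sub>F x in at_left 1. 0 \<le> F x" "\<forall>\<^sub>F x in at_left 1. F x \<le> 1" by (auto elim!: eventually_mono)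
    then show "0 \<le> g 1" "g 1 \<le> 1"
      using tendsto_lowerbound[OF gF] tendsto_upperbound[OF gF] by auto
  qed
  have "g 1 = F 1"
    using F_monotone[of True]
  proof
    assume m: "mono_on (branch_dom a True) F"
    have mono: "F x \<le> F y" if "a < x" "x \<le> y" "y \<le> 1" for x y
      using m that by (auto simp: branch_dom_def monotone_on_def)
    have le: "F x \<le> g 1" if "a < x" "x < 1" for x
    proof (rule tendsto_lowerbound[OF gF])
      show "\<forall>\<^sub>F y in at_left 1. F x \<le> F y"
        using that mono by (auto simp: eventually_at_left_field intro!: exI[of _ x])
    qed simp
    have "g 1 \<le> F 1"
    proof (rule tendsto_upperbound[OF gF])
      show "\<forall>\<^sub>F y in at_left 1. F y \<le> F 1" using ev by eventually_elim (use mono in auto)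
    qed simp
    moreover have sub: "{0..1} \<subseteq> {..g 1} \<union> {F 1}"
    proof (rule cl)
      show "F ` {a<..1} \<subseteq> {..g 1} \<union> {F 1}"
      proof
        fix y assume "y \<in> F ` {a<..1}"
        then obtain x where "a < x" "x \<le> 1" "y = F x" by auto
        then show "y \<in> {..g 1} \<union> {F 1}" using le[of x] by (cases "x = 1") auto
      qed
    qed auto
    \<comment> \<open>The midpoint lies in a closed set containing the whole image. If
      \<open>g 1\<close> and \<open>F 1\<close> differed, it would be larger than \<open>g 1\<close>
      and distinct from \<open>F 1\<close>.\<close>
    moreover have "(g 1 + F 1) / 2 \<in> {0..1}" using g1 F1 by auto
    then have "(g 1 + F 1) / 2 \<in> {..g 1} \<union> {F 1}" using sub by (rule subsetD[rotated])
    ultimately show ?thesis by (auto simp: field_simps)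
  next
    assume m: "antimono_on (branch_dom a True) F"
    have mono: "F y \<le> F x" if "a < x" "x \<le> y" "y \<le> 1" for x y
      using m that by (auto simp: branch_dom_def monotone_on_def)
    have le: "g 1 \<le> F x" if "a < x" "x < 1" for x
    proof (rule tendsto_upperbound[OF gF])
      show "\<forall>\<^sub>F y in at_left 1. F y \<le> F x"
        using that mono by (auto simp: eventually_at_left_field intro!: exI[of _ x])
    qed simp
    have "F 1 \<le> g 1"
    proof (rule tendsto_lowerbound[OF gF])
      show "\<forall>\<^sub>F y in at_left 1. F 1 \<le> F y" using ev by eventually_elim (use mono in auto)
    qed simp
    moreover have sub: "{0..1} \<subseteq> {g 1..} \<union> {F 1}"
    proof (rule cl)
      show "F ` {a<..1} \<subseteq> {g 1..} \<union> {F 1}"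
      proof
        fix y assume "y \<in> F ` {a<..1}"
        then obtain x where "a < x" "x \<le> 1" "y = F x" by auto
        then show "y \<in> {g 1..} \<union> {F 1}" using le[of x] by (cases "x = 1") auto
      qed
    qed auto
    moreover have "(g 1 + F 1) / 2 \<in> {0..1}" using g1 F1 by auto
    then have "(g 1 + F 1) / 2 \<in> {g 1..} \<union> {F 1}" using sub by (rule subsetD[rotated])
    ultimately show ?thesis by (auto simp: field_simps)
  qed
  then have eq: "g x = F x" if "a < x" "x \<le> 1" for x using that g(2) by (cases "x = 1") auto
  have img: "F ` {a<..1} = g ` {a<..1}" using eq by force
  have "{0..1} \<subseteq> g ` {a..1}"
    by (rule cl) (auto simp: img intro!: compact_imp_closed compact_continuous_image f'(3))
  moreover have "g ` {a..1} \<subseteq> {0..1}"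
  proof -
    have "g ` closure {a<..1} \<subseteq> closure (g ` {a<..1})"
      by (rule image_closure_subset[OF _ closed_closure closure_subset]) (use f'(3) a01 in simp)
    then show ?thesis using F_dense img a01 by simp
  qed
  ultimately have "g ` {a..1} = {0..1}" by blast
  then show thesis using that[OF f'(3,2) eq Fd gd] by blast
qed

definition f0' where "f0' = (SOME f'. continuous_on {0<..a} f' \<and> (\<forall>x. 0 < x \<longrightarrow> x < a \<longrightarrow> (F has_real_derivative f' x) (at x)))"

lemma f0': "continuous_on {0<..a} f0'" "0 < x \<Longrightarrow> x < a \<Longrightarrow> (F has_real_derivative f0' x) (at x)"
proof -
  have "\<exists>f'. continuous_on {0<..a} f' \<and> (\<forall>x. 0 < x \<longrightarrow> x < a \<longrightarrow> (F has_real_derivative f' x) (at x))"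
    using left_branch by metis
  from someI_ex[OF this] show "continuous_on {0<..a} f0'" "0 < x \<Longrightarrow> x < a \<Longrightarrow> (F has_real_derivative f0' x) (at x)"
    unfolding f0'_def by auto
qed

text \<open>Extension and derivative are bundled into a pair, so that a single choice makes them
  belong together.\<close>

definition right_ext :: "(real \<Rightarrow> real) \<times> (real \<Rightarrow> real) \<Rightarrow> bool" where
  "right_ext p \<longleftrightarrow> continuous_on {a..1} (fst p) \<and> continuous_on {a..1} (snd p) \<and> (\<forall>x. a < x \<longrightarrow> x \<le> 1 \<longrightarrow> fst p x = F x) \<and>
    (\<forall>x. a < x \<longrightarrow> x < 1 \<longrightarrow> (F has_real_derivative snd p x) (at x) \<and> (fst p has_real_derivative snd p x) (at x)) \<and>
    fst p ` {a..1} = {0..1}"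

definition "g1 = fst (SOME p. right_ext p)"
definition "f1' = snd (SOME p. right_ext p)"

lemma g1: "continuous_on {a..1} g1" "continuous_on {a..1} f1'" "a < x \<Longrightarrow> x \<le> 1 \<Longrightarrow> g1 x = F x"
    "a < x \<Longrightarrow> x < 1 \<Longrightarrow> (F has_real_derivative f1' x) (at x)"
    "a < x \<Longrightarrow> x < 1 \<Longrightarrow> (g1 has_real_derivative f1' x) (at x)"
    "g1 ` {a..1} = {0..1}"
proof -
  have "\<exists>p. right_ext p"
  proof -
    obtain g f' where "continuous_on {a..1} g" "continuous_on {a..1} f'" "\<And>x. a < x \<Longrightarrow> x \<le> 1 \<Longrightarrow> g x = F x"
    "\<And>x. a < x \<Longrightarrow> x < 1 \<Longrightarrow> (F has_real_derivative f' x) (at x)"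
    "\<And>x. a < x \<Longrightarrow> x < 1 \<Longrightarrow> (g has_real_derivative f' x) (at x)"
    "g ` {a..1} = {0..1}" using right_branch by blast
    then have "right_ext (g, f')" unfolding right_ext_def by auto
    then show ?thesis ..
  qed
  then have "right_ext (SOME p. right_ext p)" by (rule someI_ex)
  then show "continuous_on {a..1} g1" "continuous_on {a..1} f1'" "a < x \<Longrightarrow> x \<le> 1 \<Longrightarrow> g1 x = F x"
    "a < x \<Longrightarrow> x < 1 \<Longrightarrow> (F has_real_derivative f1' x) (at x)"
    "a < x \<Longrightarrow> x < 1 \<Longrightarrow> (g1 has_real_derivative f1' x) (at x)"
    "g1 ` {a..1} = {0..1}" unfolding right_ext_def g1_def f1'_def by auto
qed

definition Fd where "Fd x = (if x < a then f0' x else f1' x)"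

lemma F_deriv: "0 < x \<Longrightarrow> x < 1 \<Longrightarrow> x \<noteq> a \<Longrightarrow> (F has_real_derivative Fd x) (at x)"
  using f0'(2)[of x] g1(4)[of x] by (auto simp: Fd_def)

lemma branch_deriv_eq:
  assumes "0 < x" "x < 1" "x \<noteq> a" shows "branch_deriv F a x = Fd x"
proof -
  have "x \<in> interior (branch_dom a (a < x))"
  proof (cases "a < x")
    case True
    then have "{a<..<1} \<subseteq> interior (branch_dom a (a < x))"
      by (intro interior_maximal) (auto simp: branch_dom_def)
    then show ?thesis using True assms by auto
  next
    case False
    then have "{0<..<a} \<subseteq> interior (branch_dom a (a < x))"
      by (intro interior_maximal) (auto simp: branch_dom_def)
    then show ?thesis using False assms by auto
  qed
  then have "branch_deriv F a x = vector_derivative F (at x)"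
    unfolding branch_deriv_def by (simp only: at_within_interior)
  also have "\<dots> = Fd x"
    using F_deriv[OF assms] by (intro vector_derivative_at) (simp add: has_real_derivative_iff_has_vector_derivative)
  finally show ?thesis .
qed

lemma Fd_asymp: "((\<lambda>x. (Fd x - 1) / (c * x powr s)) \<longlongrightarrow> 1) (at_right 0)"
proof -
  have "((\<lambda>x. (branch_deriv F a x - 1) / (c * x powr s)) \<longlongrightarrow> 1) (at_right 0)"
    using deriv_asymp by (rule asymp_equivD_strong)
      (use c_pos in \<open>auto simp: eventually_at_right_field intro!: exI[of _ 1]\<close>)
  moreover have "\<forall>\<^sub>F x in at_right 0. (branch_deriv F a x - 1) / (c * x powr s) = (Fd x - 1) / (c * x powr s)"
    using a01 branch_deriv_eq by (auto simp: eventually_at_right_field intro!: exI[of _ a])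
  ultimately show ?thesis by (rule Lim_transform_eventually)
qed

lemma Fd_gt_1_near_0: "\<forall>\<^sub>F x in at_right 0. 1 < Fd x"
proof -
  have "\<forall>\<^sub>F x in at_right 0. 0 < (Fd x - 1) / (c * x powr s)" using Fd_asymp by (intro order_tendstoD) auto
  moreover have "\<forall>\<^sub>F x in at_right 0. 0 < (x :: real)" by (auto simp: eventually_at_right_field intro!: exI[of _ 1])
  ultimately show ?thesis
  proof eventually_elim
    case (elim x)
    then have "0 < c * x powr s" using c_pos by simp
    then show ?case using elim by (simp add: zero_less_divide_iff)
  qed
qed

text \<open>(H4) bounds the derivative away from 1 only above \<epsilon>. Below \<epsilon>,
  monotonicity of the derivative carries its value at one point \<open>x1\<close>, chosen to the
  left of \<delta> and so close to 0 that (H3) makes this value exceed 1.\<close>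

lemma uniform_expansion:
  assumes "0 < \<delta>"
  obtains \<beta> where "1 < \<beta>" "\<And>x. \<delta> \<le> x \<Longrightarrow> x < 1 \<Longrightarrow> x \<noteq> a \<Longrightarrow> \<beta> \<le> \<bar>Fd x\<bar>"
proof -
  obtain \<epsilon> \<beta> where h4: "0 < \<epsilon>" "1 < \<beta>" "mono_on ({0<..<\<epsilon>} \<inter> {0..1}) (branch_deriv F a)"
    "\<And>x. x \<in> {\<epsilon>..1} \<Longrightarrow> \<beta> \<le> \<bar>branch_deriv F a x\<bar>"
    using adm unfolding admissible_parabolic_map_def H4_def by blast
  obtain b where b: "0 < b" "\<And>x. 0 < x \<Longrightarrow> x < b \<Longrightarrow> 1 < Fd x"
    using Fd_gt_1_near_0 by (auto simp: eventually_at_right_field)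
  define x1 where "x1 = min (min b \<delta>) (min \<epsilon> a) / 2"
  have x1: "0 < x1" "x1 < b" "x1 < \<delta>" "x1 < \<epsilon>" "x1 < a" using b h4 assms a01 by (auto simp: x1_def min_def)
  have x1': "1 < Fd x1" using b(2) x1 by auto
  show thesis
  proof (rule that[of "min \<beta> (Fd x1)"])
    fix x assume x: "\<delta> \<le> x" "x < 1" "x \<noteq> a"
    show "min \<beta> (Fd x1) \<le> \<bar>Fd x\<bar>"
    proof (cases "x < \<epsilon>")
      case True
      have "branch_deriv F a x1 \<le> branch_deriv F a x"
        using h4(3) by (rule mono_onD) (use x x1 True a01 in auto)
      then have "Fd x1 \<le> Fd x" using branch_deriv_eq x x1 a01 by auto
      then show ?thesis by linarith
    next
      case False
      then have "\<beta> \<le> \<bar>Fd x\<bar>" using h4(4)[of x] branch_deriv_eq[of x] x x1 by auto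
      then show ?thesis by linarith
    qed
  qed (use h4 x1' in auto)
qed

lemma Fd_gt_1:
  assumes "0 < x" "x < 1" "x \<noteq> a" shows "1 < \<bar>Fd x\<bar>"
proof -
  obtain \<beta> where "1 < \<beta>" "\<And>y. x \<le> y \<Longrightarrow> y < 1 \<Longrightarrow> y \<noteq> a \<Longrightarrow> \<beta> \<le> \<bar>Fd y\<bar>"
    using uniform_expansion[OF assms(1)] by blast
  then show ?thesis using assms by force
qed

lemma Fd_pos_left: "0 < x \<Longrightarrow> x < a \<Longrightarrow> 1 < Fd x"
proof -
  assume x: "0 < x" "x < a"
  have "0 \<le> Fd x"
  proof (rule ccontr)
    assume "\<not> 0 \<le> Fd x"
    then obtain d where d: "0 < d" "\<And>h. 0 < h \<Longrightarrow> h < d \<Longrightarrow> F (x + h) < F x"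
      using DERIV_neg_dec_right[OF F_deriv[of x]] x a01 by auto
    define h where "h = min d (a - x) / 2"
    have "0 < h" "h < d" "x + h \<le> a" using d(1) x by (auto simp: h_def min_def field_simps)
    then show False using d(2)[of h] F_mono0[of x "x + h"] x by auto
  qed
  then show "1 < Fd x" using Fd_gt_1[of x] x a01 by auto
qed

end

section \<open>Waiting times of binary strings\<close>

lemma shift_funpow: "(shift ^^ i) \<omega> = (\<lambda>n. \<omega> (n + i))"
  by (induction i) (auto simp: shift_def)

lemma Omega0_iff: "\<omega> \<in> Omega0 \<longleftrightarrow> infinite {i. \<omega> i}"
proof -
  have "\<omega> \<in> Omega0 \<longleftrightarrow> (\<forall>i. \<exists>n. \<omega> (n + i))"
    unfolding Omega0_def by (auto simp: shift_funpow fun_eq_iff)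
  also have "\<dots> \<longleftrightarrow> (\<forall>i. \<exists>n\<ge>i. \<omega> n)"
    by (metis le_add2 le_add_diff_inverse2)
  also have "\<dots> \<longleftrightarrow> infinite {i. \<omega> i}" by (simp add: infinite_nat_iff_unbounded_le)
  finally show ?thesis .
qed

text \<open>Replaces the recursive infima by the library's \<open>enumerate\<close>, from which
  monotonicity and range of the waiting times follow.\<close>

lemma tau_enumerate:
  assumes "infinite {i. \<omega> i}" shows "tau \<omega> k = Suc (enumerate {i. \<omega> i} k)"
proof (induction k)
  case 0 then show ?case by (simp add: Inf_nat_def enumerate_0)
next
  case (Suc k)
  have "tau \<omega> (Suc k) = Suc (LEAST s. s \<in> {i. \<omega> i} \<and> enumerate {i. \<omega> i} k < s)"
    using Suc by (simp add: Inf_nat_def Suc_le_eq conj_commute)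
  then show ?case by (simp only: enumerate_Suc''[OF assms])
qed

lemma tau_less:
  assumes "\<omega> \<in> Omega0" shows "tau \<omega> k < tau \<omega> (Suc k)"
  using assms enumerate_step[of "{i. \<omega> i}" k] by (simp add: Omega0_iff tau_enumerate del: tau.simps)

lemma tau_range:
  assumes "\<omega> \<in> Omega0" shows "\<omega> i \<longleftrightarrow> (\<exists>k. tau \<omega> k = Suc i)"
proof
  show "\<exists>k. tau \<omega> k = Suc i" if "\<omega> i"
    using enumerate_Ex[of "{i. \<omega> i}" i] that assms by (auto simp: Omega0_iff tau_enumerate)
  show "\<omega> i" if "\<exists>k. tau \<omega> k = Suc i"
    using enumerate_in_set[of "{i. \<omega> i}"] that assms by (auto simp: Omega0_iff tau_enumerate)
qed

lemma iota_inj: "inj_on iota Omega0"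
proof (rule inj_onI)
  fix \<omega> \<omega>' assume o: "\<omega> \<in> Omega0" "\<omega>' \<in> Omega0" and e: "iota \<omega> = iota \<omega>'"
  have "tau \<omega> k = tau \<omega>' k" for k
  proof (induction k)
    case 0 then show ?case using fun_cong[OF e, of 0] by (simp add: iota_def)
  next
    case (Suc k)
    have "tau \<omega> (Suc k) - tau \<omega> k = tau \<omega>' (Suc k) - tau \<omega>' k"
      using fun_cong[OF e, of "Suc k"] by (simp add: iota_def del: tau.simps)
    then show ?case using Suc tau_less[OF o(1), of k] tau_less[OF o(2), of k] by linarith
  qed
  then show "\<omega> = \<omega>'" using tau_range[OF o(1)] tau_range[OF o(2)] by auto
qed

lemma iota_in_Sigma: "\<omega> \<in> Omega0 \<Longrightarrow> iota \<omega> \<in> Sigma_space"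
  unfolding Sigma_space_def
proof (intro CollectI allI)
  fix k assume "\<omega> \<in> Omega0"
  then show "1 \<le> iota \<omega> k" using tau_less[of \<omega>] by (cases k) (auto simp: iota_def Suc_le_eq simp del: tau.simps(2))
qed

lemma Inf_nat_shift:
  assumes "(X :: nat set) \<noteq> {}" shows "Inf ((\<lambda>i. i + m) ` X) = Inf X + m"
proof (rule cInf_eq_minimum)
  show "Inf X + m \<in> (\<lambda>i. i + m) ` X" using Inf_nat_def1[OF assms] by blast
  show "Inf X + m \<le> x" if "x \<in> (\<lambda>i. i + m) ` X" for x using that by (auto intro: cInf_lower)
qed

text \<open>The hypotheses say that \<omega>' consists of \<open>k\<close> zeros, a one and then
  \<omega>, the form an itinerary takes after one inverse branch. Every later infimum is therefore
  taken over a translated set.\<close>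

lemma tau_cons:
  assumes o: "\<omega> \<in> Omega0" and w: "\<And>i. i < k \<Longrightarrow> \<not> \<omega>' i" "\<omega>' k" "\<And>i. \<omega>' (Suc k + i) = \<omega> i"
  shows "tau \<omega>' 0 = Suc k" "tau \<omega>' (Suc m) = tau \<omega> m + Suc k"
proof -
  have inf: "infinite {i. \<omega> i}" using o by (simp add: Omega0_iff)
  have ne: "{i. t \<le> i \<and> \<omega> i} \<noteq> {}" for t
    using inf by (auto simp: infinite_nat_iff_unbounded_le)
  have w3: "\<omega>' i \<longleftrightarrow> \<omega> (i - Suc k)" if "Suc k \<le> i" for i using w(3)[of "i - Suc k"] that by simp
  have "Inf {i. \<omega>' i} = k"
    by (rule cInf_eq_minimum) (use w in \<open>auto simp: not_less[symmetric]\<close>)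
  then show t0: "tau \<omega>' 0 = Suc k" by simp
  have set: "{i. t + Suc k \<le> i \<and> \<omega>' i} = (\<lambda>i. i + Suc k) ` {i. t \<le> i \<and> \<omega> i}" for t
  proof (intro equalityI subsetI)
    fix i assume "i \<in> {i. t + Suc k \<le> i \<and> \<omega>' i}"
    then have "i = (i - Suc k) + Suc k" "i - Suc k \<in> {i. t \<le> i \<and> \<omega> i}" using w3[of i] by auto
    then show "i \<in> (\<lambda>i. i + Suc k) ` {i. t \<le> i \<and> \<omega> i}" by (rule image_eqI)
  next
    fix i assume "i \<in> (\<lambda>i. i + Suc k) ` {i. t \<le> i \<and> \<omega> i}"
    then show "i \<in> {i. t + Suc k \<le> i \<and> \<omega>' i}" using w3 by auto
  qed
  show "tau \<omega>' (Suc m) = tau \<omega> m + Suc k"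
  proof (induction m)
    case 0
    have "tau \<omega>' (Suc 0) = 1 + Inf {i. 0 + Suc k \<le> i \<and> \<omega>' i}" by (simp only: tau.simps(2) t0 add_0)
    then show ?case unfolding set Inf_nat_shift[OF ne] by simp
  next
    case (Suc m)
    have "tau \<omega>' (Suc (Suc m)) = 1 + Inf {i. tau \<omega> m + Suc k \<le> i \<and> \<omega>' i}"
      unfolding Suc[symmetric] by simp
    then show ?case unfolding set Inf_nat_shift[OF ne] by simp
  qed
qed

lemma iota_cons:
  assumes o: "\<omega> \<in> Omega0" and w: "\<And>i. i < k \<Longrightarrow> \<not> \<omega>' i" "\<omega>' k" "\<And>i. \<omega>' (Suc k + i) = \<omega> i"
  shows "iota \<omega>' 0 = Suc k" "iota \<omega>' (Suc j) = iota \<omega> j"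
  unfolding iota_def using tau_cons[OF assms] by (simp_all split: nat.split del: tau.simps)

section \<open>Inverse branches of an admissible map\<close>

context admissible begin

definition "\<phi>0 = local_inv F a False"
text \<open>Inverse of the continuous extension \<open>g1\<close>, so that continuity and endpoint
  values are immediate. \<open>local_inv_True\<close> identifies it with the local inverse on the
  open interval, where the potential is evaluated.\<close>

definition "\<phi>1 = the_inv_into {a..1} g1"
definition "orient = (if mono_on (branch_dom a True) F then 1 else - 1 :: real)"
definition "d0 y = 1 / f0' (\<phi>0 y)"
definition "d1 y = orient / f1' (\<phi>1 y)"

lemma F_strict0:
  assumes "0 \<le> x" "x < y" "y \<le> a" shows "F x < F y"
proof (rule DERIV_pos_imp_increasing_open[OF assms(2)])
  show "continuous_on {x..y} F" by (rule continuous_on_subset[OF F_cont0]) (use assms in auto)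
  fix t assume "x < t" "t < y"
  then show "\<exists>z. (F has_real_derivative z) (at t) \<and> 0 < z"
    using F_deriv[of t] Fd_pos_left[of t] assms a01 by (intro exI[of _ "Fd t"]) auto
qed

text \<open>At \<open>a\<close> the function \<open>f0'\<close> is known only through continuity
  from the left, hence the passage to a closure.\<close>

lemma f0'_ge: "0 < x \<Longrightarrow> x \<le> a \<Longrightarrow> 1 \<le> f0' x"
proof -
  assume x: "0 < x" "x \<le> a"
  have cl: "closure {x/2<..<a} = {x/2..a}" using x by simp
  show ?thesis
  proof (rule continuous_ge_on_closure[where S = "{x/2<..<a}" and f = f0' and x = x and a = 1])
    show "continuous_on (closure {x/2<..<a}) f0'"
      unfolding cl by (rule continuous_on_subset[OF f0'(1)]) (use x in auto)
    show "x \<in> closure {x/2<..<a}" unfolding cl using x by simp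
    show "1 \<le> f0' t" if "t \<in> {x/2<..<a}" for t
      using Fd_pos_left[of t] that x by (simp add: Fd_def)
  qed
qed

lemma orient_Fd: "a < x \<Longrightarrow> x < 1 \<Longrightarrow> 1 < orient * Fd x"
proof -
  assume x: "a < x" "x < 1"
  have "0 \<le> orient * Fd x"
  proof (cases "mono_on (branch_dom a True) F")
    case True
    then have m: "F x \<le> F y" if "a < x" "x \<le> y" "y \<le> 1" for x y
      using that by (auto simp: branch_dom_def monotone_on_def)
    have "0 \<le> Fd x"
    proof (rule ccontr)
      assume "\<not> 0 \<le> Fd x"
      then obtain d where d: "0 < d" "\<And>h. 0 < h \<Longrightarrow> h < d \<Longrightarrow> F (x + h) < F x"
        using DERIV_neg_dec_right[OF F_deriv[of x]] x a01 by auto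
      define h where "h = min d (1 - x) / 2"
      have "0 < h" "h < d" "x + h \<le> 1" using d(1) x by (auto simp: h_def min_def field_simps)
      then show False using d(2)[of h] m[of x "x + h"] x by auto
    qed
    then show ?thesis using True by (simp add: orient_def)
  next
    case False
    then have m: "F y \<le> F x" if "a < x" "x \<le> y" "y \<le> 1" for x y
      using that F_monotone[of True] by (auto simp: branch_dom_def monotone_on_def)
    have "Fd x \<le> 0"
    proof (rule ccontr)
      assume "\<not> Fd x \<le> 0"
      then obtain d where d: "0 < d" "\<And>h. 0 < h \<Longrightarrow> h < d \<Longrightarrow> F x < F (x + h)"
        using DERIV_pos_inc_right[OF F_deriv[of x]] x a01 by auto
      define h where "h = min d (1 - x) / 2"
      have "0 < h" "h < d" "x + h \<le> 1" using d(1) x by (auto simp: h_def min_def field_simps)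
      then show False using d(2)[of h] m[of x "x + h"] x by auto
    qed
    then show ?thesis using False by (simp add: orient_def)
  qed
  moreover have "\<bar>orient * Fd x\<bar> = \<bar>Fd x\<bar>" by (simp add: orient_def abs_mult)
  ultimately show ?thesis using Fd_gt_1[of x] x a01 by auto
qed

lemma orient_cases: "orient = 1 \<or> orient = - 1" by (simp add: orient_def)

lemma orient_f1'_ge:
  assumes "a \<le> x" "x \<le> 1" shows "1 \<le> orient * f1' x"
proof (rule continuous_ge_on_closure[where S = "{a<..<1}" and f = "\<lambda>x. orient * f1' x" and x = x and a = 1])
  show "continuous_on (closure {a<..<1}) (\<lambda>x. orient * f1' x)"
    using a01 g1(2) by (auto intro!: continuous_intros)
  show "x \<in> closure {a<..<1}" using assms a01 by simp
  show "1 \<le> orient * f1' t" if "t \<in> {a<..<1}" for t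
    using orient_Fd[of t] that by (simp add: Fd_def)
qed

lemma g1_strict:
  assumes "a \<le> x" "x < y" "y \<le> 1"
  shows "orient * g1 x < orient * g1 y"
proof (rule DERIV_pos_imp_increasing_open[OF assms(2)])
  show "continuous_on {x..y} (\<lambda>x. orient * g1 x)"
    by (intro continuous_intros continuous_on_subset[OF g1(1)]) (use assms in auto)
  fix t assume t: "x < t" "t < y"
  then have "((\<lambda>x. orient * g1 x) has_real_derivative orient * f1' t) (at t)"
    using g1(5)[of t] assms by (intro DERIV_cmult) auto
  then show "\<exists>z. ((\<lambda>x. orient * g1 x) has_real_derivative z) (at t) \<and> 0 < z"
    using orient_f1'_ge[of t] t assms by (intro exI[of _ "orient * f1' t"]) auto
qed

lemma g1_inj: "inj_on g1 {a..1}"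
proof (rule inj_onI)
  fix x y assume "x \<in> {a..1}" "y \<in> {a..1}" "g1 x = g1 y"
  then show "x = y" using g1_strict[of x y] g1_strict[of y x] by (cases x y rule: linorder_cases) auto
qed

lemma g1_ends: "orient = 1 \<and> g1 a = 0 \<and> g1 1 = 1 \<or> orient = - 1 \<and> g1 a = 1 \<and> g1 1 = 0"
proof -
  have "0 \<in> g1 ` {a..1}" "1 \<in> g1 ` {a..1}" using g1(6) by auto
  then obtain x y where x: "x \<in> {a..1}" "g1 x = 0" and y: "y \<in> {a..1}" "g1 y = 1" by auto
  have r: "g1 a \<in> {0..1}" "g1 1 \<in> {0..1}" using g1(6) a01 by auto
  from orient_cases show ?thesis
  proof
    assume s: "orient = 1"
    then have "x = a" using g1_strict[of a x] x r by (cases "x = a") auto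
    moreover have "y = 1" using s g1_strict[of y 1] y r by (cases "y = 1") auto
    ultimately show ?thesis using s x y by auto
  next
    assume s: "orient = - 1"
    then have "x = 1" using g1_strict[of x 1] x r by (cases "x = 1") auto
    moreover have "y = a" using s g1_strict[of a y] y r by (cases "y = a") auto
    ultimately show ?thesis using s x y by auto
  qed
qed

lemma F_inj0: "inj_on F {0..a}"
proof (rule inj_onI)
  fix x y assume "x \<in> {0..a}" "y \<in> {0..a}" "F x = F y"
  then show "x = y" using F_strict0[of x y] F_strict0[of y x] by (cases x y rule: linorder_cases) auto
qed

lemma phi0_inv: "y \<in> {0..1} \<Longrightarrow> \<phi>0 y = the_inv_into {0..a} F y"
  using F_onto by (simp add: \<phi>0_def local_inv_def branch_dom_def Let_def)

lemma phi0_in: "y \<in> {0..1} \<Longrightarrow> \<phi>0 y \<in> {0..a}" and F_phi0: "y \<in> {0..1} \<Longrightarrow> F (\<phi>0 y) = y"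
  and phi0_F: "x \<in> {0..a} \<Longrightarrow> \<phi>0 (F x) = x"
proof -
  show "\<phi>0 y \<in> {0..a}" if "y \<in> {0..1}"
    using the_inv_into_into[OF F_inj0 _ order_refl, of y] that F_onto phi0_inv by simp
  show "F (\<phi>0 y) = y" if "y \<in> {0..1}"
    using f_the_inv_into_f[OF F_inj0, of y] that F_onto phi0_inv by simp
  show "\<phi>0 (F x) = x" if "x \<in> {0..a}"
    using the_inv_into_f_f[OF F_inj0 that] F_in[of x] that a01 phi0_inv[of "F x"] by auto
qed

lemma phi1_in: "y \<in> {0..1} \<Longrightarrow> \<phi>1 y \<in> {a..1}" and g1_phi1: "y \<in> {0..1} \<Longrightarrow> g1 (\<phi>1 y) = y"
  and phi1_g1: "x \<in> {a..1} \<Longrightarrow> \<phi>1 (g1 x) = x"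
  unfolding \<phi>1_def using the_inv_into_into[OF g1_inj _ order_refl, of y] f_the_inv_into_f[OF g1_inj, of y]
    the_inv_into_f_f[OF g1_inj, of x] g1(6) by simp_all

lemma phi1_open: "0 < y \<Longrightarrow> y < 1 \<Longrightarrow> a < \<phi>1 y \<and> \<phi>1 y < 1"
proof -
  assume y: "0 < y" "y < 1"
  then have "\<phi>1 y \<in> {a..1}" "g1 (\<phi>1 y) = y" using phi1_in[of y] g1_phi1[of y] by auto
  then show ?thesis using g1_ends y by (cases "\<phi>1 y = a"; cases "\<phi>1 y = 1") auto
qed

lemma F_phi1: "0 < y \<Longrightarrow> y < 1 \<Longrightarrow> F (\<phi>1 y) = y"
  using phi1_open[of y] g1_phi1[of y] g1(3)[of "\<phi>1 y"] by auto

lemma F_inj1: "inj_on F {a<..1}"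
proof (rule inj_onI)
  fix x z assume "x \<in> {a<..1}" "z \<in> {a<..1}" "F x = F z"
  then show "x = z" using inj_onD[OF g1_inj, of x z] g1(3) by auto
qed

lemma local_inv_True: "0 < y \<Longrightarrow> y < 1 \<Longrightarrow> local_inv F a True y = \<phi>1 y"
proof -
  assume y: "0 < y" "y < 1"
  have m: "\<phi>1 y \<in> {a<..1}" "F (\<phi>1 y) = y" using phi1_open[OF y] F_phi1[OF y] by auto
  then have "y \<in> F ` {a<..1}" by force
  moreover have "the_inv_into {a<..1} F y = \<phi>1 y" using the_inv_into_f_f[OF F_inj1 m(1)] m(2) by simp
  ultimately show ?thesis by (simp add: local_inv_def branch_dom_def Let_def)
qed

lemma phi0_cont: "continuous_on {0..1} \<phi>0"
  using continuous_on_inv[OF F_cont0 compact_Icc, of \<phi>0] phi0_F F_onto by simp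

lemma phi1_cont: "continuous_on {0..1} \<phi>1"
  using continuous_on_inv[OF g1(1) compact_Icc, of \<phi>1] phi1_g1 g1(6) by simp

lemma phi0_strict: "x \<in> {0..1} \<Longrightarrow> y \<in> {0..1} \<Longrightarrow> x < y \<Longrightarrow> \<phi>0 x < \<phi>0 y"
  using phi0_in[of x] phi0_in[of y] F_phi0[of x] F_phi0[of y] F_mono0[of "\<phi>0 y" "\<phi>0 x"]
  by (cases "\<phi>0 x < \<phi>0 y") auto

lemma phi0_0: "\<phi>0 0 = 0" and phi0_1: "\<phi>0 1 = a"
  using phi0_F[of 0] phi0_F[of a] F_0 F_a a01 by auto

lemma F_gt: "0 < x \<Longrightarrow> x \<le> a \<Longrightarrow> x < F x"
proof -
  assume x: "0 < x" "x \<le> a"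
  have "continuous_on {0..x} F" by (rule continuous_on_subset[OF F_cont0]) (use x in auto)
  moreover have "F differentiable (at t)" if "0 < t" "t < x" for t
    using F_deriv[of t] that x a01 by (auto simp: real_differentiable_def)
  ultimately obtain z l where z: "0 < z" "z < x" "(F has_real_derivative l) (at z)" "F x - F 0 = (x - 0) * l"
    using MVT[OF x(1)] by blast
  then have "l = Fd z" using F_deriv[of z] x a01 by (intro DERIV_unique[OF z(3)]) auto
  then have "1 < l" using Fd_pos_left[of z] z x by auto
  then have "x * 1 < x * l" using x by (intro mult_strict_left_mono) auto
  then show ?thesis using z(4) F_0 by simp
qed

lemma phi0_lt: "0 < y \<Longrightarrow> y \<le> 1 \<Longrightarrow> \<phi>0 y < y"
  using F_gt[of "\<phi>0 y"] phi0_in[of y] F_phi0[of y] phi0_strict[of 0 y] phi0_0 by auto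

lemma phi0_open: "0 < y \<Longrightarrow> y < 1 \<Longrightarrow> 0 < \<phi>0 y \<and> \<phi>0 y < a"
  using phi0_strict[of 0 y] phi0_strict[of y 1] phi0_0 phi0_1 by auto

lemma phi0_deriv: "0 < y \<Longrightarrow> y < 1 \<Longrightarrow> (\<phi>0 has_real_derivative d0 y) (at y)"
proof -
  assume y: "0 < y" "y < 1"
  have o: "0 < \<phi>0 y" "\<phi>0 y < a" using phi0_open[OF y] by auto
  have "(\<phi>0 has_real_derivative inverse (f0' (\<phi>0 y))) (at y)"
  proof (rule DERIV_inverse_function[where a = 0 and b = 1])
    show "(F has_real_derivative f0' (\<phi>0 y)) (at (\<phi>0 y))" by (rule f0'(2)[OF o])
    show "f0' (\<phi>0 y) \<noteq> 0" using f0'_ge[of "\<phi>0 y"] o by auto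
    show "F (\<phi>0 z) = z" if "0 < z" "z < 1" for z using F_phi0[of z] that by simp
    show "isCont \<phi>0 y" using continuous_on_interior[OF phi0_cont, of y] y by simp
  qed (use y in auto)
  then show ?thesis by (simp add: d0_def inverse_eq_divide)
qed

lemma phi1_deriv: "0 < y \<Longrightarrow> y < 1 \<Longrightarrow> (\<phi>1 has_real_derivative orient * d1 y) (at y)"
proof -
  assume y: "0 < y" "y < 1"
  have o: "a < \<phi>1 y" "\<phi>1 y < 1" using phi1_open[OF y] by auto
  have "(\<phi>1 has_real_derivative inverse (f1' (\<phi>1 y))) (at y)"
  proof (rule DERIV_inverse_function[where a = 0 and b = 1])
    show "(F has_real_derivative f1' (\<phi>1 y)) (at (\<phi>1 y))" by (rule g1(4)[OF o])
    show "f1' (\<phi>1 y) \<noteq> 0" using orient_f1'_ge[of "\<phi>1 y"] o by auto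
    show "F (\<phi>1 z) = z" if "0 < z" "z < 1" for z using F_phi1[of z] that by simp
    show "isCont \<phi>1 y" using continuous_on_interior[OF phi1_cont, of y] y by simp
  qed (use y in auto)
  moreover have "orient * d1 y = inverse (f1' (\<phi>1 y))"
    using orient_cases by (auto simp: d1_def inverse_eq_divide)
  ultimately show ?thesis by simp
qed

lemma d0_positive: "0 < y \<Longrightarrow> y \<le> 1 \<Longrightarrow> 0 < d0 y"
  using f0'_ge[of "\<phi>0 y"] phi0_strict[of 0 y] phi0_0 phi0_in[of y] by (auto simp: d0_def)

lemma d1_positive: "0 \<le> y \<Longrightarrow> y \<le> 1 \<Longrightarrow> 0 < d1 y"
proof -
  assume "0 \<le> y" "y \<le> 1"
  then have "0 < orient * f1' (\<phi>1 y)" using orient_f1'_ge[of "\<phi>1 y"] phi1_in[of y] by auto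
  then show "0 < d1 y" using orient_cases by (auto simp: d1_def zero_less_divide_iff)
qed

sublocale br: branch_pair F \<phi>0 \<phi>1 d0 d1 a orient
proof
  show "continuous_on {0<..1} d0"
  proof -
    have m: "0 < \<phi>0 y \<and> \<phi>0 y \<le> a" if "0 < y" "y \<le> 1" for y
      using phi0_strict[of 0 y] phi0_in[of y] phi0_0 that by simp
    have "continuous_on {0<..1} (\<lambda>y. f0' (\<phi>0 y))"
      by (rule continuous_on_compose2[OF f0'(1) continuous_on_subset[OF phi0_cont]]) (use m in auto)
    moreover have "f0' (\<phi>0 y) \<noteq> 0" if "y \<in> {0<..1}" for y
      using f0'_ge[of "\<phi>0 y"] m[of y] that by simp
    ultimately show ?thesis unfolding d0_def[abs_def] by (intro continuous_intros) auto
  qed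
  show "continuous_on {0..1} d1"
  proof -
    have "continuous_on {0..1} (\<lambda>y. f1' (\<phi>1 y))"
      by (rule continuous_on_compose2[OF g1(2) phi1_cont]) (use phi1_in in auto)
    moreover have "f1' (\<phi>1 y) \<noteq> 0" if "y \<in> {0..1}" for y
      using orient_f1'_ge[of "\<phi>1 y"] phi1_in[OF that] by auto
    ultimately show ?thesis unfolding d1_def[abs_def] by (intro continuous_intros) auto
  qed
  show "strict_mono_on {0..1} \<phi>0" using phi0_strict by (auto simp: strict_mono_on_def)
  show "orient = 1 \<and> \<phi>1 0 = a \<and> \<phi>1 1 = 1 \<or> orient = - 1 \<and> \<phi>1 0 = 1 \<and> \<phi>1 1 = a"
    using g1_ends phi1_g1[of a] phi1_g1[of 1] a01 by auto
qed (use a01 phi0_cont phi0_0 phi0_1 phi0_lt d0_positive phi0_deriv phi1_cont d1_positive phi1_deriv F_in F_phi0 F_phi1 in auto)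

lemma a_seq_eq: "a_seq F a n = (\<phi>0 ^^ n) 1"
proof (induction n rule: less_induct)
  case (less n)
  show ?case
  proof (cases "n = 0 \<or> n = 1")
    case True then show ?thesis by (auto simp: phi0_1)
  next
    case False
    then obtain m where n: "n = Suc (Suc m)" by (cases n; cases "n - 1") auto
    show ?thesis unfolding n a_seq.simps using less[of "Suc m"] n by (simp add: \<phi>0_def)
  qed
qed

text \<open>(H3) is integrated by l'Hopital's rule: the exponent \<open>s\<close> of the derivative
  becomes \<open>s + 1\<close> for \<open>F x - x\<close>, and the constant is divided by
  \<open>s + 1\<close>.\<close>

lemma a_seq_asymp: "(\<lambda>n. (\<phi>0 ^^ n) 1 * real n powr (1 / s)) \<longlonglongrightarrow> (s * (c / (s + 1))) powr (- 1 / s)"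
proof (rule backward_orbit_asymp[where f = F])
  show "0 < (\<phi>0 ^^ n) 1" for n using br.iter_pos[of 1 n] by simp
  show "(\<lambda>n. (\<phi>0 ^^ n) 1) \<longlonglongrightarrow> 0" by (rule br.A_tendsto_0)
  show "F ((\<phi>0 ^^ Suc n) 1) = (\<phi>0 ^^ n) 1" for n using F_phi0[OF br.iter_unit[of 1 n]] by simp
  show "((\<lambda>x. (F x - x) / x powr (s + 1)) \<longlongrightarrow> c / (s + 1)) (at_right 0)"
  proof (rule lhopital_right_0[where f' = "\<lambda>x. Fd x - 1" and g' = "\<lambda>x. (s + 1) * x powr s"])
    have ev: "\<forall>\<^sub>F x in at_right 0. 0 < x \<and> x < a"
      using a01 by (auto simp: eventually_at_right_field intro!: exI[of _ a])
    have "(F \<longlongrightarrow> F 0) (at 0 within {0..a})" using F_cont0 a01 by (auto simp: continuous_on_def)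
    then have "(F \<longlongrightarrow> 0) (at_right 0)" using a01 F_0 by (simp add: at_within_Icc_at_right)
    then show "((\<lambda>x. F x - x) \<longlongrightarrow> 0) (at_right 0)" by (rule tendsto_eq_intros) (auto intro!: tendsto_eq_intros)
    show "((\<lambda>x. x powr (s + 1)) \<longlongrightarrow> 0) (at_right 0)" using s_pos by real_asymp
    show "\<forall>\<^sub>F x in at_right 0. x powr (s + 1) \<noteq> 0" using ev by eventually_elim auto
    show "\<forall>\<^sub>F x in at_right 0. (s + 1) * x powr s \<noteq> 0" using ev s_pos by (auto elim!: eventually_mono)
    show "\<forall>\<^sub>F x in at_right 0. ((\<lambda>x. F x - x) has_real_derivative Fd x - 1) (at x)"
      using ev by eventually_elim (use F_deriv a01 in \<open>auto intro!: derivative_eq_intros\<close>)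
    show "\<forall>\<^sub>F x in at_right 0. ((\<lambda>x. x powr (s + 1)) has_real_derivative (s + 1) * x powr s) (at x)"
      using ev by eventually_elim (auto intro!: derivative_eq_intros)
    have quot: "X / (c * p) * (c / t) = X / (t * p)" if "c \<noteq> 0" for X c p t :: real
      using that by (cases "p = 0"; cases "t = 0") (auto simp: field_simps)
    have "((\<lambda>x. (Fd x - 1) / (c * x powr s) * (c / (s + 1))) \<longlongrightarrow> 1 * (c / (s + 1))) (at_right 0)"
      by (intro tendsto_intros Fd_asymp)
    moreover have "\<forall>\<^sub>F x in at_right 0. (Fd x - 1) / (c * x powr s) * (c / (s + 1)) = (Fd x - 1) / ((s + 1) * x powr s)"
      using ev by eventually_elim (rule quot, use c_pos in simp)
    ultimately have "((\<lambda>x. (Fd x - 1) / ((s + 1) * x powr s)) \<longlongrightarrow> 1 * (c / (s + 1))) (at_right 0)"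
      by (rule Lim_transform_eventually)
    then show "((\<lambda>x. (Fd x - 1) / ((s + 1) * x powr s)) \<longlongrightarrow> c / (s + 1)) (at_right 0)"
      by (simp only: mult_1)
  qed
qed (use s_pos c_pos in auto)

text \<open>Near 0 the derivative comes arbitrarily close to 1, so expansion is uniform only for
  intervals of length at least \<delta>: their upper half lies above \<open>\<delta> / 2\<close>,
  where the derivative is at least \<beta> in modulus, and their lower half does not shrink.\<close>

lemma expansion:
  assumes "0 < \<delta>"
  obtains \<eta> where "0 < \<eta>"
    "\<And>u v. 0 \<le> u \<and> v \<le> a \<or> a < u \<and> v \<le> 1 \<Longrightarrow> \<delta> \<le> v - u \<Longrightarrow> (1 + \<eta>) * (v - u) \<le> \<bar>F v - F u\<bar>"
proof -
  obtain \<beta> where b: "1 < \<beta>" "\<And>x. \<delta> / 2 \<le> x \<Longrightarrow> x < 1 \<Longrightarrow> x \<noteq> a \<Longrightarrow> \<beta> \<le> \<bar>Fd x\<bar>"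
    using uniform_expansion[of "\<delta> / 2"] assms by auto
  \<comment> \<open>The two halves have equal length, so the factor is the average of 1 and
    \<beta>.\<close>
  show thesis
  proof (rule that[of "(\<beta> - 1) / 2"])
    fix u v assume uv: "0 \<le> u \<and> v \<le> a \<or> a < u \<and> v \<le> 1" and d: "\<delta> \<le> v - u"
    define k where "k = (if a < u then orient else 1)"
    have k1: "k = 1 \<or> k = - 1" using orient_cases by (auto simp: k_def)
    have inner: "0 < t \<and> t < 1 \<and> t \<noteq> a" "1 < k * Fd t" if "u < t" "t < v" for t
      using that uv a01 orient_Fd[of t] Fd_pos_left[of t] by (auto simp: k_def)
    have cont: "continuous_on {u..v} F"
    proof (cases "a < u")
      case True
      have "continuous_on {u..v} g1" by (rule continuous_on_subset[OF g1(1)]) (use uv True a01 in auto)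
      moreover have "g1 x = F x" if "x \<in> {u..v}" for x using g1(3)[of x] that True uv a01 by auto
      ultimately show ?thesis by (rule continuous_on_eq)
    next
      case False
      then show ?thesis using uv by (intro continuous_on_subset[OF F_cont0]) auto
    qed
    have mvt: "\<exists>z. x < z \<and> z < y \<and> F y - F x = (y - x) * Fd z" if xy: "u \<le> x" "x < y" "y \<le> v" for x y
    proof -
      have "continuous_on {x..y} F" by (rule continuous_on_subset[OF cont]) (use xy in auto)
      moreover have "F differentiable (at t)" if "x < t" "t < y" for t
        using F_deriv[of t] inner[of t] that xy by (auto simp: real_differentiable_def)
      ultimately obtain z l where z: "x < z" "z < y" "(F has_real_derivative l) (at z)" "F y - F x = (y - x) * l"
        using MVT[OF xy(2)] by blast
      then have "l = Fd z" using F_deriv[of z] inner[of z] xy by (intro DERIV_unique[OF z(3)]) auto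
      then show ?thesis using z by blast
    qed
    define m where "m = (u + v) / 2"
    have m: "u < m" "m < v" "m - u = (v - u) / 2" "v - m = (v - u) / 2" "\<delta> / 2 \<le> m"
      using d assms uv a01 by (auto simp: m_def field_simps)
    obtain z1 where z1: "u < z1" "z1 < m" "F m - F u = (m - u) * Fd z1" using mvt[of u m] m by auto
    obtain z2 where z2: "m < z2" "z2 < v" "F v - F m = (v - m) * Fd z2" using mvt[of m v] m by auto
    have "1 \<le> k * Fd z1" using inner(2)[of z1] z1 m by simp
    then have "(m - u) * 1 \<le> (m - u) * (k * Fd z1)" using m by (intro mult_left_mono) auto
    moreover have "\<beta> \<le> k * Fd z2"
      using b(2)[of z2] inner[of z2] z2 m k1 by auto
    then have "(v - m) * \<beta> \<le> (v - m) * (k * Fd z2)" using m by (intro mult_left_mono) auto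
    moreover have "k * (F v - F u) = (m - u) * (k * Fd z1) + (v - m) * (k * Fd z2)"
    proof -
      have "F v - F u = (m - u) * Fd z1 + (v - m) * Fd z2" using z1(3) z2(3) by linarith
      then show ?thesis by (simp add: distrib_left mult_ac)
    qed
    ultimately have "(v - u) / 2 + (v - u) / 2 * \<beta> \<le> k * (F v - F u)" unfolding m(3,4) by linarith
    moreover have "k * (F v - F u) \<le> \<bar>F v - F u\<bar>" using k1 by auto
    moreover have "(1 + (\<beta> - 1) / 2) * (v - u) = (v - u) / 2 + (v - u) / 2 * \<beta>" by (simp add: field_simps)
    ultimately show "(1 + (\<beta> - 1) / 2) * (v - u) \<le> \<bar>F v - F u\<bar>" by linarith
  qed (use b in auto)
qed

section \<open>Itineraries, the potential and distortion\<close>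

lemma iterate_in: "x \<in> {0..1} \<Longrightarrow> (F ^^ i) x \<in> {0..1}"
proof (induction i)
  case (Suc i) then show ?case using F_in[of "(F ^^ i) x"] by simp
qed simp

text \<open>The distance of two points with a common itinerary never falls below its initial value,
  so one expansion factor \<open>1 + \<eta>\<close> serves at all times, and the distance would
  outgrow the unit interval.\<close>

lemma codes_unique:
  assumes x: "codes F a \<omega> x" and y: "codes F a \<omega> y" shows "x = y"
proof (rule ccontr)
  assume ne: "x \<noteq> y"
  define L where "L i = \<bar>(F ^^ i) x - (F ^^ i) y\<bar>" for i
  have L0: "0 < L 0" using ne by (simp add: L_def)
  obtain \<eta> where eta: "0 < \<eta>"
    "\<And>u v. 0 \<le> u \<and> v \<le> a \<or> a < u \<and> v \<le> 1 \<Longrightarrow> L 0 \<le> v - u \<Longrightarrow> (1 + \<eta>) * (v - u) \<le> \<bar>F v - F u\<bar>"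
    using expansion[OF L0] by blast
  have grow: "(1 + \<eta>) ^ i * L 0 \<le> L i" for i
  proof (induction i)
    case (Suc i)
    have "1 * L 0 \<le> (1 + \<eta>) ^ i * L 0" using eta(1) L0 by (intro mult_right_mono one_le_power) auto
    then have Li: "L 0 \<le> L i" using Suc by linarith
    define X Y where "X = (F ^^ i) x" and "Y = (F ^^ i) y"
    have XY: "X \<in> branch_dom a (\<omega> i)" "Y \<in> branch_dom a (\<omega> i)" using x y by (auto simp: codes_def X_def Y_def)
    have "(1 + \<eta>) * \<bar>X - Y\<bar> \<le> \<bar>F X - F Y\<bar>"
    proof (cases "X \<le> Y")
      case True
      then show ?thesis using eta(2)[of X Y] XY Li by (auto simp: branch_dom_def L_def X_def Y_def abs_minus_commute split: if_splits)
    next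
      case False
      then show ?thesis using eta(2)[of Y X] XY Li by (auto simp: branch_dom_def L_def X_def Y_def split: if_splits)
    qed
    then have "(1 + \<eta>) * L i \<le> L (Suc i)" by (simp add: L_def X_def Y_def)
    moreover have "(1 + \<eta>) * ((1 + \<eta>) ^ i * L 0) \<le> (1 + \<eta>) * L i" using Suc eta(1) by (intro mult_left_mono) auto
    ultimately show ?case by (simp add: mult.assoc)
  qed simp
  obtain n where "1 / L 0 < (1 + \<eta>) ^ n" using real_arch_pow[of "1 + \<eta>" "1 / L 0"] eta(1) by auto
  then have "1 < (1 + \<eta>) ^ n * L 0" using L0 by (simp add: field_simps)
  moreover have "L n \<le> 1" using iterate_in[of x n] iterate_in[of y n] x y by (auto simp: L_def codes_def)
  ultimately show False using grow[of n] by linarith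
qed

definition itinerary :: "real \<Rightarrow> nat \<Rightarrow> bool" where "itinerary x i \<longleftrightarrow> a < (F ^^ i) x"

lemma codes_itinerary: "x \<in> {0..1} \<Longrightarrow> codes F a (itinerary x) x"
  unfolding codes_def itinerary_def using iterate_in[of x] by (auto simp: branch_dom_def)

lemma coding_itinerary:
  assumes "x \<in> {0..1}" shows "coding F a (itinerary x) = x"
proof -
  have "(THE z. codes F a (itinerary x) z) = x"
    using codes_itinerary[OF assms] codes_unique by (intro the_equality) auto
  moreover have "\<exists>z. codes F a (itinerary x) z" using codes_itinerary[OF assms] by blast
  ultimately show ?thesis by (simp add: coding_def Let_def)
qed

lemma shift_itinerary: "(shift ^^ i) (itinerary x) = itinerary ((F ^^ i) x)"
  by (auto simp: shift_funpow itinerary_def funpow_add fun_eq_iff)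

lemma vector_derivative_unit:
  assumes "(f has_real_derivative d) (at y)" "0 < y" "y < 1"
  shows "vector_derivative f (at y within {0..1}) = d"
proof -
  have "y \<in> interior {0..1}" using assms by simp
  then have "at y within {0..1} = at y" by (rule at_within_interior)
  then show ?thesis
    using assms(1) vector_derivative_at by (simp add: has_real_derivative_iff_has_vector_derivative)
qed

lemma V_phi0:
  assumes y: "0 < y" "y < 1" shows "V_pot F a (itinerary (\<phi>0 y)) = ln (d0 y)"
proof -
  have 1: "\<not> itinerary (\<phi>0 y) 0" using phi0_open[OF y] by (simp add: itinerary_def)
  have "F (\<phi>0 y) = y" using F_phi0[of y] y by simp
  then have 2: "coding F a (shift (itinerary (\<phi>0 y))) = y"
    using shift_itinerary[of 1 "\<phi>0 y"] coding_itinerary[of y] y by simp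
  have "vector_derivative \<phi>0 (at y within {0..1}) = d0 y" by (rule vector_derivative_unit[OF phi0_deriv[OF y] y])
  then show ?thesis using 1 2 d0_positive[of y] y by (simp add: V_pot_def \<phi>0_def)
qed

lemma V_phi1:
  assumes y: "0 < y" "y < 1" shows "V_pot F a (itinerary (\<phi>1 y)) = ln (d1 y)"
proof -
  have 1: "itinerary (\<phi>1 y) 0" using phi1_open[OF y] by (simp add: itinerary_def)
  have "F (\<phi>1 y) = y" by (rule F_phi1[OF y])
  then have 2: "coding F a (shift (itinerary (\<phi>1 y))) = y"
    using shift_itinerary[of 1 "\<phi>1 y"] coding_itinerary[of y] y by simp
  have "(local_inv F a True has_real_derivative orient * d1 y) (at y)"
    by (rule has_field_derivative_transform_within_open[OF phi1_deriv[OF y], of "{0<..<1}"])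
      (use y local_inv_True in auto)
  then have "vector_derivative (local_inv F a True) (at y within {0..1}) = orient * d1 y"
    by (rule vector_derivative_unit[OF _ y])
  then show ?thesis using 1 2 d1_positive[of y] y orient_cases by (auto simp: V_pot_def abs_mult)
qed

text \<open>
  At the points of \<open>good\<close> the itinerary lies in \<^const>\<open>Omega0\<close> and all derivatives involved are
  two-sided, so that (W1) can be read off; it extends to \<open>[0,1]\<close> by density.
\<close>

definition good :: "real set" where "good = {y. 0 < y \<and> y < 1 \<and> (\<forall>i. (F ^^ i) y \<noteq> 0)}"

lemma good_preimage: "y \<in> good \<Longrightarrow> 0 < x \<Longrightarrow> x < 1 \<Longrightarrow> F x = y \<Longrightarrow> x \<in> good"
  unfolding good_def
proof (intro CollectI conjI allI)
  fix i assume "y \<in> {y. 0 < y \<and> y < 1 \<and> (\<forall>i. (F ^^ i) y \<noteq> 0)}" "0 < x" "F x = y"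
  then show "(F ^^ i) x \<noteq> 0" by (cases i) (auto simp: funpow_Suc_right simp del: funpow.simps(2))
qed

lemma good_phi0: "y \<in> good \<Longrightarrow> \<phi>0 y \<in> good"
  using good_preimage[of y "\<phi>0 y"] phi0_open[of y] F_phi0[of y] a01 by (auto simp: good_def)

lemma good_phi1: "y \<in> good \<Longrightarrow> \<phi>1 y \<in> good"
  using good_preimage[of y "\<phi>1 y"] phi1_open[of y] F_phi1[of y] a01 by (auto simp: good_def)

lemma good_Psi: "y \<in> good \<Longrightarrow> br.\<Psi> j y \<in> good"
  unfolding ret_branch_def by (induction j) (auto intro: good_phi0 good_phi1)

lemma good_word: "y \<in> good \<Longrightarrow> foldr br.\<Psi> w y \<in> good"
  by (induction w) (auto intro: good_Psi)

lemma good_unit: "y \<in> good \<Longrightarrow> 0 < y \<and> y < 1"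
  by (simp add: good_def)

text \<open>If the itinerary ended in zeros, the orbit would eventually increase inside
  \<open>(0, a]\<close> towards a fixed point, but \<open>F x > x\<close> there.\<close>

lemma good_Omega0:
  assumes y: "y \<in> good" shows "itinerary y \<in> Omega0"
proof (rule ccontr)
  assume "itinerary y \<notin> Omega0"
  then have "finite {i. itinerary y i}" by (simp add: Omega0_iff)
  then obtain n where "\<forall>i\<in>{i. itinerary y i}. i < n"
    using finite_nat_set_iff_bounded by blast
  then have n: "\<not> itinerary y i" if "n \<le> i" for i using that by auto
  define z where "z i = (F ^^ (i + n)) y" for i
  have z: "0 < z i \<and> z i \<le> a" for i
    using n[of "i + n"] iterate_in[of y "i + n"] y by (auto simp: z_def itinerary_def good_def less_le)
  have zS: "z (Suc i) = F (z i)" for i by (simp add: z_def)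
  have inc: "incseq z" using F_gt z by (intro incseq_SucI) (simp add: zS less_imp_le)
  then obtain L where L: "z \<longlonglongrightarrow> L" using incseq_convergent[of z a] z by blast
  have "z 0 \<le> L" using inc L by (rule incseq_le)
  then have L0: "0 < L" using z[of 0] by linarith
  have La: "L \<le> a" by (rule LIMSEQ_le_const2[OF L]) (use z in auto)
  have "(\<lambda>i. F (z i)) \<longlonglongrightarrow> F L"
    by (rule continuous_on_tendsto_compose[OF F_cont0 L]) (use L0 La z in \<open>auto simp: less_imp_le\<close>)
  moreover have "(\<lambda>i. F (z i)) \<longlonglongrightarrow> L" using LIMSEQ_Suc[OF L] by (simp add: zS)
  ultimately have "F L = L" using LIMSEQ_unique by blast
  then show False using F_gt[OF L0 La] by simp
qed

lemma itinerary_Suc: "itinerary x (Suc i) = itinerary (F x) i"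
  by (simp add: itinerary_def funpow_swap1)

lemma Psi_open: "0 < y \<Longrightarrow> y < 1 \<Longrightarrow> 0 < br.\<Psi> k y \<and> br.\<Psi> k y < 1"
  using br.Psi_range_open[of y k] br.iter_unit[of 1 k] br.iter_unit[of 1 "Suc k"] by (auto simp del: funpow.simps)

lemma Psi_Suc: "br.\<Psi> (Suc k) y = \<phi>0 (br.\<Psi> k y)" and Psi_0: "br.\<Psi> 0 y = \<phi>1 y"
  by (simp_all add: ret_branch_def)

lemma itinerary_Psi:
  assumes y: "0 < y" "y < 1"
  shows "(\<forall>i<k. \<not> itinerary (br.\<Psi> k y) i) \<and> itinerary (br.\<Psi> k y) k \<and> (\<forall>i. itinerary (br.\<Psi> k y) (Suc k + i) = itinerary y i)"
proof (induction k)
  case 0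
  show ?case using phi1_open[OF y] F_phi1[OF y] by (simp add: Psi_0 itinerary_Suc) (simp add: itinerary_def)
next
  case (Suc k)
  have o: "0 < br.\<Psi> k y" "br.\<Psi> k y < 1" using Psi_open[OF y] by auto
  have "F (\<phi>0 (br.\<Psi> k y)) = br.\<Psi> k y" using F_phi0[of "br.\<Psi> k y"] o by simp
  then have S: "itinerary (br.\<Psi> (Suc k) y) (Suc i) = itinerary (br.\<Psi> k y) i" for i by (simp add: Psi_Suc itinerary_Suc)
  have "\<not> itinerary (br.\<Psi> (Suc k) y) 0" using phi0_open[OF o] by (simp add: Psi_Suc itinerary_def)
  then have "\<not> itinerary (br.\<Psi> (Suc k) y) i" if "i < Suc k" for i using that Suc S by (cases i) auto
  then show ?case using Suc S by (simp add: S)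
qed

lemma ret_deriv_Suc: "br.\<l> (Suc k) y = d0 (br.\<Psi> k y) * br.\<l> k y" and ret_deriv_0: "br.\<l> 0 y = d1 y"
  by (simp_all add: ret_deriv_def chain_deriv_def ret_branch_def mult_ac)

text \<open>The chain rule in symbolic form: for the itinerary of \<open>\<Psi> k y\<close> the sum
  defining \<open>W\<close> has \<open>k\<close> terms from the first branch and a last one from the
  second, and the derivatives involved multiply to \<open>\<l> k y\<close>.\<close>

lemma W_Psi:
  assumes y: "y \<in> good" shows "W_pot F a (iota (itinerary (br.\<Psi> k y))) = ln (br.\<l> k y)"
proof -
  have y01: "0 < y" "y < 1" using good_unit[OF y] by auto
  have "tau (itinerary (br.\<Psi> k y)) 0 = Suc k"
    by (rule tau_cons(1)[OF good_Omega0[OF y]]) (use itinerary_Psi[OF y01, of k] in auto)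
  then have "W_Omega F a (itinerary (br.\<Psi> k y)) = (\<Sum>i<Suc k. V_pot F a (itinerary ((F ^^ i) (br.\<Psi> k y))))"
    unfolding W_Omega_def shift_itinerary by (simp only:)
  also have "\<dots> = ln (br.\<l> k y)"
  proof (induction k)
    case 0 show ?case using V_phi1[OF y01] by (simp add: Psi_0 ret_deriv_0)
  next
    case (Suc k)
    have o: "0 < br.\<Psi> k y" "br.\<Psi> k y < 1" using Psi_open[OF y01] by auto
    have F: "F (br.\<Psi> (Suc k) y) = br.\<Psi> k y" using F_phi0[of "br.\<Psi> k y"] o by (simp add: Psi_Suc)
    have "(\<Sum>i<Suc (Suc k). V_pot F a (itinerary ((F ^^ i) (br.\<Psi> (Suc k) y))))
      = V_pot F a (itinerary (br.\<Psi> (Suc k) y)) + (\<Sum>i<Suc k. V_pot F a (itinerary ((F ^^ Suc i) (br.\<Psi> (Suc k) y))))"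
      by (subst sum.lessThan_Suc_shift) simp
    also have "(\<Sum>i<Suc k. V_pot F a (itinerary ((F ^^ Suc i) (br.\<Psi> (Suc k) y)))) = ln (br.\<l> k y)"
      unfolding funpow_Suc_right comp_apply F by (rule Suc)
    also have "V_pot F a (itinerary (br.\<Psi> (Suc k) y)) = ln (d0 (br.\<Psi> k y))" unfolding Psi_Suc by (rule V_phi0[OF o])
    finally show ?case
      using d0_positive[of "br.\<Psi> k y"] br.l_pos[of y k] o y01 by (simp add: ret_deriv_Suc ln_mult)
  qed
  finally show ?thesis
    unfolding W_pot_def the_inv_into_f_f[OF iota_inj good_Omega0[OF good_Psi[OF y]]] .
qed

lemma iota_word:
  assumes "x \<in> good" "y \<in> good" "i < length w"
  shows "iota (itinerary (foldr br.\<Psi> w x)) i = iota (itinerary (foldr br.\<Psi> w y)) i"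
  using assms(3)
proof (induction w arbitrary: i)
  case (Cons k w)
  have 1: "iota (itinerary (br.\<Psi> k z)) 0 = Suc k" "iota (itinerary (br.\<Psi> k z)) (Suc j) = iota (itinerary z) j"
    if "z \<in> good" for z j
    using iota_cons[OF good_Omega0[OF that], of k "itinerary (br.\<Psi> k z)"] itinerary_Psi[of z k] good_unit[OF that] by auto
  show ?case
    using Cons 1[OF good_word[OF assms(1)]] 1[OF good_word[OF assms(2)]] by (cases i) auto
qed simp

text \<open>Points reached through the same word \<open>j # w\<close> have sequences sharing their
  first \<open>Suc (length w)\<close> symbols, and \<open>W\<close> of such a sequence is the
  logarithm of \<open>\<l> j\<close>. Hence (W1) is the distortion bound.\<close>

lemma good_distortion:
  obtains C where "0 < C" "\<And>x y j w. x \<in> good \<Longrightarrow> y \<in> good \<Longrightarrow>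
    br.\<l> j (foldr br.\<Psi> w x) \<le> exp (C * \<theta> ^ Suc (length w)) * br.\<l> j (foldr br.\<Psi> w y)"
proof -
  obtain C where C: "0 < C" "\<And>n. 1 \<le> n \<Longrightarrow>
        (SUP (\<sigma>, \<sigma>') \<in> {(\<sigma>, \<sigma>'). \<sigma> \<in> Sigma_space \<and> \<sigma>' \<in> Sigma_space \<and> \<sigma> \<noteq> \<sigma>' \<and>
                                 Inf {j. \<sigma> j \<noteq> \<sigma>' j} = n}.
           ereal \<bar>W_pot F a \<sigma> - W_pot F a \<sigma>'\<bar>) \<le> ereal (C * \<theta> ^ n)"
    using adm unfolding admissible_parabolic_map_def W1_def by blast
  have W: "\<bar>W_pot F a \<sigma> - W_pot F a \<sigma>'\<bar> \<le> C * \<theta> ^ n"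
    if "\<sigma> \<in> Sigma_space" "\<sigma>' \<in> Sigma_space" "\<sigma> \<noteq> \<sigma>'" "Inf {j. \<sigma> j \<noteq> \<sigma>' j} = n" "1 \<le> n" for \<sigma> \<sigma>' n
  proof -
    have "ereal \<bar>W_pot F a \<sigma> - W_pot F a \<sigma>'\<bar> \<le> ereal (C * \<theta> ^ n)"
      using C(2)[OF that(5)] that by (subst (asm) SUP_le_iff) auto
    then show ?thesis by simp
  qed
  show thesis
  proof (rule that[OF C(1)])
    fix x y j w assume g: "x \<in> good" "y \<in> good"
    let ?x = "foldr br.\<Psi> w x" and ?y = "foldr br.\<Psi> w y"
    have gw: "?x \<in> good" "?y \<in> good" using good_word g by auto
    have pos: "0 < br.\<l> j ?x" "0 < br.\<l> j ?y" using br.l_pos good_unit[OF gw(1)] good_unit[OF gw(2)] by auto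
    let ?s = "iota (itinerary (br.\<Psi> j ?x))" and ?t = "iota (itinerary (br.\<Psi> j ?y))"
    have in_S: "?s \<in> Sigma_space" "?t \<in> Sigma_space" using iota_in_Sigma good_Omega0 good_Psi gw by auto
    have "\<bar>W_pot F a ?s - W_pot F a ?t\<bar> \<le> C * \<theta> ^ Suc (length w)"
    proof (cases "?s = ?t")
      case True then show ?thesis using C(1) th by simp
    next
      case False
      \<comment> \<open>The sequences may agree for longer than the word prescribes; since \<theta>
        < 1 this only improves the bound.\<close>
      define n where "n = Inf {j. ?s j \<noteq> ?t j}"
      have "{j. ?s j \<noteq> ?t j} \<noteq> {}" using False by auto
      then have "?s n \<noteq> ?t n" using Inf_nat_def1[of "{j. ?s j \<noteq> ?t j}"] by (simp add: n_def)
      then have n: "Suc (length w) \<le> n" using iota_word[OF g, of n "j # w"] by (cases "n < Suc (length w)") auto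
      then have "\<bar>W_pot F a ?s - W_pot F a ?t\<bar> \<le> C * \<theta> ^ n" using W[OF in_S False] n_def by simp
      also have "\<dots> \<le> C * \<theta> ^ Suc (length w)" using n th C(1) by (intro mult_left_mono power_decreasing) auto
      finally show ?thesis .
    qed
    then have "ln (br.\<l> j ?x) \<le> C * \<theta> ^ Suc (length w) + ln (br.\<l> j ?y)"
      unfolding W_Psi[OF gw(1)] W_Psi[OF gw(2)] by linarith
    then have "exp (ln (br.\<l> j ?x)) \<le> exp (C * \<theta> ^ Suc (length w) + ln (br.\<l> j ?y))" by (simp only: exp_le_cancel_iff)
    then show "br.\<l> j ?x \<le> exp (C * \<theta> ^ Suc (length w)) * br.\<l> j ?y" using pos by (simp add: exp_add)
  qed
qed

text \<open>\<open>F\<close> is injective on each branch, so the preimages of 0 under all iterates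
  form a countable set, whose complement meets every nonempty open interval.\<close>

lemma good_dense: "closure good = {0..1}"
proof
  show "closure good \<subseteq> {0..1}" by (rule closure_minimal) (auto simp: good_def)
  have cnt: "countable {x \<in> {0..1}. (F ^^ i) x = 0}" for i
  proof (induction i)
    case 0
    have "{x \<in> {0..1}. (F ^^ 0) x = 0} \<subseteq> {0}" by auto
    then show ?case by (rule countable_subset) simp
  next
    case (Suc i)
    let ?N = "{x \<in> {0..1}. (F ^^ i) x = 0}"
    have sub: "countable {x \<in> S. F x \<in> ?N}" if "inj_on F S" for S
    proof (rule countable_image_inj_on)
      show "countable (F ` {x \<in> S. F x \<in> ?N})" by (rule countable_subset[OF _ Suc]) auto
      show "inj_on F {x \<in> S. F x \<in> ?N}" by (rule inj_on_subset[OF that]) auto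
    qed
    have "{x \<in> {0..1}. (F ^^ Suc i) x = 0} \<subseteq> {x \<in> {0..a}. F x \<in> ?N} \<union> {x \<in> {a<..1}. F x \<in> ?N}"
    proof
      fix x assume x: "x \<in> {x \<in> {0..1}. (F ^^ Suc i) x = 0}"
      then have "F x \<in> ?N" using F_in[of x] by (simp add: funpow_swap1)
      then show "x \<in> {x \<in> {0..a}. F x \<in> ?N} \<union> {x \<in> {a<..1}. F x \<in> ?N}" using x by auto
    qed
    then show ?case by (rule countable_subset) (intro countable_Un sub F_inj0 F_inj1)
  qed
  define N where "N = (\<Union>i. {x \<in> {0..1}. (F ^^ i) x = 0})"
  have N: "countable N" unfolding N_def using cnt by (intro countable_UN) auto
  have "{0<..<1} \<subseteq> closure good"
  proof
    fix x :: real assume x: "x \<in> {0<..<1}"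
    show "x \<in> closure good"
      unfolding closure_approachable
    proof (intro allI impI)
      fix e :: real assume "0 < e"
      then have "{0<..<1} \<inter> ball x e \<noteq> {}" using x by force
      then have "\<exists>y\<in>{0<..<1} \<inter> ball x e. y \<notin> N"
        by (rule open_minus_countable[OF N]) (intro open_Int open_greaterThanLessThan open_ball)
      then obtain y where y: "y \<in> {0<..<1} \<inter> ball x e" "y \<notin> N" by blast
      then have "y \<in> good" by (auto simp: good_def N_def)
      then show "\<exists>y\<in>good. dist y x < e" using y by (auto simp: dist_commute)
    qed
  qed
  then have "closure {0<..<1} \<subseteq> closure good" by (rule closure_minimal) simp
  then show "{0..1} \<subseteq> closure good" by simp
qed

lemma word_cont: "continuous_on {0..1} (foldr br.\<Psi> w) \<and> foldr br.\<Psi> w ` {0..1} \<subseteq> {0..1}"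
proof (induction w)
  case (Cons j w)
  have r: "br.\<Psi> j x \<in> {0..1}" if "x \<in> {0..1}" for x
    using br.Psi_range[OF that, of j] br.iter_unit[of 1 j] br.iter_unit[of 1 "Suc j"] by (simp del: funpow.simps)
  have "continuous_on {0..1} (\<lambda>x. br.\<Psi> j (foldr br.\<Psi> w x))"
    using Cons by (intro continuous_on_compose2[OF br.Psi_continuous]) auto
  moreover have "br.\<Psi> j (foldr br.\<Psi> w x) \<in> {0..1}" if "x \<in> {0..1}" for x using r Cons that by blast
  ultimately show ?case by (auto simp: comp_def)
qed (auto simp: id_def)

lemma full_distortion:
  obtains C where "0 < C" "\<And>x y j w. x \<in> {0..1} \<Longrightarrow> y \<in> {0..1} \<Longrightarrow>
    br.\<l> j (foldr br.\<Psi> w x) \<le> exp (C * \<theta> ^ Suc (length w)) * br.\<l> j (foldr br.\<Psi> w y)"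
proof -
  obtain C where C: "0 < C" "\<And>x y j w. x \<in> good \<Longrightarrow> y \<in> good \<Longrightarrow>
    br.\<l> j (foldr br.\<Psi> w x) \<le> exp (C * \<theta> ^ Suc (length w)) * br.\<l> j (foldr br.\<Psi> w y)"
    using good_distortion by blast
  show thesis
  proof (rule that[OF C(1)])
    fix x y :: real and j :: nat and w :: "nat list" assume x: "x \<in> {0..1}" and y: "y \<in> {0..1}"
    let ?E = "exp (C * \<theta> ^ Suc (length w))" and ?f = "\<lambda>x. br.\<l> j (foldr br.\<Psi> w x)"
    have cont: "continuous_on (closure good) ?f"
      unfolding good_dense using word_cont[of w] by (intro continuous_on_compose2[OF br.l_cont]) auto
    \<comment> \<open>The inequality is extended in one variable at a time: here \<open>x\<close> is
      arbitrary while the other point is still good.\<close>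
    have 1: "?f x \<le> ?E * ?f z" if "z \<in> good" for z
      by (rule continuous_le_on_closure[where f = ?f and S = good and x = x])
        (use cont x C(2)[OF _ that] good_dense in auto)
    show "?f x \<le> ?E * ?f y"
      by (rule continuous_ge_on_closure[where f = "\<lambda>z. ?E * ?f z" and S = good and x = y])
        (use cont y 1 good_dense in \<open>auto intro!: continuous_intros\<close>)
  qed
qed

theorem markov_hole_asymptotics:
  "\<exists>d>0. (\<lambda>N. escape_rate \<mu> F {0..a_seq F a N} / ereal (rate s d (a_seq F a N))) \<longlonglongrightarrow> 1"
proof -
  obtain C where C: "0 < C" "\<And>x y j w. x \<in> {0..1} \<Longrightarrow> y \<in> {0..1} \<Longrightarrow>
    br.\<l> j (foldr br.\<Psi> w x) \<le> exp (C * \<theta> ^ Suc (length w)) * br.\<l> j (foldr br.\<Psi> w y)"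
    using full_distortion by blast
  interpret sys: parabolic_system F \<phi>0 \<phi>1 d0 d1 a orient \<theta> C \<mu>
  proof
    show "H5 F \<mu>" using adm by (simp add: admissible_parabolic_map_def)
  qed (use th C in auto)
  show ?thesis
    unfolding a_seq_eq using sys.escape_asymptotics[OF s_pos a_seq_asymp] s_pos c_pos by simp
qed

end

theorem theorem3p6:
  fixes F :: "real \<Rightarrow> real" and a c s \<theta> :: real and r :: enat and \<mu> :: "real measure"
  assumes "admissible_parabolic_map F a r c s \<theta> \<mu>"
  shows "\<exists>c\<^sub>s>0.
    (\<lambda>N. let H = markov_hole F a N; m = measure lborel H in
         escape_rate \<mu> F H /
         ereal (if s < 1 then c\<^sub>s * m
                else if s = 1 then c\<^sub>s * (m / (- ln m))
                else c\<^sub>s * m powr s))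
    \<longlonglongrightarrow> 1"
proof -
  interpret admissible F a c s \<theta> r \<mu> by unfold_locales (rule assms)
  have m: "measure lborel {0..a_seq F a N} = a_seq F a N" for N
    using br.iter_unit[of 1 N] by (simp add: a_seq_eq)
  from markov_hole_asymptotics show ?thesis
    unfolding markov_hole_def Let_def m rate_def .
qed

end
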